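(* Let $Z\to\mathbb{P}^1$ be a twistor space in the Gibbons-Hawking class and let $(M,g)$ be its associated moduli space with $$g=V^{-1}(dt+A)^2+V\left(dz^2+d\xi\,d\tilde\xi\right),$$ where the Gibbons-Hawking potential $V$ satisfies $dV=\star^3dA$. On twistor lines satisfying $V=0$ the normal bundle is $\mathcal O\oplus\mathcal O(2)$, and the twistor-induced local geometry (on the hypersurface $V=0$ of the space of twistor lines) is that of a (generically torsional) $(2+1)$-dimensional Newton-Cartan spacetime, provided that the restriction to $V=0$ of the flat three-metric $dz^2+d\xi\,d\tilde\xi$ is of rank two.
   Context: Cover $\mathbb{P}^1$ by $U,\hat U$ with coordinates $\lambda$ and $\hat\lambda=\lambda^{-1}$. A twistor space is in the Gibbons-Hawking class if it is a (Penrose) twistor space, i.e. a complex three-fold whose generic twistor lines have normal bundle $\mathcal O(1)\oplus\mathcal O(1)$, admitting a fibration over $\mathcal O(2)$: it has fibre coordinates $w=(T,Q)$, $\hat w=(\hat T,\hat Q)$ with patching $\hat T=T+f(Q,\lambda)$, $\hat Q=\lambda^{-2}Q$. Twistor lines are the global sections of $Z\to\mathbb{P}^1$: $Q|=\xi\lambda^2-2z\lambda-\tilde\xi$, $T|=t-h$, where $f|=h-\hat h$ with $h$, $\hat h$ holomorphic over $U$, $\hat U$; so $(t,\xi,\tilde\xi,z)$ are coordinates on the space of twistor lines, which includes the lines with $V=0$ (where $g$ itself is singular). A vertical slash denotes restriction to a twistor line. Writing $\frac{\partial f}{\partial Q}|=\sum_n\gamma_n\lambda^n$, the potential $V$ is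 (up to a non-zero constant) $\gamma_{-1}$. All objects are holomorphic; $\star^3$ is the Hodge star of $dz^2+d\xi d\tilde\xi$. Twistor-induced geometry: on the lines $V=0$, with normal bundle patching $\mathcal F^\mu_{\ \nu}=\frac{\partial\hat w^\mu}{\partial w^\nu}|=\hat H\,\mathrm{diag}(1,\lambda^{-2})H^{-1}$ ($H$, $\hat H$ holomorphic maps to $\mathrm{GL}(2,\mathbb{C})$ from $U$, $\hat U$, defined up to global sections of $N_x\otimes N_x^*$), the frame section is $v=H^{-1}dw|$. Restricted to the hypersurface $V=0$, its first component is a one-form $\theta$, the clock, and the coefficients of its second component $e^{0'0'}\lambda^2-2e^{0'1'}\lambda-e^{1'1'}$ give the (conformal) spatial metric, the restriction of $(e^{0'1'})^2+e^{0'0'}e^{1'1'}$. A $(2+1)$-dimensional (complex) Newton-Cartan spacetime consists of a three-manifold with a clock one-form $\theta$, a symmetric contravariant metric of rank two whose kernel is spanned by $\theta$ (equivalently a metric on the two-dimensional spatial distribution $\ker\theta$), and a compatible affine connection; it is torsional if the connection is allowed torsion, which is manifested by $d\theta\ne0$. "Generically torsional" means that $d\theta$ does not generically vanish. *)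

theory Defs
  imports "HOL-Analysis.Analysis"
begin

section \<open>Holomorphic calculus in several variables\<close>

definition pair :: "complex^'n \<Rightarrow> complex^'n \<Rightarrow> complex" where
  "pair \<alpha> v = (\<Sum>i\<in>UNIV. \<alpha> $ i * v $ i)"

text \<open>Holomorphic means complex Frechet differentiable: the real derivative, which is what
  \<open>has_derivative\<close> speaks of, is complex linear.\<close>

definition holo_on :: "(complex^'n \<Rightarrow> complex) \<Rightarrow> (complex^'n) set \<Rightarrow> bool" where
  "holo_on F S \<longleftrightarrow> open S \<and> (\<forall>x\<in>S. \<exists>a. (F has_derivative pair a) (at x))"

text \<open>The same for functions of \<open>(x, l)\<close>, jointly in both arguments.\<close>

definition holo_family_on ::
  "(complex^'n \<Rightarrow> complex \<Rightarrow> complex) \<Rightarrow> (complex^'n) set \<Rightarrow> complex set \<Rightarrow> bool" where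
  "holo_family_on F S U \<longleftrightarrow> open S \<and> open U \<and>
     (\<forall>x\<in>S. \<forall>l\<in>U. \<exists>a b.
        ((\<lambda>(y, m). F y m) has_derivative (\<lambda>(v, m). pair a v + b * m)) (at (x, l)))"

definition cpartial :: "'n \<Rightarrow> (complex^'n \<Rightarrow> complex) \<Rightarrow> complex^'n \<Rightarrow> complex" where
  "cpartial i F x = deriv (\<lambda>s. F (x + s *s axis i 1)) 0"

definition cjacobian :: "(complex^'n \<Rightarrow> complex^'m) \<Rightarrow> complex^'n \<Rightarrow> complex^'n^'m" where
  "cjacobian F x = (\<chi> i j. cpartial j (\<lambda>y. F y $ i) x)"

definition differential :: "(complex^'n \<Rightarrow> complex) \<Rightarrow> complex^'n \<Rightarrow> complex^'n" where
  "differential F x = (\<chi> i. cpartial i F x)"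

text \<open>A one-form is given by its components; \<open>ext_d\<close> is the antisymmetric matrix of components
  of its exterior derivative.\<close>

definition ext_d :: "(complex^'n \<Rightarrow> complex^'n) \<Rightarrow> complex^'n \<Rightarrow> complex^'n^'n" where
  "ext_d \<alpha> x = (\<chi> i j. cpartial i (\<lambda>y. \<alpha> y $ j) x - cpartial j (\<lambda>y. \<alpha> y $ i) x)"


section \<open>Twistor spaces in the Gibbons-Hawking class\<close>

text \<open>\<open>U\<close> is a disc (or the plane) in the coordinate \<open>\<lambda>\<close>, \<open>U'\<close> is a disc (or the plane) in the
  coordinate \<open>1/\<lambda>\<close>, and together they cover the Riemann sphere. Functions on the second set are
  always written in the coordinate \<open>1/\<lambda>\<close>. Taking \<open>r = s = 0\<close> gives the two standard affine
  charts.\<close>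

definition sphere_cover :: "complex set \<Rightarrow> complex set \<Rightarrow> bool" where
  "sphere_cover U U' \<longleftrightarrow> (\<exists>r s::real. 0 \<le> r \<and> 0 \<le> s \<and> r * s < 1 \<and>
      U = {l. s * norm l < 1} \<and> U' = {m. r * norm m < 1})"

definition overlap :: "complex set \<Rightarrow> complex set \<Rightarrow> complex set" where
  "overlap U U' = {l \<in> U. l \<noteq> 0 \<and> inverse l \<in> U'}"

text \<open>The patching \<open>(T, Q) \<mapsto> (T + f(Q, \<lambda>), \<lambda>\<^sup>-\<^sup>2 Q)\<close> of the fibre coordinates.\<close>

definition patching :: "(complex \<Rightarrow> complex \<Rightarrow> complex) \<Rightarrow> complex \<Rightarrow> complex^2 \<Rightarrow> complex^2" where
  "patching f l w = vector [w $ 1 + f (w $ 2) l, w $ 2 / l^2]"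

text \<open>A point of the space of twistor lines is \<open>(t, \<xi>, \<xi>~, z)\<close>; \<open>space_part\<close> is \<open>(\<xi>, \<xi>~, z)\<close>.\<close>

definition space_part :: "complex^4 \<Rightarrow> complex^3" where
  "space_part p = vector [p $ 2, p $ 3, p $ 4]"

definition Q_section :: "complex^3 \<Rightarrow> complex \<Rightarrow> complex" where
  "Q_section x l = x $ 1 * l^2 - 2 * x $ 3 * l - x $ 2"

text \<open>The twistor line \<open>p\<close> in the fibre coordinates over \<open>U\<close> and over \<open>U'\<close>; here
  \<open>h\<close>, \<open>h'\<close> is a splitting of \<open>f\<close> along the lines.\<close>

definition line :: "(complex^3 \<Rightarrow> complex \<Rightarrow> complex) \<Rightarrow> complex^4 \<Rightarrow> complex \<Rightarrow> complex^2" where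
  "line h p l = vector [p $ 1 - h (space_part p) l, Q_section (space_part p) l]"

definition line' :: "(complex^3 \<Rightarrow> complex \<Rightarrow> complex) \<Rightarrow> complex^4 \<Rightarrow> complex \<Rightarrow> complex^2" where
  "line' h' p m = vector [p $ 1 - h' (space_part p) m, p $ 2 - 2 * p $ 4 * m - p $ 3 * m^2]"

definition normal_patching ::
  "(complex \<Rightarrow> complex \<Rightarrow> complex) \<Rightarrow> (complex^3 \<Rightarrow> complex \<Rightarrow> complex) \<Rightarrow> complex^4 \<Rightarrow> complex
     \<Rightarrow> complex^2^2" where
  "normal_patching f h p l = cjacobian (patching f l) (line h p l)"

text \<open>\<open>H\<close>, \<open>H'\<close> are frames over \<open>U\<close>, \<open>U'\<close> that bring the patching of the normal bundle of the
  line \<open>p\<close> to that of \<open>O(a) + O(b)\<close>.\<close>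

definition splitting_frames ::
  "complex set \<Rightarrow> complex set \<Rightarrow> (complex \<Rightarrow> complex \<Rightarrow> complex) \<Rightarrow> (complex^3 \<Rightarrow> complex \<Rightarrow> complex)
     \<Rightarrow> complex^4 \<Rightarrow> int \<Rightarrow> int \<Rightarrow> (complex \<Rightarrow> complex^2^2) \<Rightarrow> (complex \<Rightarrow> complex^2^2) \<Rightarrow> bool" where
  "splitting_frames U U' f h p a b H H' \<longleftrightarrow>
     (\<forall>i j. (\<lambda>l. H l $ i $ j) holomorphic_on U) \<and> (\<forall>l\<in>U. invertible (H l)) \<and>
     (\<forall>i j. (\<lambda>m. H' m $ i $ j) holomorphic_on U') \<and> (\<forall>m\<in>U'. invertible (H' m)) \<and>
     (\<forall>l\<in>overlap U U'. normal_patching f h p l =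
        H' (inverse l) ** vector [vector [l powi (- a), 0], vector [0, l powi (- b)]]
          ** matrix_inv (H l))"

definition normal_bundle ::
  "complex set \<Rightarrow> complex set \<Rightarrow> (complex \<Rightarrow> complex \<Rightarrow> complex) \<Rightarrow> (complex^3 \<Rightarrow> complex \<Rightarrow> complex)
     \<Rightarrow> complex^4 \<Rightarrow> int \<Rightarrow> int \<Rightarrow> bool" where
  "normal_bundle U U' f h p a b \<longleftrightarrow> (\<exists>H H'. splitting_frames U U' f h p a b H H')"

definition lines :: "(complex^3) set \<Rightarrow> (complex^4) set" where
  "lines X = {p. space_part p \<in> X}"

text \<open>The twistor space is glued by \<open>f\<close>, defined for \<open>(Q, \<lambda>)\<close> in the open set \<open>D\<close>. The region \<open>X\<close>
  is an open set of parameters \<open>(\<xi>, \<xi>~, z)\<close> whose curves stay in \<open>D\<close> over the overlap; \<open>t\<close> is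
  unconstrained because the patching is invariant under translations of \<open>T\<close>. The last condition
  says that generic lines have normal bundle \<open>O(1) + O(1)\<close>.\<close>

definition gh_twistor_space ::
  "complex set \<Rightarrow> complex set \<Rightarrow> (complex^2) set \<Rightarrow> (complex \<Rightarrow> complex \<Rightarrow> complex)
     \<Rightarrow> (complex^3) set \<Rightarrow> (complex^3 \<Rightarrow> complex \<Rightarrow> complex) \<Rightarrow> (complex^3 \<Rightarrow> complex \<Rightarrow> complex)
     \<Rightarrow> bool" where
  "gh_twistor_space U U' D f X h h' \<longleftrightarrow>
     sphere_cover U U' \<and>
     D \<subseteq> {q. q $ 2 \<in> overlap U U'} \<and> holo_on (\<lambda>q. f (q $ 1) (q $ 2)) D \<and>
     open X \<and> (\<forall>x\<in>X. \<forall>l\<in>overlap U U'. vector [Q_section x l, l] \<in> D) \<and>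
     holo_family_on h X U \<and> holo_family_on h' X U' \<and>
     (\<forall>x\<in>X. \<forall>l\<in>overlap U U'. f (Q_section x l) l = h x l - h' x (inverse l)) \<and>
     lines X \<subseteq> closure {p \<in> lines X. normal_bundle U U' f h p 1 1}"


section \<open>The Gibbons-Hawking geometry\<close>

text \<open>\<open>V\<close> is a non-zero constant multiple of the coefficient of \<open>1/\<lambda>\<close> in the Laurent series of
  \<open>\<partial>f/\<partial>Q\<close> along the line.\<close>

definition gh_potential ::
  "complex set \<Rightarrow> complex set \<Rightarrow> (complex \<Rightarrow> complex \<Rightarrow> complex) \<Rightarrow> (complex^3) set
     \<Rightarrow> (complex^3 \<Rightarrow> complex) \<Rightarrow> bool" where
  "gh_potential U U' f X V \<longleftrightarrow> (\<exists>c (\<gamma> :: int \<Rightarrow> complex^3 \<Rightarrow> complex). c \<noteq> 0 \<and>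
     (\<forall>x\<in>X. \<forall>l\<in>overlap U U'.
        ((\<lambda>n. \<gamma> n x * l powi n) has_sum deriv (\<lambda>Q. f Q l) (Q_section x l)) UNIV) \<and>
     (\<forall>x\<in>X. V x = c * \<gamma> (- 1) x))"

text \<open>\<open>dz\<^sup>2 + d\<xi> d\<xi>~\<close> in the coordinates \<open>(\<xi>, \<xi>~, z)\<close>.\<close>

definition flat3 :: "complex^3^3" where
  "flat3 = vector [vector [0, 1/2, 0], vector [1/2, 0, 0], vector [0, 0, 1]]"

text \<open>The Hodge star from two-forms to one-forms on the flat three-space. The parameter \<open>s\<close> is a
  square root of \<open>det flat3\<close>; over the complex numbers neither root is preferred, and the choice is
  the choice of orientation.\<close>

definition star3 :: "complex \<Rightarrow> complex^3^3 \<Rightarrow> complex^3" where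
  "star3 s \<omega> = (\<chi> i. s / 2 * (\<Sum>j\<in>UNIV. \<Sum>k\<in>UNIV.
      det (vector [axis i 1, axis j 1, axis k 1] :: complex^3^3)
        * (matrix_inv flat3 ** \<omega> ** matrix_inv flat3) $ j $ k))"

definition gh_metric ::
  "(complex^3 \<Rightarrow> complex) \<Rightarrow> (complex^3 \<Rightarrow> complex^3) \<Rightarrow> complex^4 \<Rightarrow> complex^4 \<Rightarrow> complex^4 \<Rightarrow> complex"
  where
  "gh_metric V A p Y Z = (let x = space_part p in
     inverse (V x) * (Y $ 1 + pair (A x) (space_part Y)) * (Z $ 1 + pair (A x) (space_part Z))
     + V x * pair (space_part Y) (flat3 *v space_part Z))"

text \<open>The metric induced on the lines with \<open>V \<noteq> 0\<close>, up to a conformal factor: a tangent vector is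
  null iff the section of the normal bundle that it defines vanishes somewhere.\<close>

definition twistor_conformal_metric ::
  "complex set \<Rightarrow> complex set \<Rightarrow> (complex^3) set \<Rightarrow> (complex^3 \<Rightarrow> complex \<Rightarrow> complex)
     \<Rightarrow> (complex^3 \<Rightarrow> complex \<Rightarrow> complex) \<Rightarrow> (complex^3 \<Rightarrow> complex)
     \<Rightarrow> (complex^4 \<Rightarrow> complex^4 \<Rightarrow> complex^4 \<Rightarrow> complex) \<Rightarrow> bool" where
  "twistor_conformal_metric U U' X h h' V g \<longleftrightarrow>
     (\<forall>p\<in>lines X. V (space_part p) \<noteq> 0 \<longrightarrow> (\<forall>Y. g p Y Y = 0 \<longleftrightarrow>
        (\<exists>l\<in>U. cjacobian (\<lambda>q. line h q l) p *v Y = 0) \<or>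
        (\<exists>m\<in>U'. cjacobian (\<lambda>q. line' h' q m) p *v Y = 0)))"

text \<open>\<open>V\<close>, \<open>A\<close> are Gibbons-Hawking data for the metric on the space of twistor lines.\<close>

definition gh_moduli_space ::
  "complex set \<Rightarrow> complex set \<Rightarrow> (complex \<Rightarrow> complex \<Rightarrow> complex) \<Rightarrow> (complex^3) set
     \<Rightarrow> (complex^3 \<Rightarrow> complex \<Rightarrow> complex) \<Rightarrow> (complex^3 \<Rightarrow> complex \<Rightarrow> complex)
     \<Rightarrow> (complex^3 \<Rightarrow> complex) \<Rightarrow> (complex^3 \<Rightarrow> complex^3) \<Rightarrow> bool" where
  "gh_moduli_space U U' f X h h' V A \<longleftrightarrow>
     gh_potential U U' f X V \<and>
     (\<forall>i. holo_on (\<lambda>x. A x $ i) X) \<and>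
     (\<exists>s. s^2 = det flat3 \<and> (\<forall>x\<in>X. differential V x = star3 s (ext_d A x))) \<and>
     twistor_conformal_metric U U' X h h' V (gh_metric V A)"


section \<open>The hypersurface \<open>V = 0\<close> and its twistor-induced geometry\<close>

text \<open>A holomorphic local parametrisation of a hypersurface in the four-dimensional space of
  lines.\<close>

definition hypersurface_chart ::
  "(complex^4) set \<Rightarrow> (complex^3) set \<Rightarrow> (complex^3 \<Rightarrow> complex^4) \<Rightarrow> bool" where
  "hypersurface_chart S \<Omega> \<phi> \<longleftrightarrow>
     (\<forall>i. holo_on (\<lambda>u. \<phi> u $ i) \<Omega>) \<and> (\<forall>u\<in>\<Omega>. rank (cjacobian \<phi> u) = 3) \<and>
     openin (top_of_set S) (\<phi> ` \<Omega>) \<and> (\<exists>\<psi>. homeomorphism \<Omega> (\<phi> ` \<Omega>) \<phi> \<psi>)"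

text \<open>The components of the restriction of the flat three-metric to the hypersurface.\<close>

definition restricted_flat3 :: "(complex^3 \<Rightarrow> complex^4) \<Rightarrow> complex^3 \<Rightarrow> complex^3^3" where
  "restricted_flat3 \<phi> u = (let J = cjacobian (\<lambda>u. space_part (\<phi> u)) u in
     transpose J ** flat3 ** J)"

text \<open>Frames for the normal bundles \<open>O + O(2)\<close> of the lines of the hypersurface, depending
  holomorphically on the line.\<close>

definition jumping_frames ::
  "complex set \<Rightarrow> complex set \<Rightarrow> (complex \<Rightarrow> complex \<Rightarrow> complex) \<Rightarrow> (complex^3 \<Rightarrow> complex \<Rightarrow> complex)
     \<Rightarrow> (complex^3) set \<Rightarrow> (complex^3 \<Rightarrow> complex^4) \<Rightarrow> (complex^3 \<Rightarrow> complex \<Rightarrow> complex^2^2)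
     \<Rightarrow> (complex^3 \<Rightarrow> complex \<Rightarrow> complex^2^2) \<Rightarrow> bool" where
  "jumping_frames U U' f h \<Omega> \<phi> H H' \<longleftrightarrow>
     (\<forall>i j. holo_family_on (\<lambda>u l. H u l $ i $ j) \<Omega> U) \<and>
     (\<forall>i j. holo_family_on (\<lambda>u m. H' u m $ i $ j) \<Omega> U') \<and>
     (\<forall>u\<in>\<Omega>. splitting_frames U U' f h (\<phi> u) 0 2 (H u) (H' u))"

text \<open>The frame section \<open>v = H\<^sup>-\<^sup>1 dw\<close> on the hypersurface, evaluated on a tangent vector \<open>Y\<close>.\<close>

definition frame_section ::
  "(complex^3 \<Rightarrow> complex \<Rightarrow> complex) \<Rightarrow> (complex^3 \<Rightarrow> complex^4) \<Rightarrow> (complex^3 \<Rightarrow> complex \<Rightarrow> complex^2^2)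
     \<Rightarrow> complex^3 \<Rightarrow> complex \<Rightarrow> complex^3 \<Rightarrow> complex^2" where
  "frame_section h \<phi> H u l Y =
     matrix_inv (H u l) *v (cjacobian (\<lambda>u. line h (\<phi> u) l) u *v Y)"

text \<open>The one-forms read off from the components of \<open>v\<close>: the clock \<open>\<theta>\<close> from the first, and
  \<open>e00\<close>, \<open>e01\<close>, \<open>e11\<close> (that is, \<open>e\<^sup>0\<^sup>'\<^sup>0\<^sup>'\<close> etc.) from the second.\<close>

definition twistor_induced ::
  "complex set \<Rightarrow> (complex^3 \<Rightarrow> complex \<Rightarrow> complex) \<Rightarrow> (complex^3) set \<Rightarrow> (complex^3 \<Rightarrow> complex^4)
     \<Rightarrow> (complex^3 \<Rightarrow> complex \<Rightarrow> complex^2^2) \<Rightarrow> (complex^3 \<Rightarrow> complex^3) \<Rightarrow> (complex^3 \<Rightarrow> complex^3)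
     \<Rightarrow> (complex^3 \<Rightarrow> complex^3) \<Rightarrow> (complex^3 \<Rightarrow> complex^3) \<Rightarrow> bool" where
  "twistor_induced U h \<Omega> \<phi> H \<theta> e00 e01 e11 \<longleftrightarrow>
     (\<forall>u\<in>\<Omega>. \<forall>l\<in>U. \<forall>Y.
        frame_section h \<phi> H u l Y $ 1 = pair (\<theta> u) Y \<and>
        frame_section h \<phi> H u l Y $ 2 =
          pair (e00 u) Y * l^2 - 2 * pair (e01 u) Y * l - pair (e11 u) Y)"

text \<open>The symmetric bilinear form \<open>e01\<^sup>2 + e00 e11\<close>.\<close>

definition triad_metric ::
  "complex^3 \<Rightarrow> complex^3 \<Rightarrow> complex^3 \<Rightarrow> complex^3 \<Rightarrow> complex^3 \<Rightarrow> complex" where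
  "triad_metric e00 e01 e11 Y Z =
     pair e01 Y * pair e01 Z + (pair e00 Y * pair e11 Z + pair e00 Z * pair e11 Y) / 2"

text \<open>The contravariant metric \<open>k\<close> corresponds to the metric \<open>q\<close> on \<open>ker \<theta>\<close>: raising an index with
  \<open>k\<close> inverts lowering it with \<open>q\<close>.\<close>

definition inverse_spatial_metric ::
  "(complex^3) set \<Rightarrow> (complex^3 \<Rightarrow> complex^3)
     \<Rightarrow> (complex^3 \<Rightarrow> complex^3 \<Rightarrow> complex^3 \<Rightarrow> complex) \<Rightarrow> (complex^3 \<Rightarrow> complex^3^3) \<Rightarrow> bool" where
  "inverse_spatial_metric \<Omega> \<theta> q k \<longleftrightarrow>
     (\<forall>u\<in>\<Omega>. \<forall>\<alpha>. pair (\<theta> u) (k u *v \<alpha>) = 0 \<and>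
        (\<forall>Y. pair (\<theta> u) Y = 0 \<longrightarrow> q u (k u *v \<alpha>) Y = pair \<alpha> Y))"


section \<open>Newton-Cartan spacetimes\<close>

text \<open>A (2+1)-dimensional complex Newton-Cartan structure on a coordinate patch \<open>\<Omega>\<close>. The connection
  is \<open>\<nabla>\<^sub>i Y\<^sup>j = \<partial>\<^sub>i Y\<^sup>j + \<Gamma>\<^sup>j\<^sub>i\<^sub>l Y\<^sup>l\<close> with \<open>\<Gamma>\<^sup>j\<^sub>i\<^sub>l\<close> written \<open>\<Gamma> u $ j $ i $ l\<close>. No symmetry in \<open>i\<close>, \<open>l\<close> is
  imposed: torsion is allowed. The last two clauses are \<open>\<nabla>\<theta> = 0\<close> and \<open>\<nabla>k = 0\<close>.\<close>

definition newton_cartan ::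
  "(complex^3) set \<Rightarrow> (complex^3 \<Rightarrow> complex^3) \<Rightarrow> (complex^3 \<Rightarrow> complex^3^3)
     \<Rightarrow> (complex^3 \<Rightarrow> complex^3^3^3) \<Rightarrow> bool" where
  "newton_cartan \<Omega> \<theta> k \<Gamma> \<longleftrightarrow>
     (\<forall>i. holo_on (\<lambda>u. \<theta> u $ i) \<Omega>) \<and>
     (\<forall>i j. holo_on (\<lambda>u. k u $ i $ j) \<Omega>) \<and>
     (\<forall>i j l. holo_on (\<lambda>u. \<Gamma> u $ i $ j $ l) \<Omega>) \<and>
     (\<forall>u\<in>\<Omega>. transpose (k u) = k u \<and> rank (k u) = 2 \<and> {\<alpha>. k u *v \<alpha> = 0} = vec.span {\<theta> u}) \<and>
     (\<forall>u\<in>\<Omega>. \<forall>i j.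
        cpartial i (\<lambda>y. \<theta> y $ j) u - (\<Sum>l\<in>UNIV. \<Gamma> u $ l $ i $ j * \<theta> u $ l) = 0) \<and>
     (\<forall>u\<in>\<Omega>. \<forall>i j m.
        cpartial i (\<lambda>y. k y $ j $ m) u
          + (\<Sum>l\<in>UNIV. \<Gamma> u $ j $ i $ l * k u $ l $ m)
          + (\<Sum>l\<in>UNIV. \<Gamma> u $ m $ i $ l * k u $ j $ l) = 0)"

text \<open>The clock is not closed at generic points; a torsion-free connection preserving \<open>\<theta>\<close> would
  force \<open>d\<theta> = 0\<close>.\<close>

definition generically_torsional ::
  "(complex^3) set \<Rightarrow> (complex^3 \<Rightarrow> complex^3) \<Rightarrow> bool" where
  "generically_torsional \<Omega> \<theta> \<longleftrightarrow> \<Omega> \<subseteq> closure {u \<in> \<Omega>. ext_d \<theta> u \<noteq> 0}"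

end

theory Submission
  imports Defs "HOL-Complex_Analysis.Cauchy_Integral_Formula"
begin

text \<open>Differentiating the splitting of \<open>f\<close> along the lines splits \<open>\<partial>f/\<partial>Q\<close>, and on \<open>V = 0\<close> this gives
  explicit triangular frames of the normal bundle; by Liouville's theorem all other frames differ from
  them by constants \<open>a\<close>, \<open>b\<close> and a section \<open>s\<close> of \<open>O(2)\<close>. Hence the clock is \<open>\<theta>\<^sub>0 / a\<close> for a fixed form
  \<open>\<theta>\<^sub>0 = dt + \<dots>\<close>, and \<open>e00\<close>, \<open>e01\<close>, \<open>e11\<close> are \<open>d\<xi> / b\<close>, \<open>dz / b\<close>, \<open>d\<xi>~ / b\<close> modulo \<open>\<theta>\<^sub>0\<close>. The kernel of the
  restricted flat metric is transverse to \<open>ker \<theta>\<^sub>0\<close>, which yields the contravariant metric and a compatible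
  connection in closed form. Finally \<open>d\<theta>\<^sub>0\<close> is a multiple of the restriction of the Hodge dual of \<open>dV\<close>. If
  the clock were closed on an open set, then \<open>\<theta>\<^sub>0 \<and> d\<theta>\<^sub>0 = 0\<close> there, so that \<open>dV\<close> would be null and hence
  zero on a non-null surface \<open>V = 0\<close>; with these Cauchy data the harmonic function \<open>V\<close> would
  vanish near it, although generic lines have normal bundle \<open>O(1) + O(1)\<close>.\<close>

section \<open>Circle integrals depending on a parameter\<close>

text \<open>The potential, its companion \<gamma>_0 and their derivatives are integrals over one
  fixed circle of a weight times a Q-derivative of f along the line. A derivative in direction v
  multiplies the weight by Q_v, which is l^2, -1 or -2l for the coordinate directions. Two relations
  between these monomials carry the torsion argument: dividing l^2 and -2l by l gives multiples of
  -2l and -1, so that d\<gamma>_0 is a Hodge dual of dV modulo d\<xi>~; and (-2l)^2 = -4 (l^2)(-1)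
  is the Laplace equation. The frames are arbitrary, so the clock is fixed only up to a nowhere
  vanishing factor, and non-closedness must be shown for all factors at once. The kernel direction
  of the restricted metric is d/dt: V does not depend on t, so the hypersurface is invariant under
  t-translations. Uniqueness for Cauchy data is obtained from Taylor coefficients at one point of
  the surface and the identity theorem on complex lines through that point.\<close>

lemma circle_integral:
  "contour_integral (circlepath z r) g =
     integral (cbox 0 1) (\<lambda>t. g (circlepath z r t) * vector_derivative (circlepath z r) (at t))"
  by (simp add: contour_integral_integral cbox_interval)

lemma circlepath_in_sphere: "0 \<le> r \<Longrightarrow> t \<in> {0..1} \<Longrightarrow> circlepath z r t \<in> sphere z r"
  by (metis path_image_circlepath_nonneg path_image_def image_eqI)

lemma continuous_on_circle_integrand:
  assumes "continuous_on (S \<times> sphere z r) (\<lambda>(x, y). K x y)" "0 \<le> r"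
  shows "continuous_on (S \<times> cbox 0 1)
    (\<lambda>(x, t). K x (circlepath z r t) * vector_derivative (circlepath z r) (at t))"
proof -
  have c: "continuous_on (S \<times> cbox 0 1) (\<lambda>p. circlepath z r (snd p))"
    unfolding circlepath by (intro continuous_intros)
  have "continuous_on (S \<times> cbox 0 1) (\<lambda>p. (\<lambda>(x, y). K x y) (fst p, circlepath z r (snd p)))"
    by (rule continuous_on_compose2[OF assms(1) continuous_on_Pair[OF continuous_on_fst[OF continuous_on_id] c]])
      (auto simp del: mem_sphere simp: circlepath_in_sphere assms(2))
  moreover have "continuous_on (S \<times> cbox 0 1)
      (\<lambda>p. vector_derivative (circlepath z r) (at (snd p)))"
    by (simp add: vector_derivative_circlepath) (intro continuous_intros)
  ultimately show ?thesis
    by (simp add: split_beta continuous_on_mult)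
qed

lemma continuous_on_circle_integral:
  assumes "continuous_on (S \<times> sphere z r) (\<lambda>(x, y). K x y)" "0 \<le> r"
  shows "continuous_on S (\<lambda>x. contour_integral (circlepath z r) (K x))"
  unfolding circle_integral
  by (rule integral_continuous_on_param) (rule continuous_on_circle_integrand[OF assms])

text \<open>\<open>leibniz_rule\<close> asks for a derivative that is continuous as a bounded
  operator. In a Euclidean space this can be tested on one vector at a time, hence the form of the
  last assumption.\<close>

lemma has_derivative_circle_integral:
  fixes K :: "'a::euclidean_space \<Rightarrow> complex \<Rightarrow> complex"
  assumes "open S" "x0 \<in> S" "0 \<le> r"
    and der: "\<And>x y. x \<in> S \<Longrightarrow> y \<in> sphere z r \<Longrightarrow> ((\<lambda>x. K x y) has_derivative D x y) (at x)"
    and K: "\<And>x. x \<in> S \<Longrightarrow> continuous_on (sphere z r) (K x)"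
    and D: "\<And>v. continuous_on (S \<times> sphere z r) (\<lambda>(x, y). D x y v)"
  shows "((\<lambda>x. contour_integral (circlepath z r) (K x)) has_derivative
           (\<lambda>v. contour_integral (circlepath z r) (\<lambda>y. D x0 y v))) (at x0)"
proof -
  obtain e where e: "e > 0" "ball x0 e \<subseteq> S"
    using assms(1,2) openE by blast
  let ?U = "ball x0 e"
  let ?w = "\<lambda>t. vector_derivative (circlepath z r) (at t)"
  let ?c = "circlepath z r"
  let ?f = "\<lambda>x t. K x (?c t) * ?w t"
  have derw: "((\<lambda>x. ?f x t) has_derivative (\<lambda>v. D x (?c t) v * ?w t)) (at x)"
    if "x \<in> ?U" "t \<in> cbox 0 1" for x t
    using that e(2) circlepath_in_sphere[OF assms(3), of t z]
    by (auto intro!: derivative_intros der simp del: mem_sphere)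
  define fx where "fx x t = Blinfun (\<lambda>v. D x (?c t) v * ?w t)" for x t
  have fx: "blinfun_apply (fx x t) = (\<lambda>v. D x (?c t) v * ?w t)" if "x \<in> ?U" "t \<in> cbox 0 1" for x t
    unfolding fx_def
    by (rule bounded_linear_Blinfun_apply[OF has_derivative_bounded_linear[OF derw[OF that]]])
  have cont: "continuous_on (?U \<times> cbox 0 1) (\<lambda>(x, t). D x (?c t) v * ?w t)" for v
    by (rule continuous_on_subset[OF continuous_on_circle_integrand[OF D assms(3), of v]])
      (use e(2) in auto)
  have cfx: "continuous_on (?U \<times> cbox 0 1) (\<lambda>(x, t). fx x t)"
  proof (rule continuous_on_blinfun_componentwise)
    fix v :: 'a
    show "continuous_on (?U \<times> cbox 0 1) (\<lambda>p. (case p of (x, t) \<Rightarrow> fx x t) v)"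
      using cont[of v] by (rule continuous_on_eq) (auto simp del: mem_ball box_real simp: fx)
  qed
  have int1: "(\<lambda>t. ?f x t) integrable_on cbox 0 1" if "x \<in> ?U" for x
  proof (rule integrable_continuous)
    have "continuous_on ({x} \<times> sphere z r) (\<lambda>p. K x (snd p))"
      by (rule continuous_on_compose2[OF K continuous_on_snd[OF continuous_on_id]])
        (use that e(2) in auto)
    then have "continuous_on ({x} \<times> sphere z r) (\<lambda>(x, y). K x y)"
      by (rule continuous_on_eq) auto
    from continuous_on_circle_integrand[OF this assms(3)]
    have c: "continuous_on ({x} \<times> cbox 0 1) (\<lambda>(x, t). ?f x t)" .
    have "continuous_on (cbox 0 1) (\<lambda>t. (\<lambda>(x, t). ?f x t) (x, t))"
      by (rule continuous_on_compose2[OF c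
            continuous_on_Pair[OF continuous_on_const continuous_on_id]]) auto
    then show "continuous_on (cbox 0 1) (\<lambda>t. ?f x t)"
      by simp
  qed
  have "((\<lambda>x. integral (cbox 0 1) (?f x)) has_derivative integral (cbox 0 1) (fx x0)) (at x0 within ?U)"
    by (rule leibniz_rule[OF _ int1 cfx])
      (use e derw in \<open>auto simp del: mem_ball box_real simp: fx has_derivative_at_withinI centre_in_ball\<close>)
  then have "((\<lambda>x. contour_integral ?c (K x)) has_derivative integral (cbox 0 1) (fx x0)) (at x0)"
    using e(1) unfolding circle_integral by (subst (asm) at_within_open) auto
  moreover have "blinfun_apply (integral (cbox 0 1) (fx x0)) =
      (\<lambda>v. contour_integral ?c (\<lambda>y. D x0 y v))"
  proof
    fix v
    have c1: "continuous_on (cbox 0 1) (fx x0)"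
      proof -
      have "continuous_on (cbox 0 1) (\<lambda>t. (\<lambda>(x, t). fx x t) (x0, t))"
        by (rule continuous_on_compose2[OF cfx
              continuous_on_Pair[OF continuous_on_const continuous_on_id]]) (use e(1) in auto)
      then show ?thesis by simp
    qed
    have "blinfun_apply (integral (cbox 0 1) (fx x0)) v = integral (cbox 0 1) (\<lambda>t. fx x0 t v)"
      by (rule blinfun_apply_integral[OF integrable_continuous[OF c1]])
    also have "\<dots> = integral (cbox 0 1) (\<lambda>t. D x0 (?c t) v * ?w t)"
      by (rule integral_cong) (use e(1) in \<open>auto simp del: mem_ball box_real simp: fx\<close>)
    finally show "blinfun_apply (integral (cbox 0 1) (fx x0)) v = contour_integral ?c (\<lambda>y. D x0 y v)"
      unfolding circle_integral .
  qed
  ultimately show ?thesis by simp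
qed

section \<open>Derivatives of holomorphic functions of several variables\<close>

text \<open>\<open>J\<close> is multiplication by \<open>\<i>\<close> on the real vector space \<open>'a\<close>; this treats \<open>complex^'n\<close> and
  \<open>complex^'n \<times> complex\<close> together.\<close>

definition jholo :: "('a::euclidean_space \<Rightarrow> 'a) \<Rightarrow> ('a \<Rightarrow> complex) \<Rightarrow> 'a set \<Rightarrow> bool" where
  "jholo J F S \<longleftrightarrow> open S \<and> (\<forall>x\<in>S. F differentiable (at x) \<and>
     (\<forall>v. frechet_derivative F (at x) (J v) = \<i> * frechet_derivative F (at x) v))"

lemma jholo_derivative:
  "jholo J F S \<Longrightarrow> x \<in> S \<Longrightarrow> (F has_derivative frechet_derivative F (at x)) (at x)"
  by (simp add: jholo_def frechet_derivative_works[symmetric])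

lemma jholo_continuous_on: "jholo J F S \<Longrightarrow> continuous_on S F"
  by (meson continuous_at_imp_continuous_on has_derivative_continuous jholo_derivative)

text \<open>The complex number \<open>c\<close> acting on \<open>v\<close>, with \<open>J\<close> in
  the role of multiplication by i. The points \<open>x + jscale J c v\<close> form the complex line
  through \<open>x\<close> in direction \<open>v\<close>.\<close>

definition jscale :: "('a::euclidean_space \<Rightarrow> 'a) \<Rightarrow> complex \<Rightarrow> 'a \<Rightarrow> 'a" where
  "jscale J c v = Re c *\<^sub>R v + Im c *\<^sub>R J v"

lemma jholo_jscale:
  assumes "jholo J F S" "x \<in> S"
  shows "frechet_derivative F (at x) (jscale J c v) = c * frechet_derivative F (at x) v"
proof -
  have "linear (frechet_derivative F (at x))"
    using jholo_derivative[OF assms] has_derivative_linear by blast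
  then have "frechet_derivative F (at x) (jscale J c v) =
      (of_real (Re c) + of_real (Im c) * \<i>) * frechet_derivative F (at x) v"
    using assms by (simp add: jscale_def linear_add linear_cmul jholo_def scaleR_conv_of_real algebra_simps)
  moreover have "of_real (Re c) + of_real (Im c) * \<i> = c"
    by (metis complex_eq mult.commute)
  ultimately show ?thesis by simp
qed

lemma has_derivative_jscale: "((\<lambda>c. jscale J c v) has_derivative (\<lambda>c. jscale J c v)) (at c)"
  unfolding jscale_def by (auto intro!: derivative_eq_intros)

lemma norm_jscale_le: "norm (jscale J c v) \<le> norm c * (norm v + norm (J v))"
proof -
  have "norm (jscale J c v) \<le> \<bar>Re c\<bar> * norm v + \<bar>Im c\<bar> * norm (J v)"
    unfolding jscale_def by (metis norm_scaleR norm_triangle_ineq)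
  also have "\<dots> \<le> norm c * norm v + norm c * norm (J v)"
    by (intro add_mono mult_right_mono abs_Re_le_cmod abs_Im_le_cmod) auto
  finally show ?thesis by (simp add: algebra_simps)
qed

lemma jholo_along_line:
  assumes "jholo J F S" "x + jscale J c v \<in> S"
  shows "((\<lambda>c. F (x + jscale J c v)) has_field_derivative
           frechet_derivative F (at (x + jscale J c v)) v) (at c)"
proof -
  have "((\<lambda>c. x + jscale J c v) has_derivative (\<lambda>c. jscale J c v)) (at c)"
    using has_derivative_add[OF has_derivative_const has_derivative_jscale] by simp
  from diff_chain_at[OF this jholo_derivative[OF assms]]
  show ?thesis
    by (simp add: o_def has_field_derivative_def jholo_jscale[OF assms] mult_commute_abs)
qed

text \<open>One radius serves all base points near \<open>x\<close>. The contour in Cauchy's formula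
  then does not depend on the base point, and the formula can be differentiated in it.\<close>

lemma jholo_circle:
  assumes "jholo J F S" "x \<in> S"
  obtains e r where "e > 0" "r > 0" "ball x e \<subseteq> S"
    "\<And>y c. y \<in> ball x e \<Longrightarrow> norm c \<le> r \<Longrightarrow> y + jscale J c v \<in> S"
proof -
  obtain d where d: "d > 0" "ball x d \<subseteq> S"
    using assms openE unfolding jholo_def by blast
  define n where "n = norm v + norm (J v) + 1"
  have n: "n > 0" by (simp add: n_def add_nonneg_pos)
  have "y + jscale J c v \<in> S" if "y \<in> ball x (d/2)" "norm c \<le> d / (2 * n)" for y c
  proof -
    have "norm (jscale J c v) \<le> d / (2 * n) * (norm v + norm (J v))"
      using norm_jscale_le[of J c v] that(2) by (meson add_nonneg_nonneg mult_right_mono norm_ge_zero order_trans)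
    also have "\<dots> \<le> d / (2 * n) * n"
      using d n by (intro mult_left_mono) (auto simp: n_def)
    also have "\<dots> = d / 2" using n by simp
    finally have "norm (jscale J c v) \<le> d / 2" .
    then have "dist x (y + jscale J c v) < d"
      using that(1) norm_triangle_ineq4[of "x - y" "jscale J c v"]
      by (simp add: dist_norm algebra_simps)
    then show ?thesis using d by auto
  qed
  moreover have "ball x (d/2) \<subseteq> S"
    using d subset_ball[of "d/2" d x] by auto
  ultimately show thesis using that[of "d/2" "d/(2*n)"] d(1) n by auto
qed

text \<open>Cauchy's formula for the slice \<open>c \<mapsto> F (x + jscale J c v)\<close>. It
  trades a derivative of \<open>F\<close> for values of \<open>F\<close>, and so produces all higher
  regularity from mere differentiability.\<close>

lemma jholo_Cauchy:
  assumes "jholo J F S" "0 < r" "\<And>c. norm c \<le> r \<Longrightarrow> x + jscale J c v \<in> S"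
  shows "frechet_derivative F (at x) v =
    1 / (2 * of_real pi * \<i>) * contour_integral (circlepath 0 r) (\<lambda>c. F (x + jscale J c v) / c^2)"
proof -
  let ?g = "\<lambda>c. F (x + jscale J c v)"
  have d: "(?g has_field_derivative frechet_derivative F (at (x + jscale J c v)) v) (at c)"
    if "norm c \<le> r" for c
    using jholo_along_line[OF assms(1) assms(3)[OF that]] .
  have "continuous_on (cball 0 r) ?g"
    by (rule continuous_at_imp_continuous_on) (auto intro: DERIV_isCont[OF d])
  moreover have "?g holomorphic_on ball 0 r"
    by (auto simp: holomorphic_on_open intro!: exI d)
  ultimately have "(?g has_field_derivative 1 / (2 * of_real pi * \<i>) *
      contour_integral (circlepath 0 r) (\<lambda>u. ?g u / (u-0)^2)) (at 0)"
    using assms(2) by (intro Cauchy_derivative_integral_circlepath) auto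
  moreover have "jscale J 0 v = 0" by (simp add: jscale_def)
  ultimately show ?thesis
    using DERIV_unique d[of 0] assms(2) by fastforce
qed

lemma continuous_on_jscale_plus: "continuous_on A (\<lambda>(y, c). y + jscale J c v)"
  unfolding jscale_def split_beta by (intro continuous_intros)

lemma jholo_derivative_continuous:
  assumes "jholo J F S"
  shows "continuous_on S (\<lambda>x. frechet_derivative F (at x) v)"
proof (rule continuous_at_imp_continuous_on, intro ballI)
  fix x assume "x \<in> S"
  then obtain e r where er: "e > 0" "r > 0" "ball x e \<subseteq> S"
    "\<And>y c. y \<in> ball x e \<Longrightarrow> norm c \<le> r \<Longrightarrow> y + jscale J c v \<in> S"
    using jholo_circle[OF assms, where v = v and thesis = thesis] by blast
  have "continuous_on (ball x e \<times> sphere 0 r) (\<lambda>p. F (case p of (y, c) \<Rightarrow> y + jscale J c v))"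
    by (rule continuous_on_compose2[OF jholo_continuous_on[OF assms] continuous_on_jscale_plus])
      (use er(4) in auto)
  then have "continuous_on (ball x e \<times> sphere 0 r) (\<lambda>(y, c). F (y + jscale J c v) / c^2)"
    using er(2) unfolding split_beta by (intro continuous_intros) auto
  then have "continuous_on (ball x e) (\<lambda>y. 1 / (2 * of_real pi * \<i>) *
      contour_integral (circlepath 0 r) (\<lambda>c. F (y + jscale J c v) / c^2))"
    using er(2) by (intro continuous_intros continuous_on_circle_integral) auto
  then have "continuous_on (ball x e) (\<lambda>y. frechet_derivative F (at y) v)"
    by (rule continuous_on_eq) (simp add: jholo_Cauchy[OF assms er(2) er(4)])
  then show "isCont (\<lambda>y. frechet_derivative F (at y) v) x"
    using er(1) by (simp add: continuous_on_eq_continuous_at)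
qed

text \<open>Differentiation under the integral sign in Cauchy's formula, with the base point as
  parameter; this is where continuity of the first derivatives enters.\<close>

lemma jholo_second_derivative:
  assumes "jholo J F S" "x \<in> S"
  obtains r where "r > 0" "\<And>c. norm c \<le> r \<Longrightarrow> x + jscale J c v \<in> S"
    "((\<lambda>y. frechet_derivative F (at y) v) has_derivative
       (\<lambda>w. 1 / (2 * of_real pi * \<i>) *
         contour_integral (circlepath 0 r) (\<lambda>c. frechet_derivative F (at (x + jscale J c v)) w / c^2)))
      (at x)"
proof -
  obtain e r where er: "e > 0" "r > 0" "ball x e \<subseteq> S"
    "\<And>y c. y \<in> ball x e \<Longrightarrow> norm c \<le> r \<Longrightarrow> y + jscale J c v \<in> S"
    using jholo_circle[OF assms, where v = v and thesis = thesis] by blast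
  have comp: "continuous_on (ball x e \<times> sphere 0 r) (\<lambda>(y, c). G (y + jscale J c v) / c^2)"
    if "continuous_on S G" for G :: "'a \<Rightarrow> complex"
  proof -
    have "continuous_on (ball x e \<times> sphere 0 r) (\<lambda>p. G (case p of (y, c) \<Rightarrow> y + jscale J c v))"
      by (rule continuous_on_compose2[OF that continuous_on_jscale_plus]) (use er(4) in auto)
    then show ?thesis
      using er(2) unfolding split_beta by (intro continuous_intros) auto
  qed
  have "((\<lambda>y. contour_integral (circlepath 0 r) (\<lambda>c. F (y + jscale J c v) / c^2)) has_derivative
      (\<lambda>w. contour_integral (circlepath 0 r)
        (\<lambda>c. frechet_derivative F (at (x + jscale J c v)) w / c^2))) (at x)"
  proof (rule has_derivative_circle_integral[where S = "ball x e"])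
    fix y c assume yc: "y \<in> ball x e" "c \<in> sphere (0::complex) r"
    have "((\<lambda>y. y + jscale J c v) has_derivative (\<lambda>w. w)) (at y)"
      by (auto intro!: derivative_eq_intros)
    from diff_chain_at[OF this jholo_derivative[OF assms(1) er(4)]]
    have "((\<lambda>y. F (y + jscale J c v)) has_derivative frechet_derivative F (at (y + jscale J c v))) (at y)"
      using yc by (simp add: o_def)
    then show "((\<lambda>y. F (y + jscale J c v) / c\<^sup>2) has_derivative
        (\<lambda>w. frechet_derivative F (at (y + jscale J c v)) w / c\<^sup>2)) (at y)"
      using yc er(2) unfolding divide_inverse by (auto intro!: derivative_eq_intros)
  next
    fix y assume y: "y \<in> ball x e"
    have "continuous_on (sphere 0 r) (\<lambda>c. (\<lambda>(y, c). F (y + jscale J c v) / c\<^sup>2) (y, c))"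
      by (rule continuous_on_compose2[OF comp[OF jholo_continuous_on[OF assms(1)]]])
        (use y in \<open>auto intro!: continuous_intros\<close>)
    then show "continuous_on (sphere 0 r) (\<lambda>c. F (y + jscale J c v) / c\<^sup>2)" by simp
  qed (use er comp[OF jholo_derivative_continuous[OF assms(1)]] in auto)
  from has_derivative_mult_right[OF this, of "1 / (2 * of_real pi * \<i>)"]
  have "((\<lambda>y. frechet_derivative F (at y) v) has_derivative
      (\<lambda>w. 1 / (2 * of_real pi * \<i>) * contour_integral (circlepath 0 r)
         (\<lambda>c. frechet_derivative F (at (x + jscale J c v)) w / c^2))) (at x)"
    by (rule has_derivative_transform_within_open[where s = "ball x e"])
      (use er(1) jholo_Cauchy[OF assms(1) er(2) er(4)] in auto)
  with er show thesis using that[of r] centre_in_ball by blast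
qed

lemma jholo_frechet_derivative:
  assumes "jholo J F S"
  shows "jholo J (\<lambda>x. frechet_derivative F (at x) v) S"
  unfolding jholo_def
proof (intro conjI ballI allI)
  show "open S" using assms by (simp add: jholo_def)
next
  fix x assume "x \<in> S"
  from jholo_second_derivative[OF assms this, of v]
  show "(\<lambda>x. frechet_derivative F (at x) v) differentiable at x"
    unfolding differentiable_def by blast
next
  fix x w assume x: "x \<in> S"
  obtain r where r: "\<And>c. norm c \<le> r \<Longrightarrow> x + jscale J c v \<in> S" and "r > 0" and
   d: "((\<lambda>y. frechet_derivative F (at y) v) has_derivative
       (\<lambda>w. 1 / (2 * of_real pi * \<i>) *
         contour_integral (circlepath 0 r) (\<lambda>c. frechet_derivative F (at (x + jscale J c v)) w / c^2)))
      (at x)"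
    using jholo_second_derivative[OF assms x, of v] by blast
  have "contour_integral (circlepath 0 r) (\<lambda>c. frechet_derivative F (at (x + jscale J c v)) (J w) / c^2)
     = contour_integral (circlepath 0 r) (\<lambda>c. \<i> * (frechet_derivative F (at (x + jscale J c v)) w / c^2))"
    by (rule contour_integral_cong)
      (use assms r \<open>r > 0\<close> in \<open>auto simp: jholo_def\<close>)
  also have "\<dots> = \<i> * contour_integral (circlepath 0 r) (\<lambda>c. frechet_derivative F (at (x + jscale J c v)) w / c^2)"
    by (simp only: contour_integral_integral mult.assoc integral_mult_right)
  finally show "frechet_derivative (\<lambda>x. frechet_derivative F (at x) v) (at x) (J w) =
    \<i> * frechet_derivative (\<lambda>x. frechet_derivative F (at x) v) (at x) w"
    by (simp add: frechet_derivative_at[OF d, symmetric])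
qed

text \<open>The integral for the second derivative is at the same time Cauchy's integral for the
  \<open>v\<close>-derivative of the \<open>w\<close>-derivative.\<close>

lemma jholo_derivatives_commute:
  assumes "jholo J F S" "x \<in> S"
  shows "frechet_derivative (\<lambda>y. frechet_derivative F (at y) v) (at x) w =
         frechet_derivative (\<lambda>y. frechet_derivative F (at y) w) (at x) v"
proof -
  obtain r where r: "\<And>c. norm c \<le> r \<Longrightarrow> x + jscale J c v \<in> S" "r > 0" and
   d: "((\<lambda>y. frechet_derivative F (at y) v) has_derivative
       (\<lambda>w. 1 / (2 * of_real pi * \<i>) *
         contour_integral (circlepath 0 r) (\<lambda>c. frechet_derivative F (at (x + jscale J c v)) w / c^2)))
      (at x)"
    using jholo_second_derivative[OF assms, of v] by blast
  show ?thesis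
    unfolding frechet_derivative_at[OF d, symmetric]
    using jholo_Cauchy[OF jholo_frechet_derivative[OF assms(1)] r(2) r(1)] by simp
qed

section \<open>Complex derivatives in coordinates\<close>

lemma pair_smult: "pair a (c *s v) = c * pair a v"
  by (simp add: pair_def sum_distrib_left mult_ac)

lemma pair_add: "pair a (v + w) = pair a v + pair a w"
  by (simp add: pair_def sum.distrib algebra_simps)

lemma pair_diff: "pair a (v - w) = pair a v - pair a w"
  by (simp add: pair_def sum_subtractf algebra_simps)

lemma pair_axis [simp]: "pair a (axis i c) = a $ i * c"
  by (simp add: pair_def axis_def if_distrib cong: if_cong)

lemma bounded_linear_smult_vec: "bounded_linear (\<lambda>s. s *s (v :: complex^'n))"
proof -
  have "linear (\<lambda>s. s *s v)"
    by (rule linearI) (simp_all add: vec_eq_iff algebra_simps)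
  then show ?thesis by (simp add: linear_conv_bounded_linear)
qed

lemma complex_linear_eq_pair:
  fixes D :: "complex^'n \<Rightarrow> complex"
  assumes "linear D" "\<And>v. D (\<i> *s v) = \<i> * D v"
  shows "D = pair (\<chi> i. D (axis i 1))"
proof
  fix v :: "complex^'n"
  have sc: "D (c *s w) = c * D w" for c w
  proof -
    have "c *s w = Re c *\<^sub>R w + Im c *\<^sub>R (\<i> *s w)"
      by (simp add: vec_eq_iff complex_eq_iff)
    then show ?thesis
      using assms by (simp add: linear_add linear_cmul complex_eq_iff)
  qed
  have "v = (\<Sum>i\<in>UNIV. v $ i *s axis i 1)"
    by (rule basis_expansion[symmetric])
  then have "D v = (\<Sum>i\<in>UNIV. D (v $ i *s axis i 1))"
    using linear_sum[OF assms(1)] by metis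
  then show "D v = pair (\<chi> i. D (axis i 1)) v"
    by (simp add: sc pair_def mult.commute)
qed

lemma holo_on_jholo: "holo_on F S \<longleftrightarrow> jholo ((*s) \<i>) F S"
proof
  assume "holo_on F S"
  then have "open S" "\<And>x. x \<in> S \<Longrightarrow> \<exists>a. (F has_derivative pair a) (at x)"
    by (auto simp: holo_on_def)
  moreover have "F differentiable at x \<and>
      (\<forall>v. frechet_derivative F (at x) (\<i> *s v) = \<i> * frechet_derivative F (at x) v)"
    if "(F has_derivative pair a) (at x)" for a x
    using that frechet_derivative_at[OF that, symmetric] by (auto simp: differentiable_def pair_smult)
  ultimately show "jholo ((*s) \<i>) F S"
    unfolding jholo_def by meson
next
  assume J: "jholo ((*s) \<i>) F S"
  have "\<exists>a. (F has_derivative pair a) (at x)" if "x \<in> S" for x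
    using jholo_derivative[OF J that] J that
      complex_linear_eq_pair[OF has_derivative_linear[OF jholo_derivative[OF J that]]]
    by (metis jholo_def)
  then show "holo_on F S" using J by (auto simp: holo_on_def jholo_def)
qed

lemma
  assumes "(F has_derivative pair a) (at x)"
  shows has_field_derivative_axis: "((\<lambda>s. F (x + s *s axis i 1)) has_field_derivative a $ i) (at 0)"
    and cpartial_eq: "cpartial i F x = a $ i"
proof -
  have "((\<lambda>s. x + s *s axis i 1) has_derivative (\<lambda>s. s *s axis i 1)) (at 0)"
    by (auto intro!: derivative_eq_intros bounded_linear.has_derivative[OF bounded_linear_smult_vec])
  then have "((\<lambda>s. F (x + s *s axis i 1)) has_derivative (\<lambda>s. pair a (s *s axis i 1))) (at 0)"
    using diff_chain_at[of "\<lambda>s. x + s *s axis i 1" "\<lambda>s. s *s axis i 1" 0 F "pair a"] assms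
    by (simp add: o_def)
  then show "((\<lambda>s. F (x + s *s axis i 1)) has_field_derivative a $ i) (at 0)"
    by (simp add: has_field_derivative_def pair_smult mult.commute[of "a $ i"] mult_commute_abs)
  then show "cpartial i F x = a $ i" by (simp add: cpartial_def DERIV_imp_deriv)
qed

lemma holo_on_has_derivative:
  assumes "holo_on F S" "x \<in> S"
  shows "(F has_derivative pair (differential F x)) (at x)"
proof -
  obtain a where a: "(F has_derivative pair a) (at x)"
    using assms by (auto simp: holo_on_def)
  have "differential F x = a"
    by (simp add: differential_def vec_eq_iff cpartial_eq[OF a])
  with a show ?thesis by simp
qed

lemma holo_on_open: "holo_on F S \<Longrightarrow> open S"
  by (simp add: holo_on_def)

lemma holo_onI:
  assumes "open S" "\<And>x. x \<in> S \<Longrightarrow> (F has_derivative pair (a x)) (at x)"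
  shows "holo_on F S"
  using assms by (auto simp: holo_on_def)

lemma holo_on_continuous_on: "holo_on F S \<Longrightarrow> continuous_on S F"
  by (simp add: holo_on_jholo jholo_continuous_on)

lemma holo_on_cong: "(\<And>x. x \<in> S \<Longrightarrow> F x = G x) \<Longrightarrow> holo_on F S \<Longrightarrow> holo_on G S"
  unfolding holo_on_def using has_derivative_transform_within_open[of F _ _ UNIV S G] by (metis (no_types, lifting))

lemma holo_on_subset: "holo_on F S \<Longrightarrow> open T \<Longrightarrow> T \<subseteq> S \<Longrightarrow> holo_on F T"
  by (auto simp: holo_on_def)

lemma cpartial_cong:
  assumes "open S" "x \<in> S" "\<And>x. x \<in> S \<Longrightarrow> F x = G x" "holo_on F S"
  shows "cpartial i F x = cpartial i G x"
  using assms cpartial_eq[OF has_derivative_transform_within_open[OF holo_on_has_derivative[OF assms(4,2)]]]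
    cpartial_eq[OF holo_on_has_derivative[OF assms(4,2)]] by metis

lemma holo_on_cpartial_eq:
  assumes "holo_on F S" "x \<in> S"
  shows "cpartial i F x = frechet_derivative F (at x) (axis i 1)"
  using frechet_derivative_at[OF holo_on_has_derivative[OF assms], symmetric]
  by (simp add: differential_def)

lemma holo_on_cpartial:
  assumes "holo_on F S"
  shows "holo_on (cpartial i F) S"
  by (rule holo_on_cong[of S "\<lambda>x. frechet_derivative F (at x) (axis i 1)"])
    (use assms in \<open>auto simp: holo_on_jholo[symmetric] holo_on_cpartial_eq
       intro: jholo_frechet_derivative[of "(*s) \<i>", folded holo_on_jholo]\<close>)

lemma cpartial_commute:
  assumes "holo_on F S" "x \<in> S"
  shows "cpartial i (cpartial j F) x = cpartial j (cpartial i F) x"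
proof -
  have "cpartial i (cpartial j F) x =
      frechet_derivative (\<lambda>x. frechet_derivative F (at x) (axis j 1)) (at x) (axis i 1)" for i j
  proof -
    have "cpartial i (cpartial j F) x = cpartial i (\<lambda>x. frechet_derivative F (at x) (axis j 1)) x"
      by (rule cpartial_cong[OF holo_on_open[OF assms(1)] assms(2) _ holo_on_cpartial[OF assms(1)]])
        (simp add: holo_on_cpartial_eq[OF assms(1)])
    also have "\<dots> = frechet_derivative (\<lambda>x. frechet_derivative F (at x) (axis j 1)) (at x) (axis i 1)"
      by (rule holo_on_cpartial_eq[OF _ assms(2)])
        (use assms jholo_frechet_derivative in \<open>auto simp: holo_on_jholo\<close>)
    finally show ?thesis .
  qed
  then show ?thesis
    using jholo_derivatives_commute assms by (metis holo_on_jholo)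
qed

section \<open>Closure properties of holomorphic functions\<close>

lemma holo_on_const: "open S \<Longrightarrow> holo_on (\<lambda>x. c) S"
  by (rule holo_onI[where a = "\<lambda>x. 0"])
    (auto simp: pair_def intro!: derivative_eq_intros)

lemma has_derivative_pair_add:
  assumes "(F has_derivative pair a) (at x)" "(G has_derivative pair b) (at x)"
  shows "((\<lambda>x. F x + G x) has_derivative pair (a + b)) (at x)"
proof -
  have "(\<lambda>v. pair a v + pair b v) = pair (a + b)"
    by (auto simp: pair_def algebra_simps sum.distrib)
  with has_derivative_add[OF assms] show ?thesis by simp
qed

lemma has_derivative_pair_mult:
  assumes "(F has_derivative pair a) (at x)" "(G has_derivative pair b) (at x)"
  shows "((\<lambda>x. F x * G x) has_derivative pair (F x *s b + G x *s a)) (at x)"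
proof -
  have "(\<lambda>v. F x * pair b v + pair a v * G x) = pair (F x *s b + G x *s a)"
    by (auto simp: pair_def algebra_simps sum.distrib sum_distrib_left)
  with has_derivative_mult[OF assms] show ?thesis by simp
qed

lemma has_derivative_pair_inverse:
  assumes "(F has_derivative pair a) (at x)" "F x \<noteq> 0"
  shows "((\<lambda>x. inverse (F x)) has_derivative pair ((- (inverse (F x) ^ 2)) *s a)) (at x)"
proof -
  have "(\<lambda>v. - (inverse (F x) * pair a v * inverse (F x))) = pair ((- (inverse (F x) ^ 2)) *s a)"
    by (auto simp: pair_def algebra_simps sum_distrib_left power2_eq_square sum_negf)
  with Deriv.has_derivative_inverse[OF assms(2) assms(1)] show ?thesis by simp
qed

lemma holo_on_add:
  assumes "holo_on F S" "holo_on G S" shows "holo_on (\<lambda>x. F x + G x) S"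
  by (rule holo_onI[OF holo_on_open[OF assms(1)] has_derivative_pair_add])
    (use assms holo_on_has_derivative in auto)

lemma holo_on_mult:
  assumes "holo_on F S" "holo_on G S" shows "holo_on (\<lambda>x. F x * G x) S"
  by (rule holo_onI[OF holo_on_open[OF assms(1)] has_derivative_pair_mult])
    (use assms holo_on_has_derivative in auto)

lemma holo_on_inverse:
  assumes "holo_on F S" "\<And>x. x \<in> S \<Longrightarrow> F x \<noteq> 0" shows "holo_on (\<lambda>x. inverse (F x)) S"
  by (rule holo_onI[OF holo_on_open[OF assms(1)] has_derivative_pair_inverse])
    (use assms holo_on_has_derivative in auto)

lemma holo_on_divide:
  assumes "holo_on F S" "holo_on G S" "\<And>x. x \<in> S \<Longrightarrow> G x \<noteq> 0"
  shows "holo_on (\<lambda>x. F x / G x) S"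
  unfolding divide_inverse using assms by (intro holo_on_mult holo_on_inverse)

lemma holo_on_minus:
  assumes "holo_on F S" shows "holo_on (\<lambda>x. - F x) S"
  using holo_on_mult[OF holo_on_const[OF holo_on_open[OF assms], of "-1"] assms] by simp

lemma holo_on_diff:
  assumes "holo_on F S" "holo_on G S" shows "holo_on (\<lambda>x. F x - G x) S"
  using holo_on_add[OF assms(1) holo_on_minus[OF assms(2)]] by simp

lemma holo_on_sum:
  assumes "open S" "\<And>i. i \<in> I \<Longrightarrow> holo_on (F i) S" shows "holo_on (\<lambda>x. \<Sum>i\<in>I. F i x) S"
  using assms by (induction I rule: infinite_finite_induct) (auto intro: holo_on_const holo_on_add)

lemma holo_on_prod:
  assumes "open S" "\<And>i. i \<in> I \<Longrightarrow> holo_on (F i) S" shows "holo_on (\<lambda>x. \<Prod>i\<in>I. F i x) S"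
  using assms by (induction I rule: infinite_finite_induct) (auto intro: holo_on_const holo_on_mult)

lemma holo_on_power:
  assumes "holo_on F S" shows "holo_on (\<lambda>x. F x ^ n) S"
  using assms by (induction n) (auto intro: holo_on_const holo_on_mult holo_on_open)

lemma holo_on_det:
  assumes "open S" "\<And>i j. holo_on (\<lambda>x. M x $ i $ j) S" shows "holo_on (\<lambda>x. det (M x)) S"
  unfolding det_def using assms by (intro holo_on_sum holo_on_mult holo_on_prod holo_on_const)

lemma
  assumes "invertible A"
  shows matrix_inv_right: "A ** matrix_inv A = mat 1"
    and matrix_inv_left: "matrix_inv A ** A = mat 1"
  using someI_ex[OF assms[unfolded invertible_def]] by (simp_all add: matrix_inv_def)

lemma holo_on_matrix_inv:
  fixes M :: "complex^'n \<Rightarrow> complex^'m^'m"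
  assumes "open S" "\<And>i j. holo_on (\<lambda>x. M x $ i $ j) S" "\<And>x. x \<in> S \<Longrightarrow> invertible (M x)"
  shows "holo_on (\<lambda>x. matrix_inv (M x) $ i $ j) S"
proof -
  \<comment> \<open>Cramer's rule: with column \<open>i\<close> replaced by the \<open>j\<close>-th
    unit vector, the entry of the inverse is a quotient of two determinants.\<close>
  let ?A = "\<lambda>x. \<chi> a b. if b = i then axis j 1 $ a else M x $ a $ b"
  have "det (?A x) / det (M x) = matrix_inv (M x) $ i $ j" if "x \<in> S" for x
  proof -
    have nz: "det (M x) \<noteq> 0" using assms(3)[OF that] invertible_det_nz by blast
    have "M x *v (matrix_inv (M x) *v axis j 1) = axis j 1"
      using assms(3)[OF that]
      by (simp add: matrix_vector_mul_assoc matrix_inv_right)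
    then have "matrix_inv (M x) *v axis j 1 = (\<chi> k. det (\<chi> a b. if b = k then axis j 1 $ a else M x $ a $ b) / det (M x))"
      using cramer[OF nz] by blast
    moreover have "(matrix_inv (M x) *v axis j 1) $ i = matrix_inv (M x) $ i $ j"
      by (simp add: matrix_vector_mult_def axis_def if_distrib cong: if_cong)
    ultimately show ?thesis by simp
  qed
  moreover have "holo_on (\<lambda>x. det (?A x) / det (M x)) S"
  proof (rule holo_on_divide)
    show "holo_on (\<lambda>x. det (?A x)) S"
    proof (rule holo_on_det[OF assms(1)])
      show "holo_on (\<lambda>x. ?A x $ a $ b) S" for a b
        using assms by (cases "b = i") (auto intro: holo_on_const)
    qed
  qed (use assms in \<open>auto intro: holo_on_det simp: invertible_det_nz\<close>)
  ultimately show ?thesis by (rule holo_on_cong)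
qed

lemma has_derivative_vec_pair:
  fixes \<phi> :: "complex^'n \<Rightarrow> complex^'m"
  assumes "\<And>k. ((\<lambda>y. \<phi> y $ k) has_derivative pair (a k)) (at x)"
  shows "(\<phi> has_derivative (\<lambda>v. \<chi> k. pair (a k) v)) (at x)"
proof -
  have b: "bounded_linear (\<lambda>c. c *s (axis k 1 :: complex^'m))" for k
    by (rule bounded_linear_smult_vec)
  have "((\<lambda>y. \<Sum>k\<in>UNIV. \<phi> y $ k *s axis k 1) has_derivative
      (\<lambda>v. \<Sum>k\<in>UNIV. pair (a k) v *s axis k 1)) (at x)"
    by (intro has_derivative_sum bounded_linear.has_derivative[OF b] assms)
  moreover have "(\<Sum>k\<in>UNIV. pair (a k) v *s axis k 1) = (\<chi> k. pair (a k) v)" for v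
    using basis_expansion[of "\<chi> k. pair (a k) v"] by simp
  ultimately show ?thesis by (simp add: basis_expansion)
qed

lemma pair_vec_compose:
  "pair b (\<chi> k. pair (a k) v) = pair (\<chi> i. \<Sum>k\<in>UNIV. b $ k * a k $ i) v"
  unfolding pair_def by (simp add: sum_distrib_left sum_distrib_right mult.assoc) (rule sum.swap)

lemma has_derivative_pair_compose:
  fixes \<phi> :: "complex^'n \<Rightarrow> complex^'m"
  assumes "\<And>k. ((\<lambda>y. \<phi> y $ k) has_derivative pair (a k)) (at x)"
    "(G has_derivative pair b) (at (\<phi> x))"
  shows "((\<lambda>y. G (\<phi> y)) has_derivative pair (\<chi> i. \<Sum>k\<in>UNIV. b $ k * a k $ i)) (at x)"
  using diff_chain_at[OF has_derivative_vec_pair[OF assms(1)] assms(2)]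
  by (simp add: o_def pair_vec_compose)

lemma
  fixes \<phi> :: "complex^'n \<Rightarrow> complex^'m"
  assumes "holo_on G T" "open S" "\<And>k. holo_on (\<lambda>y. \<phi> y $ k) S" "\<phi> ` S \<subseteq> T"
  shows holo_on_compose: "holo_on (\<lambda>y. G (\<phi> y)) S"
    and cpartial_compose: "x \<in> S \<Longrightarrow> cpartial i (\<lambda>y. G (\<phi> y)) x =
      (\<Sum>k\<in>UNIV. cpartial k G (\<phi> x) * cpartial i (\<lambda>y. \<phi> y $ k) x)"
proof -
  have d: "((\<lambda>y. G (\<phi> y)) has_derivative pair
      (\<chi> i. \<Sum>k\<in>UNIV. differential G (\<phi> x) $ k * differential (\<lambda>y. \<phi> y $ k) x $ i)) (at x)"
    if "x \<in> S" for x
    by (rule has_derivative_pair_compose[OF holo_on_has_derivative[OF assms(3) that]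
          holo_on_has_derivative[OF assms(1)]]) (use assms(4) that in auto)
  show "holo_on (\<lambda>y. G (\<phi> y)) S"
    using holo_onI[OF assms(2) d] .
  show "cpartial i (\<lambda>y. G (\<phi> y)) x =
      (\<Sum>k\<in>UNIV. cpartial k G (\<phi> x) * cpartial i (\<lambda>y. \<phi> y $ k) x)" if "x \<in> S"
    by (simp add: cpartial_eq[OF d[OF that]] differential_def)
qed

lemma cpartial_add:
  assumes "holo_on F S" "holo_on G S" "x \<in> S"
  shows "cpartial i (\<lambda>x. F x + G x) x = cpartial i F x + cpartial i G x"
  using cpartial_eq[OF has_derivative_pair_add[OF holo_on_has_derivative[OF assms(1,3)]
      holo_on_has_derivative[OF assms(2,3)]]]
  by (simp add: differential_def)

lemma cpartial_mult:
  assumes "holo_on F S" "holo_on G S" "x \<in> S"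
  shows "cpartial i (\<lambda>x. F x * G x) x = F x * cpartial i G x + G x * cpartial i F x"
  using cpartial_eq[OF has_derivative_pair_mult[OF holo_on_has_derivative[OF assms(1,3)]
      holo_on_has_derivative[OF assms(2,3)]]]
  by (simp add: differential_def)

lemma cpartial_const [simp]: "cpartial i (\<lambda>x. c) x = 0"
  by (simp add: cpartial_def)

lemma cpartial_minus:
  assumes "holo_on F S" "x \<in> S"
  shows "cpartial i (\<lambda>x. - F x) x = - cpartial i F x"
  using cpartial_mult[OF holo_on_const[OF holo_on_open[OF assms(1)], of "-1"] assms, of i] by simp

lemma cpartial_diff:
  assumes "holo_on F S" "holo_on G S" "x \<in> S"
  shows "cpartial i (\<lambda>x. F x - G x) x = cpartial i F x - cpartial i G x"
  using cpartial_add[OF assms(1) holo_on_minus[OF assms(2)] assms(3)] cpartial_minus[OF assms(2,3)]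
  by simp

lemma cpartial_sum:
  assumes "finite I" "open S" "\<And>k. k \<in> I \<Longrightarrow> holo_on (F k) S" "x \<in> S"
  shows "cpartial i (\<lambda>x. \<Sum>k\<in>I. F k x) x = (\<Sum>k\<in>I. cpartial i (F k) x)"
  using assms
proof (induction I rule: finite_induct)
  case (insert k I)
  then show ?case
    using cpartial_add[of "F k" S "\<lambda>x. \<Sum>k\<in>I. F k x" x i] by (auto intro: holo_on_sum)
qed auto

subsection \<open>Holomorphic families\<close>

abbreviation "vec_times \<equiv> (\<lambda>(v, m). (\<i> *s v, \<i> * m)) :: (complex^'n) \<times> complex \<Rightarrow> _"

lemma holo_family_jholo:
  "holo_family_on F S U \<longleftrightarrow> open S \<and> open U \<and> jholo vec_times (\<lambda>(y, m). F y m) (S \<times> U)"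
proof
  assume *: "holo_family_on F S U"
  then have o: "open S" "open U" by (auto simp: holo_family_on_def)
  have "(\<lambda>(y, m). F y m) differentiable at p \<and>
      (\<forall>w. frechet_derivative (\<lambda>(y, m). F y m) (at p) (vec_times w) =
         \<i> * frechet_derivative (\<lambda>(y, m). F y m) (at p) w)" if p: "p \<in> S \<times> U" for p
  proof -
    obtain a b where "((\<lambda>(y, m). F y m) has_derivative (\<lambda>(v, m). pair a v + b * m)) (at p)"
      using * p unfolding holo_family_on_def by (cases p) blast
    with frechet_derivative_at[OF this, symmetric] show ?thesis
      by (auto simp: differentiable_def pair_smult algebra_simps)
  qed
  then show "open S \<and> open U \<and> jholo vec_times (\<lambda>(y, m). F y m) (S \<times> U)"
    using o by (simp add: jholo_def open_Times)
next
  assume *: "open S \<and> open U \<and> jholo vec_times (\<lambda>(y, m). F y m) (S \<times> U)"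
  have "\<exists>a b. ((\<lambda>(y, m). F y m) has_derivative (\<lambda>(v, m). pair a v + b * m)) (at (x, l))"
    if xl: "x \<in> S" "l \<in> U" for x l
  proof -
    define D where "D = frechet_derivative (\<lambda>(y, m). F y m) (at (x, l))"
    have d: "((\<lambda>(y, m). F y m) has_derivative D) (at (x, l))"
      unfolding D_def using jholo_derivative * xl by blast
    have lin: "linear D" by (rule has_derivative_linear[OF d])
    have J: "D (vec_times w) = \<i> * D w" for w
      unfolding D_def using * xl unfolding jholo_def by blast
    have "linear (\<lambda>v. D (v, 0))"
      using lin by (auto intro!: linearI simp: linear_add[symmetric] linear_cmul[symmetric])
    from complex_linear_eq_pair[OF this] J[of "(v, 0)" for v]
    have 1: "D (v, 0) = pair (\<chi> i. D (axis i 1, 0)) v" for v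
      by (auto dest: fun_cong)
    have 2: "D (0, m) = D (0, 1) * m" for m
    proof -
      have "(0, m) = Re m *\<^sub>R (0, 1) + Im m *\<^sub>R vec_times (0 :: complex^'a, 1)"
        by (simp add: complex_eq_iff)
      then have "D (0, m) = Re m *\<^sub>R D (0, 1) + Im m *\<^sub>R (\<i> * D (0, 1))"
        using lin J by (simp only: linear_add linear_cmul)
      then show ?thesis by (simp add: complex_eq_iff)
    qed
    have eq: "D (v, m) = pair (\<chi> i. D (axis i 1, 0)) v + D (0, 1) * m" for v m
      using linear_add[OF lin, of "(v, 0)" "(0, m)"] 1[of v] 2[of m] by simp
    have "D p = (\<lambda>(v, m). pair (\<chi> i. D (axis i 1, 0)) v + D (0, 1) * m) p" for p
      by (cases p) (simp only: split, rule eq)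
    then have "D = (\<lambda>(v, m). pair (\<chi> i. D (axis i 1, 0)) v + D (0, 1) * m)" ..
    with d show ?thesis by metis
  qed
  with * show "holo_family_on F S U" by (simp add: holo_family_on_def)
qed

lemma holo_family_open: "holo_family_on F S U \<Longrightarrow> open S" "holo_family_on F S U \<Longrightarrow> open U"
  by (auto simp: holo_family_on_def)

lemma
  assumes "((\<lambda>(y, m). F y m) has_derivative (\<lambda>(v, m). pair a v + b * m)) (at (x, l))"
  shows family_derivative_left: "((\<lambda>y. F y l) has_derivative pair a) (at x)"
    and family_derivative_right: "(F x has_field_derivative b) (at l)"
proof -
  have "((\<lambda>y. (y, l)) has_derivative (\<lambda>v. (v, 0))) (at x)"
    by (auto intro!: derivative_eq_intros)
  from diff_chain_at[OF this assms] show "((\<lambda>y. F y l) has_derivative pair a) (at x)"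
    by (simp add: o_def)
  have "(Pair x has_derivative (\<lambda>m. (0, m))) (at l)"
    by (auto intro!: derivative_eq_intros)
  from diff_chain_at[OF this assms] show "(F x has_field_derivative b) (at l)"
    by (simp add: o_def has_field_derivative_def pair_def)
qed

lemma holo_family_left: "holo_family_on F S U \<Longrightarrow> l \<in> U \<Longrightarrow> holo_on (\<lambda>x. F x l) S"
  unfolding holo_family_on_def holo_on_def using family_derivative_left by blast

lemma holo_family_right: "holo_family_on F S U \<Longrightarrow> x \<in> S \<Longrightarrow> F x holomorphic_on U"
  unfolding holo_family_on_def using family_derivative_right holomorphic_on_open by metis

text \<open>The partial derivative is the joint derivative in direction
  \<open>(axis i 1, 0)\<close>, and directional derivatives of a jointly holomorphic function are
  jointly holomorphic.\<close>

lemma holo_family_cpartial: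
  assumes "holo_family_on F S U"
  shows "holo_family_on (\<lambda>x l. cpartial i (\<lambda>y. F y l) x) S U"
proof -
  let ?F = "\<lambda>(y, m). F y m"
  have J: "jholo vec_times ?F (S \<times> U)" using assms holo_family_jholo by blast
  have eq: "cpartial i (\<lambda>y. F y l) x = frechet_derivative ?F (at (x, l)) (axis i 1, 0)"
    if xl: "x \<in> S" "l \<in> U" for x l
  proof -
    obtain a b where ab: "(?F has_derivative (\<lambda>(v, m). pair a v + b * m)) (at (x, l))"
      using assms xl unfolding holo_family_on_def by blast
    show ?thesis
      using cpartial_eq[OF family_derivative_left[OF ab]] frechet_derivative_at[OF ab, symmetric]
      by simp
  qed
  have "holo_family_on (\<lambda>x l. frechet_derivative ?F (at (x, l)) (axis i 1, 0)) S U"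
    using jholo_frechet_derivative[OF J, of "(axis i 1, 0)"] holo_family_open[OF assms]
    by (simp add: holo_family_jholo case_prod_beta')
  then show ?thesis
    unfolding holo_family_on_def
  proof (intro conjI ballI; elim conjE)
    fix x l assume *: "x \<in> S" "l \<in> U" "open S" "open U"
      "\<forall>x\<in>S. \<forall>l\<in>U. \<exists>a b. ((\<lambda>(x, l). frechet_derivative ?F (at (x, l)) (axis i 1, 0))
         has_derivative (\<lambda>(v, m). pair a v + b * m)) (at (x, l))"
    then obtain a b where "((\<lambda>(x, l). frechet_derivative ?F (at (x, l)) (axis i 1, 0))
         has_derivative (\<lambda>(v, m). pair a v + b * m)) (at (x, l))" by blast
    then have "((\<lambda>(x, l). cpartial i (\<lambda>y. F y l) x)
         has_derivative (\<lambda>(v, m). pair a v + b * m)) (at (x, l))"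
      by (rule has_derivative_transform_within_open[where s = "S \<times> U"])
        (use * in \<open>auto simp: open_Times eq\<close>)
    then show "\<exists>a b. ((\<lambda>(y, m). cpartial i (\<lambda>y. F y m) y)
         has_derivative (\<lambda>(v, m). pair a v + b * m)) (at (x, l))" by blast
  qed auto
qed

lemma holo_family_parameter:
  assumes "holo_on G S" "open U" shows "holo_family_on (\<lambda>x l. G x) S U"
  unfolding holo_family_on_def
proof (intro conjI ballI exI)
  fix x l assume "x \<in> S" "l \<in> U"
  have "(fst has_derivative fst) (at (x, l))" by (auto intro!: derivative_eq_intros)
  from diff_chain_at[OF this, of G "pair (differential G x)"]
  show "((\<lambda>(y, m). G y) has_derivative (\<lambda>(v, m). pair (differential G x) v + 0 * m)) (at (x, l))"
    using holo_on_has_derivative[OF assms(1) \<open>x \<in> S\<close>] by (simp add: o_def case_prod_beta')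
qed (use assms holo_on_open in auto)

lemma holo_family_const: "open S \<Longrightarrow> open U \<Longrightarrow> holo_family_on (\<lambda>x l. c) S U"
  by (rule holo_family_parameter[OF holo_on_const])

lemma holo_family_diff:
  assumes "holo_family_on F S U" "holo_family_on G S U"
  shows "holo_family_on (\<lambda>x l. F x l - G x l) S U"
  unfolding holo_family_on_def
proof (intro conjI ballI)
  fix x l assume xl: "x \<in> S" "l \<in> U"
  obtain a b where a: "((\<lambda>(y, m). F y m) has_derivative (\<lambda>(v, m). pair a v + b * m)) (at (x, l))"
    using assms(1) xl unfolding holo_family_on_def by blast
  obtain c d where c: "((\<lambda>(y, m). G y m) has_derivative (\<lambda>(v, m). pair c v + d * m)) (at (x, l))"
    using assms(2) xl unfolding holo_family_on_def by blast
  have "(\<lambda>p. (case p of (v, m) \<Rightarrow> pair a v + b * m) - (case p of (v, m) \<Rightarrow> pair c v + d * m)) =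
      (\<lambda>(v, m). pair (a - c) v + (b - d) * m)"
    by (auto simp: pair_def algebra_simps sum_subtractf)
  with has_derivative_diff[OF a c]
  have "((\<lambda>(y, m). F y m - G y m) has_derivative (\<lambda>(v, m). pair (a - c) v + (b - d) * m)) (at (x, l))"
    by (simp add: case_prod_beta')
  then show "\<exists>a b. ((\<lambda>(y, m). F y m - G y m) has_derivative (\<lambda>(v, m). pair a v + b * m)) (at (x, l))"
    by blast
qed (use assms holo_family_open in auto)

lemma holo_family_compose:
  fixes \<phi> :: "complex^'n \<Rightarrow> complex^'m"
  assumes "holo_family_on F S U" "open \<Omega>" "\<And>k. holo_on (\<lambda>u. \<phi> u $ k) \<Omega>" "\<phi> ` \<Omega> \<subseteq> S"
  shows "holo_family_on (\<lambda>u l. F (\<phi> u) l) \<Omega> U"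
  unfolding holo_family_on_def
proof (intro conjI ballI)
  fix x l assume xl: "x \<in> \<Omega>" "l \<in> U"
  then obtain a b where a: "((\<lambda>(y, m). F y m) has_derivative (\<lambda>(v, m). pair a v + b * m)) (at (\<phi> x, l))"
    using assms(1,4) unfolding holo_family_on_def by (meson image_subset_iff)
  let ?c = "\<lambda>k. differential (\<lambda>u. \<phi> u $ k) x"
  have "(\<phi> has_derivative (\<lambda>v. \<chi> k. pair (?c k) v)) (at x)"
    using holo_on_has_derivative[OF assms(3) xl(1)] by (rule has_derivative_vec_pair)
  moreover have "(fst has_derivative fst) (at (x, l))" by (auto intro!: derivative_eq_intros)
  ultimately have "((\<lambda>p. \<phi> (fst p)) has_derivative (\<lambda>p. \<chi> k. pair (?c k) (fst p))) (at (x, l))"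
    using diff_chain_at[of fst fst "(x, l)" \<phi>] by (simp add: o_def)
  then have "((\<lambda>p. (\<phi> (fst p), snd p)) has_derivative (\<lambda>p. (\<chi> k. pair (?c k) (fst p), snd p))) (at (x, l))"
    by (auto intro!: derivative_eq_intros)
  from diff_chain_at[OF this, of "\<lambda>(y, m). F y m" "\<lambda>(v, m). pair a v + b * m"] a
  have "((\<lambda>(y, m). F (\<phi> y) m) has_derivative
      (\<lambda>(v, m). pair (\<chi> i. \<Sum>k\<in>UNIV. a $ k * ?c k $ i) v + b * m)) (at (x, l))"
    by (simp add: o_def case_prod_beta' pair_vec_compose)
  then show "\<exists>a b. ((\<lambda>(y, m). F (\<phi> y) m) has_derivative (\<lambda>(v, m). pair a v + b * m)) (at (x, l))"
    by blast
qed (use assms holo_family_open in auto)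

section \<open>Degenerate metrics and compatible connections\<close>

lemma pair_eq_row: "(A *v x) $ i = pair (row i A) x"
  by (simp add: matrix_vector_mult_def pair_def row_def)

lemma pair_commute: "pair a b = pair b a"
  by (simp add: pair_def mult.commute)

lemma pair_matrix: "pair a (A *v x) = pair (transpose A *v a) x"
  unfolding pair_def matrix_vector_mult_def transpose_def
  by (simp add: sum_distrib_left sum_distrib_right mult_ac) (rule sum.swap)

lemma rank_eq_card_iff:
  fixes A :: "complex^'n^'m"
  shows "rank A = CARD('n) \<longleftrightarrow> (\<forall>x. A *v x = 0 \<longrightarrow> x = 0)"
proof -
  have "rank A = CARD('n) \<longleftrightarrow> vec.span (rows A) = UNIV"
    unfolding row_rank_def_gen
    by (simp add: vec.dim_eq_full[symmetric] card_cart_basis vec.dimension_def)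
  then show ?thesis
    by (simp add: matrix_left_invertible_span_rows_gen[symmetric] matrix_left_invertible_ker)
qed

text \<open>If \<open>N\<close> and \<open>X\<close> were independent, every row of
  \<open>g\<close>, being orthogonal to both, would be a multiple of their cross product
  \<open>n\<close>, and the rank would be at most one.\<close>

lemma rank_2_kernel:
  fixes g :: "complex^3^3"
  assumes "rank g = 2" "N \<noteq> 0" "g *v N = 0" "g *v X = 0"
  shows "\<exists>c. X = c *s N"
proof (rule ccontr)
  assume no: "\<not> ?thesis"
  have r: "pair r N = 0" "pair r X = 0" if "r \<in> rows g" for r
    using that assms(3,4) pair_eq_row[of g N] pair_eq_row[of g X] by (auto simp: rows_def)
  obtain k where k: "N $ k \<noteq> 0" using assms(2) by (auto simp: vec_eq_iff)
  define n :: "complex^3" where "n = vector [N$2 * X$3 - N$3 * X$2, N$3 * X$1 - N$1 * X$3, N$1 * X$2 - N$2 * X$1]"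
  have "n \<noteq> 0"
  proof
    assume "n = 0"
    then have "N$2 * X$3 = N$3 * X$2" "N$3 * X$1 = N$1 * X$3" "N$1 * X$2 = N$2 * X$1"
      by (auto simp: n_def vec_eq_iff forall_3)
    then have "N $ i * X $ j = N $ j * X $ i" for i j
      using exhaust_3[of i] exhaust_3[of j] by auto
    then have "X = (X $ k / N $ k) *s N"
      using k by (auto simp: vec_eq_iff field_simps)
    with no show False by blast
  qed
  then obtain j where j: "n $ j \<noteq> 0" by (auto simp: vec_eq_iff)
  have "rows g \<subseteq> vec.span {n}"
  proof
    fix r assume "r \<in> rows g"
    from r[OF this] have e: "r$1 * N$1 + r$2 * N$2 + r$3 * N$3 = 0" "r$1 * X$1 + r$2 * X$2 + r$3 * X$3 = 0"
      by (simp_all add: pair_def sum_3)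
    have "r$1 * n$2 = r$2 * n$1" "r$1 * n$3 = r$3 * n$1" "r$2 * n$3 = r$3 * n$2"
      unfolding n_def vector_3 using e by algebra+
    then have "r $ i * n $ j = r $ j * n $ i" for i
      using exhaust_3[of i] exhaust_3[of j] by auto
    then have "r = (r $ j / n $ j) *s n"
      using j by (auto simp: vec_eq_iff field_simps)
    then show "r \<in> vec.span {n}"
      by (metis vec.span_base vec.span_scale insertI1)
  qed
  then have "vec.dim (rows g) \<le> card {n}"
    by (rule vec.dim_le_card) simp
  with assms(1) show False by (simp add: row_rank_def_gen)
qed

text \<open>The kernel of \<open>g\<close> is transverse to that of \<open>\<theta>\<close>, so
  adding the square of \<open>\<theta>\<close> makes \<open>g\<close> non-degenerate. In the
  splitting into the line of \<open>N\<close> and \<open>ker \<theta>\<close>, \<open>m\<close> is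
  block diagonal with blocks 1 and \<open>g\<close>; removing the square of \<open>N\<close> from
  its inverse leaves the inverse of \<open>g\<close> on \<open>ker \<theta>\<close>.\<close>

lemma degenerate_metric_inverse:
  fixes g :: "complex^3^3" and \<theta> N :: "complex^3"
  assumes sym: "transpose g = g" and gN: "g *v N = 0" and tN: "pair \<theta> N = 1"
    and ker: "\<And>X. g *v X = 0 \<Longrightarrow> \<exists>c. X = c *s N"
  defines "m \<equiv> \<chi> i j. g $ i $ j + \<theta> $ i * \<theta> $ j"
  defines "k \<equiv> \<chi> i j. matrix_inv m $ i $ j - N $ i * N $ j"
  shows "invertible m" "matrix_inv m *v \<theta> = N" "transpose k = k" "k *v \<theta> = 0"
    "g ** k = (\<chi> i j. mat 1 $ i $ j - \<theta> $ i * N $ j)"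
proof -
  let ?B = "matrix_inv m"
  have m: "m *v X = g *v X + pair \<theta> X *s \<theta>" for X
    by (simp add: m_def vec_eq_iff matrix_vector_mult_def pair_def algebra_simps sum.distrib sum_distrib_left)
  have "X = 0" if "m *v X = 0" for X
  proof -
    have "pair N (m *v X) = 0" using that by (simp add: pair_def)
    then have "pair N (g *v X) + pair \<theta> X * pair N \<theta> = 0"
      by (simp only: m pair_add pair_smult)
    moreover have "pair N (g *v X) = 0"
      using pair_matrix[of N g X] unfolding sym gN by (simp add: pair_def)
    ultimately have t: "pair \<theta> X = 0" using tN by (simp add: pair_commute)
    with that m have "g *v X = 0" by simp
    with ker obtain c where "X = c *s N" by blast
    with t tN show "X = 0" by (simp add: pair_smult)
  qed
  then show inv: "invertible m"
    by (metis invertible_left_inverse matrix_left_invertible_ker)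
  have "m *v N = \<theta>" using m gN tN by simp
  then show BN: "?B *v \<theta> = N"
    by (metis inv matrix_inv_left matrix_vector_mul_assoc matrix_vector_mul_lid)
  have tm: "transpose m = m"
    using sym by (simp add: m_def transpose_def vec_eq_iff mult.commute)
  have tB: "transpose ?B = ?B"
  proof -
    have "transpose ?B ** m = mat 1"
      by (metis inv matrix_inv_right matrix_transpose_mul tm transpose_mat)
    then have "transpose ?B = (transpose ?B ** m) ** ?B"
      by (metis inv matrix_inv_right matrix_mul_assoc matrix_mul_rid)
    then show ?thesis
      using \<open>transpose ?B ** m = mat 1\<close> by simp
  qed
  then show "transpose k = k"
    by (simp add: k_def transpose_def vec_eq_iff mult.commute)
  have kv: "k *v X = ?B *v X - pair N X *s N" for X
    by (simp add: k_def vec_eq_iff matrix_vector_mult_def pair_def algebra_simps sum_subtractf sum_distrib_left)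
  show "k *v \<theta> = 0" using BN tN by (simp add: kv pair_commute)
  show "g ** k = (\<chi> i j. mat 1 $ i $ j - \<theta> $ i * N $ j)"
  proof (simp only: vec_eq_iff, intro allI)
    fix i j
    have 1: "(\<Sum>l\<in>UNIV. m $ i $ l * ?B $ l $ j) = mat 1 $ i $ j"
      using matrix_inv_right[OF inv] by (simp add: matrix_matrix_mult_def vec_eq_iff)
    have 2: "(\<Sum>l\<in>UNIV. \<theta> $ l * ?B $ l $ j) = N $ j"
    proof -
      have "?B $ l $ j = ?B $ j $ l" for l
        using tB by (simp add: transpose_def vec_eq_iff)
      then show ?thesis
        using BN by (simp add: matrix_vector_mult_def vec_eq_iff mult.commute)
    qed
    have 3: "(\<Sum>l\<in>UNIV. g $ i $ l * N $ l) = 0"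
      using gN by (simp add: matrix_vector_mult_def vec_eq_iff)
    have "(g ** k) $ i $ j = (\<Sum>l\<in>UNIV. m $ i $ l * ?B $ l $ j - \<theta> $ i * (\<theta> $ l * ?B $ l $ j)
        - (g $ i $ l * N $ l) * N $ j)"
      by (simp add: matrix_matrix_mult_def k_def m_def algebra_simps)
    also have "\<dots> = mat 1 $ i $ j - \<theta> $ i * N $ j - 0 * N $ j"
      by (simp only: sum_subtractf sum_distrib_left[symmetric] sum_distrib_right[symmetric] 1 2 3)
    finally show "(g ** k) $ i $ j = (\<chi> i j. mat 1 $ i $ j - \<theta> $ i * N $ j) $ i $ j" by simp
  qed
qed

lemma sum_mat_1: "(\<Sum>j\<in>UNIV. mat 1 $ i $ j * Y j) = (Y i :: complex)"
  "(\<Sum>j\<in>UNIV. Y j * mat 1 $ i $ j) = (Y i :: complex)"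
  by (simp_all add: mat_def if_distrib[of "\<lambda>c. c * _"] if_distrib[of "(*) _"] cong: if_cong)

lemma matrix_vector_axis: "(A *v axis j 1) $ i = (A $ i $ j :: complex)"
  by (simp add: matrix_vector_mult_def axis_def if_distrib cong: if_cong)

text \<open>With \<open>P = 1 - N \<theta>\<^sup>T\<close> the projection onto \<open>ker \<theta>\<close>, the connection is
  \<open>\<Gamma>\<^sub>i = N (\<partial>\<^sub>i\<theta>)\<^sup>T - P (\<partial>\<^sub>ik) \<sigma> / 2\<close>; it parallelises \<open>\<theta>\<close> because \<open>\<theta>\<^sup>T P = 0\<close>, and \<open>k\<close> because
  \<open>\<sigma> k = P\<^sup>T\<close>.\<close>

lemma newton_cartan_exists:
  fixes \<theta> N :: "complex^3 \<Rightarrow> complex^3" and k \<sigma> :: "complex^3 \<Rightarrow> complex^3^3"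
  assumes "open \<Omega>"
    and h\<theta>: "\<And>i. holo_on (\<lambda>u. \<theta> u $ i) \<Omega>" and hN: "\<And>i. holo_on (\<lambda>u. N u $ i) \<Omega>"
    and hk: "\<And>i j. holo_on (\<lambda>u. k u $ i $ j) \<Omega>" and h\<sigma>: "\<And>i j. holo_on (\<lambda>u. \<sigma> u $ i $ j) \<Omega>"
    and tk: "\<And>u. u \<in> \<Omega> \<Longrightarrow> transpose (k u) = k u"
    and ts: "\<And>u. u \<in> \<Omega> \<Longrightarrow> transpose (\<sigma> u) = \<sigma> u"
    and kt: "\<And>u. u \<in> \<Omega> \<Longrightarrow> k u *v \<theta> u = 0"
    and tN: "\<And>u. u \<in> \<Omega> \<Longrightarrow> pair (\<theta> u) (N u) = 1"
    and sk: "\<And>u. u \<in> \<Omega> \<Longrightarrow> \<sigma> u ** k u = (\<chi> i j. mat 1 $ i $ j - \<theta> u $ i * N u $ j)"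
    and q: "\<And>u X Y. u \<in> \<Omega> \<Longrightarrow> pair (\<theta> u) X = 0 \<Longrightarrow> pair (\<theta> u) Y = 0 \<Longrightarrow> q u X Y = pair X (\<sigma> u *v Y)"
  shows "inverse_spatial_metric \<Omega> \<theta> q k" "\<exists>\<Gamma>. newton_cartan \<Omega> \<theta> k \<Gamma>"
proof -
  have ks: "k u *v (\<sigma> u *v Y) = Y - pair (\<theta> u) Y *s N u" if "u \<in> \<Omega>" for u Y
  proof -
    have "k u ** \<sigma> u = transpose (\<sigma> u ** k u)"
      using tk ts that by (simp add: matrix_transpose_mul)
    also have "\<dots> = (\<chi> i j. mat 1 $ i $ j - N u $ i * \<theta> u $ j)"
      by (simp add: sk[OF that] transpose_def vec_eq_iff mat_def)
    finally show ?thesis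
      by (simp only: matrix_vector_mul_assoc)
        (simp add: vec_eq_iff matrix_vector_mult_def pair_def sum_mat_1
          left_diff_distrib right_diff_distrib sum_subtractf sum_distrib_left mult_ac)
  qed
  have tka: "pair (\<theta> u) (k u *v \<alpha>) = 0" if "u \<in> \<Omega>" for u \<alpha>
    using pair_matrix[of "\<theta> u" "k u" \<alpha>] unfolding tk[OF that] kt[OF that] by (simp add: pair_def)
  show "inverse_spatial_metric \<Omega> \<theta> q k"
    unfolding inverse_spatial_metric_def
  proof (intro ballI allI conjI impI)
    fix u \<alpha> Y assume u: "u \<in> \<Omega>" and Y: "pair (\<theta> u) Y = 0"
    have "q u (k u *v \<alpha>) Y = pair (\<sigma> u *v Y) (k u *v \<alpha>)"
      using q[OF u tka[OF u] Y] by (simp add: pair_commute)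
    also have "\<dots> = pair Y \<alpha>"
      using tk[OF u] ks[OF u] Y by (simp add: pair_matrix)
    finally show "q u (k u *v \<alpha>) Y = pair \<alpha> Y" by (simp add: pair_commute)
  qed (rule tka)
  define dk where "dk u i = (\<chi> a b. cpartial i (\<lambda>y. k y $ a $ b) u)" for u i
  define d\<theta> where "d\<theta> u i = (\<chi> a. cpartial i (\<lambda>y. \<theta> y $ a) u)" for u i
  define P where "P u = (\<chi> a b. mat 1 $ a $ b - N u $ a * \<theta> u $ b)" for u
  define \<Gamma> where "\<Gamma> u = (\<chi> j i l. N u $ j * d\<theta> u i $ l
    - 1/2 * (\<Sum>a\<in>UNIV. \<Sum>b\<in>UNIV. P u $ j $ a * dk u i $ a $ b * \<sigma> u $ b $ l))" for u
  have hP: "holo_on (\<lambda>u. P u $ a $ b) \<Omega>" for a b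
    unfolding P_def by (simp, intro holo_on_diff holo_on_mult hN h\<theta> holo_on_const \<open>open \<Omega>\<close>)
  have hG: "holo_on (\<lambda>u. \<Gamma> u $ j $ i $ l) \<Omega>" for i j l
    unfolding \<Gamma>_def d\<theta>_def dk_def
    by (simp, intro holo_on_diff holo_on_mult holo_on_sum holo_on_divide hN h\<sigma> hP
        holo_on_cpartial h\<theta> hk holo_on_const \<open>open \<Omega>\<close>) auto
  have tP: "(\<Sum>a\<in>UNIV. P u $ j $ a * X a) = X j - N u $ j * (\<Sum>a\<in>UNIV. \<theta> u $ a * X a)" for u j X
    by (simp add: P_def sum_mat_1 left_diff_distrib sum_subtractf sum_distrib_left mult.assoc)
  have kernel: "{\<alpha>. k u *v \<alpha> = 0} = vec.span {\<theta> u}" if u: "u \<in> \<Omega>" for u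
  proof (intro equalityI subsetI; clarify?)
    fix \<alpha> assume "k u *v \<alpha> = 0"
    then have "(\<sigma> u ** k u) *v \<alpha> = 0" by (simp add: matrix_vector_mul_assoc[symmetric])
    moreover have "(\<sigma> u ** k u) *v \<alpha> = \<alpha> - pair (N u) \<alpha> *s \<theta> u"
      unfolding sk[OF u]
      by (simp add: vec_eq_iff matrix_vector_mult_def pair_def sum_mat_1
          left_diff_distrib right_diff_distrib sum_subtractf sum_distrib_left mult_ac)
    ultimately have "\<alpha> = pair (N u) \<alpha> *s \<theta> u" by simp
    then show "\<alpha> \<in> vec.span {\<theta> u}"
      by (metis vec.span_base vec.span_scale insertI1)
  next
    fix \<alpha> assume "\<alpha> \<in> vec.span {\<theta> u}"
    then obtain c where "\<alpha> = c *s \<theta> u" by (auto simp: vec.span_singleton)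
    then show "k u *v \<alpha> = 0" using kt[OF u] by (simp add: vec.scale)
  qed
  have rank: "rank (k u) = 2" if u: "u \<in> \<Omega>" for u
  proof -
    have "\<theta> u \<noteq> 0" using tN[OF u] by (auto simp: pair_def)
    then have "rank (k u) \<noteq> 3"
      using rank_eq_card_iff[of "k u"] kt[OF u] by auto
    moreover have "rank (k u) \<le> 3"
      using vec.dim_subset_UNIV[of "rows (k u)"]
      by (simp add: row_rank_def_gen vec.dimension_def card_cart_basis)
    \<comment> \<open>By \<open>ks\<close> every vector is a value of \<open>k u\<close> plus a
      multiple of \<open>N u\<close>. The image of \<open>k u\<close> therefore has codimension at
      most one, and by symmetry it is the row space.\<close>
    moreover have "3 \<le> rank (k u) + 1"
    proof -
      have "v \<in> vec.span (insert (N u) (rows (k u)))" for v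
      proof -
        have "k u *v (\<sigma> u *v v) \<in> vec.span (columns (k u))"
          by (simp add: matrix_vector_mult_in_columnspace_gen)
        also have "columns (k u) = rows (k u)"
          using tk[OF u] by (metis rows_transpose)
        finally have "k u *v (\<sigma> u *v v) \<in> vec.span (insert (N u) (rows (k u)))"
          by (meson subset_insertI subsetD vec.span_mono)
        moreover have "v = k u *v (\<sigma> u *v v) + pair (\<theta> u) v *s N u"
          using ks[OF u] by simp
        ultimately show ?thesis
          by (metis insertI1 vec.span_add vec.span_base vec.span_scale)
      qed
      then have "vec.span (insert (N u) (rows (k u))) = UNIV" by blast
      then have "vec.dim (insert (N u) (rows (k u))) = 3"
        by (simp add: vec.dim_eq_full[symmetric] vec.dimension_def card_cart_basis)
      then show ?thesis
        by (simp add: row_rank_def_gen vec.dim_insert split: if_splits)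
    qed
    ultimately show ?thesis by linarith
  qed
  have "newton_cartan \<Omega> \<theta> k \<Gamma>"
    unfolding newton_cartan_def
  proof (intro conjI allI ballI h\<theta> hk hG tk rank kernel)
    fix u i j assume u: "u \<in> \<Omega>"
    have "(\<Sum>l\<in>UNIV. \<Gamma> u $ l $ i $ j * \<theta> u $ l) = pair (\<theta> u) (N u) * d\<theta> u i $ j
      - 1/2 * (\<Sum>l\<in>UNIV. \<theta> u $ l * (\<Sum>a\<in>UNIV. P u $ l $ a * (\<Sum>b\<in>UNIV. dk u i $ a $ b * \<sigma> u $ b $ j)))"
      by (simp add: \<Gamma>_def left_diff_distrib right_diff_distrib sum_subtractf pair_def
          sum_distrib_left sum_distrib_right mult_ac)
    also have "(\<Sum>l\<in>UNIV. \<theta> u $ l * (\<Sum>a\<in>UNIV. P u $ l $ a * (\<Sum>b\<in>UNIV. dk u i $ a $ b * \<sigma> u $ b $ j))) = 0"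
    proof -
      have "(\<Sum>l\<in>UNIV. \<theta> u $ l * (X l - N u $ l * c)) = (\<Sum>l\<in>UNIV. \<theta> u $ l * X l) - pair (\<theta> u) (N u) * c" for X c
        by (simp add: right_diff_distrib sum_subtractf pair_def sum_distrib_left mult_ac)
      then show ?thesis by (simp only: tP tN[OF u]) simp
    qed
    finally show "cpartial i (\<lambda>y. \<theta> y $ j) u - (\<Sum>l\<in>UNIV. \<Gamma> u $ l $ i $ j * \<theta> u $ l) = 0"
      by (simp add: tN[OF u] d\<theta>_def)
  next
    fix u i j n assume u: "u \<in> \<Omega>"
    let ?K = "dk u i" and ?c = "\<lambda>m. \<Sum>l\<in>UNIV. d\<theta> u i $ l * k u $ l $ m"
    have symk: "k y $ a $ b = k y $ b $ a" if "y \<in> \<Omega>" for y a b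
      using tk[OF that] by (simp add: transpose_def vec_eq_iff)
    have symK: "?K $ a $ b = ?K $ b $ a" for a b
      unfolding dk_def using cpartial_cong[OF \<open>open \<Omega>\<close> u symk hk] by simp
    have t0: "(\<Sum>l\<in>UNIV. \<theta> y $ l * k y $ l $ m) = 0" if "y \<in> \<Omega>" for y m
      using kt[OF that] unfolding symk[OF that, of _ m]
      by (simp add: matrix_vector_mult_def vec_eq_iff mult.commute)
    \<comment> \<open>The derivative of the identity \<open>t0\<close>, which expresses the
      contraction of \<open>\<theta> u\<close> with the derivative of \<open>k\<close> through the
      derivative of \<open>\<theta>\<close>.\<close>
    have tK: "(\<Sum>l\<in>UNIV. \<theta> u $ l * ?K $ l $ m) = - ?c m" for m
    proof -
      have "cpartial i (\<lambda>y. \<Sum>l\<in>UNIV. \<theta> y $ l * k y $ l $ m) u = cpartial i (\<lambda>y. 0) u"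
        by (rule cpartial_cong[OF \<open>open \<Omega>\<close> u]) (simp_all add: t0 holo_on_sum holo_on_mult h\<theta> hk \<open>open \<Omega>\<close>)
      also have "cpartial i (\<lambda>y. \<Sum>l\<in>UNIV. \<theta> y $ l * k y $ l $ m) u =
          (\<Sum>l\<in>UNIV. \<theta> u $ l * ?K $ l $ m + k u $ l $ m * d\<theta> u i $ l)"
        by (subst cpartial_sum[where S = \<Omega>])
          (simp_all add: u \<open>open \<Omega>\<close> holo_on_mult h\<theta> hk cpartial_mult[OF h\<theta> hk u] dk_def d\<theta>_def)
      finally show ?thesis
        by (simp add: sum.distrib mult.commute eq_neg_iff_add_eq_0)
    qed
    have skc: "(\<Sum>l\<in>UNIV. \<sigma> u $ b $ l * k u $ l $ m) = P u $ m $ b" for b m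
      using sk[OF u] by (simp add: matrix_matrix_mult_def vec_eq_iff P_def mat_def mult.commute)
    \<comment> \<open>Symmetrised in \<open>j\<close> and \<open>m\<close>, the right-hand side is
      minus \<open>?K $ j $ m\<close>: the terms with \<open>N\<close> cancel, one copy from the
      first summand against two halves from the second.\<close>
    have G: "(\<Sum>l\<in>UNIV. \<Gamma> u $ j $ i $ l * k u $ l $ m) =
        N u $ j * ?c m - 1/2 * (?K $ j $ m + N u $ j * ?c m + N u $ m * ?c j)" for j m
    proof -
      have "(\<Sum>l\<in>UNIV. \<Gamma> u $ j $ i $ l * k u $ l $ m) = N u $ j * ?c m
        - 1/2 * (\<Sum>l\<in>UNIV. \<Sum>a\<in>UNIV. \<Sum>b\<in>UNIV. P u $ j $ a * ?K $ a $ b * (\<sigma> u $ b $ l * k u $ l $ m))"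
        by (simp add: \<Gamma>_def left_diff_distrib right_diff_distrib sum_subtractf
            sum_distrib_left sum_distrib_right mult_ac)
      also have "(\<Sum>l\<in>UNIV. \<Sum>a\<in>UNIV. \<Sum>b\<in>UNIV. P u $ j $ a * ?K $ a $ b * (\<sigma> u $ b $ l * k u $ l $ m))
         = (\<Sum>a\<in>UNIV. \<Sum>b\<in>UNIV. P u $ j $ a * ?K $ a $ b * P u $ m $ b)"
        unfolding skc[symmetric] sum_distrib_left
        by (subst sum.swap, rule sum.cong[OF refl], rule sum.swap)
      also have "\<dots> = (\<Sum>a\<in>UNIV. P u $ j $ a * (\<Sum>b\<in>UNIV. P u $ m $ b * ?K $ a $ b))"
        by (simp add: sum_distrib_left mult_ac)
      also have "\<dots> = ?K $ j $ m - N u $ m * (\<Sum>b\<in>UNIV. \<theta> u $ b * ?K $ b $ j)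
         - N u $ j * (\<Sum>a\<in>UNIV. \<theta> u $ a * (?K $ a $ m - N u $ m * (\<Sum>b\<in>UNIV. \<theta> u $ b * ?K $ b $ a)))"
        unfolding tP using symK[of j] symK by simp
      also have "\<dots> = ?K $ j $ m + N u $ m * ?c j + N u $ j * ?c m
         - N u $ j * N u $ m * (\<Sum>a\<in>UNIV. \<theta> u $ a * ?c a)"
        unfolding tK right_diff_distrib sum_subtractf
        by (simp add: sum_distrib_left[symmetric] tK sum_negf algebra_simps)
      also have "(\<Sum>a\<in>UNIV. \<theta> u $ a * ?c a) = (\<Sum>l\<in>UNIV. d\<theta> u i $ l * (\<Sum>a\<in>UNIV. \<theta> u $ a * k u $ a $ l))"
        unfolding sum_distrib_left using symk[OF u] by (subst sum.swap) (simp add: mult_ac)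
      also have "\<dots> = 0" by (simp add: t0[OF u])
      finally show ?thesis by (simp add: algebra_simps)
    qed
    have "(\<Sum>l\<in>UNIV. \<Gamma> u $ n $ i $ l * k u $ j $ l) = (\<Sum>l\<in>UNIV. \<Gamma> u $ n $ i $ l * k u $ l $ j)"
      using symk[OF u] by simp
    then show "cpartial i (\<lambda>y. k y $ j $ n) u
          + (\<Sum>l\<in>UNIV. \<Gamma> u $ j $ i $ l * k u $ l $ n)
          + (\<Sum>l\<in>UNIV. \<Gamma> u $ n $ i $ l * k u $ j $ l) = 0"
      unfolding G using symK[of n j] by (simp add: dk_def algebra_simps)
  qed
  then show "\<exists>\<Gamma>. newton_cartan \<Omega> \<theta> k \<Gamma>" by blast
qed

section \<open>Non-null surfaces in the flat three-space\<close>

lemma flat3_pair: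
  "pair X (flat3 *v Y) = (X $ 1 * Y $ 2 + X $ 2 * Y $ 1) / 2 + X $ 3 * Y $ 3"
  by (simp add: pair_def flat3_def matrix_vector_mult_def sum_3 field_simps)

lemma pair_restricted:
  "pair X ((transpose J ** flat3 ** J) *v Y) = pair (J *v X) (flat3 *v (J *v Y))"
  by (simp only: matrix_vector_mul_assoc[symmetric] pair_matrix[of X "transpose J"] transpose_transpose)

text \<open>The expression is the norm of the cross product of columns \<open>a\<close> and \<open>b\<close> of \<open>J\<close>, a conormal of the
  image of \<open>J\<close>, and is minus four times the Gram determinant of these columns.\<close>

lemma non_null_conormal:
  fixes J :: "complex^3^3" and N :: "complex^3"
  assumes "J *v N = 0" "N \<noteq> 0"
    and ker: "\<And>X. (transpose J ** flat3 ** J) *v X = 0 \<Longrightarrow> \<exists>c. X = c *s N"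
  obtains a b where
    "(J$3$a * J$1$b - J$1$a * J$3$b) * (J$2$a * J$3$b - J$3$a * J$2$b) * 4
      + (J$1$a * J$2$b - J$2$a * J$1$b)^2 \<noteq> 0"
proof -
  let ?g = "transpose J ** flat3 ** J"
  obtain k where k: "N $ k \<noteq> 0" using assms(2) by (auto simp: vec_eq_iff)
  obtain a b :: 3 where ab: "a \<noteq> k" "b \<noteq> k" "a \<noteq> b" "\<And>i. i = a \<or> i = b \<or> i = k"
  proof -
    consider "k = 1" | "k = 2" | "k = 3" using exhaust_3 by blast
    then show thesis
      by cases (use that[of 2 3] that[of 1 3] that[of 1 2] exhaust_3 in auto)
  qed
  let ?p = "\<lambda>X Y. pair X (?g *v Y)"
  let ?a = "axis a 1 :: complex^3" and ?b = "axis b 1 :: complex^3"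
  have symp: "?p X Y = ?p Y X" for X Y
    unfolding pair_restricted flat3_pair by (simp add: algebra_simps)
  have sum3: "(\<Sum>i\<in>UNIV. f i) = f a + f b + f k" for f :: "3 \<Rightarrow> complex"
  proof -
    have U: "UNIV = {a, b, k}" using ab(4) by auto
    show ?thesis unfolding U using ab(1-3) by simp
  qed
  \<comment> \<open>Vectors with vanishing coordinate \<open>k\<close> form a complement of the
    kernel spanned by \<open>N\<close>, so the restricted metric is non-degenerate on the span of
    \<open>?a\<close> and \<open>?b\<close>.\<close>
  have small: "X = 0" if "X $ k = 0" "?p ?a X = 0" "?p ?b X = 0" for X
  proof -
    have "?p N X = 0"
      using symp[of N X] assms(1) by (simp add: matrix_vector_mul_assoc[symmetric] pair_def)
    moreover have "?p ?a X = (?g *v X) $ a" "?p ?b X = (?g *v X) $ b"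
      by (subst pair_commute, simp)+
    ultimately have "(?g *v X) $ k * N $ k = 0" "(?g *v X) $ a = 0" "(?g *v X) $ b = 0"
      using that(2,3) unfolding pair_def sum3[of "\<lambda>i. N $ i * _ i"] by (simp_all add: mult.commute)
    then have "(?g *v X) $ i = 0" for i using k ab(4)[of i] by auto
    then have "?g *v X = 0" by (simp add: vec_eq_iff)
    with ker obtain c where "X = c *s N" by blast
    with that(1) k show "X = 0" by simp
  qed
  have lin: "?p Z (x *s X - y *s Y) = x * ?p Z X - y * ?p Z Y" for x y X Y Z
    by (simp add: vec.diff vec.scale pair_diff pair_smult)
  define A B C where "A = ?p ?a ?a" and "B = ?p ?a ?b" and "C = ?p ?b ?b"
  have nz: "A * C - B^2 \<noteq> 0"
  proof
    assume d: "A * C - B^2 = 0"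
    have B': "?p ?b ?a = B" using symp by (simp add: B_def)
    \<comment> \<open>The coefficients come from the adjugate of the Gram matrix: if its determinant
      vanishes, both combinations are orthogonal to \<open>?a\<close> and \<open>?b\<close>.\<close>
    have "C *s ?a - B *s ?b = 0" "B *s ?a - A *s ?b = 0"
      using d ab(1-3) by (auto intro!: small simp only: lin A_def[symmetric] B_def[symmetric] B' C_def[symmetric])
        (auto simp: axis_def power2_eq_square algebra_simps)
    then have "C = 0" "B = 0" "A = 0"
      using ab(3) by (auto simp: vec_eq_iff axis_def split: if_splits dest!: spec[of _ a] spec[of _ b])
    then have "?a = 0"
      using ab B' by (intro small) (auto simp: axis_def A_def B_def)
    then show False by (simp add: axis_eq_0_iff)
  qed
  have col: "(J *v axis j 1) $ i = J $ i $ j" for i j by (rule matrix_vector_axis)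
  have "A = J$1$a * J$2$a + (J$3$a)^2" "C = J$1$b * J$2$b + (J$3$b)^2"
    "2 * B = J$1$a * J$2$b + J$2$a * J$1$b + 2 * J$3$a * J$3$b"
    unfolding A_def B_def C_def pair_restricted flat3_pair col
    by (simp_all add: power2_eq_square field_simps)
  then have "(J$3$a * J$1$b - J$1$a * J$3$b) * (J$2$a * J$3$b - J$3$a * J$2$b) * 4
      + (J$1$a * J$2$b - J$2$a * J$1$b)^2 = - 4 * (A * C - B^2)"
    by algebra
  with nz show thesis using that[of a b] by simp
qed

text \<open>The assumption \<open>curl\<close> says that the Hodge dual of \<open>\<beta>\<close> restricts to zero on the image of \<open>J\<close>, in
  other words that the conormal \<open>\<beta>\<close> is null.\<close>

lemma gradient_zero:
  fixes J :: "complex^3^3" and \<beta> \<gamma> :: "complex^3"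
  assumes "J *v N = 0" "N \<noteq> 0" "\<And>X. (transpose J ** flat3 ** J) *v X = 0 \<Longrightarrow> \<exists>c. X = c *s N"
    and tan: "\<And>j. (\<Sum>k\<in>UNIV. \<beta> $ k * J $ k $ j) = 0"
    and curl: "\<And>i j. (\<Sum>k\<in>UNIV. \<gamma> $ k * J $ k $ i) * J $ 2 $ j = (\<Sum>k\<in>UNIV. \<gamma> $ k * J $ k $ j) * J $ 2 $ i"
    and \<gamma>: "\<gamma> $ 1 = - \<beta> $ 3 / 2" "\<gamma> $ 3 = 2 * \<beta> $ 2"
  shows "\<beta> = 0"
proof -
  obtain a b where nz: "(J$3$a * J$1$b - J$1$a * J$3$b) * (J$2$a * J$3$b - J$3$a * J$2$b) * 4
      + (J$1$a * J$2$b - J$2$a * J$1$b)^2 \<noteq> 0"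
    using non_null_conormal[OF assms(1-3)] by blast
  \<comment> \<open>By \<open>tan\<close>, \<open>\<beta>\<close> is proportional to this cross
    product, and \<open>curl\<close> adds one linear equation. Together they annihilate the product
    of each component of \<open>\<beta>\<close> with the norm \<open>n3^2 + 4 n1 n2\<close>, whose
    factor 4 is that of the inverse of \<open>flat3\<close>.\<close>
  define n1 n2 n3 where n: "n1 = J$2$a * J$3$b - J$3$a * J$2$b" "n2 = J$3$a * J$1$b - J$1$a * J$3$b"
    "n3 = J$1$a * J$2$b - J$2$a * J$1$b"
  have t: "\<beta>$1 * J$1$a + \<beta>$2 * J$2$a + \<beta>$3 * J$3$a = 0" "\<beta>$1 * J$1$b + \<beta>$2 * J$2$b + \<beta>$3 * J$3$b = 0"
    using tan[of a] tan[of b] by (simp_all add: sum_3)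
  have c: "\<gamma>$1 * n3 = \<gamma>$3 * n1"
    using curl[of a b] unfolding sum_3 n by algebra
  have p: "\<beta>$1 * n2 = \<beta>$2 * n1" "\<beta>$1 * n3 = \<beta>$3 * n1" "\<beta>$2 * n3 = \<beta>$3 * n2"
    unfolding n using t by algebra+
  have "- (\<beta>$3 * n3) = 4 * \<beta>$2 * n1"
    using c unfolding \<gamma> by (simp add: field_simps)
  then have e: "\<beta>$3 * n3 + 4 * \<beta>$2 * n1 = 0" by algebra
  have q: "n2 * n1 * 4 + n3^2 \<noteq> 0" using nz unfolding n by (simp add: power2_eq_square)
  have "\<beta>$1 * (n2 * n1 * 4 + n3^2) = 0" "\<beta>$2 * (n2 * n1 * 4 + n3^2) = 0"
    "\<beta>$3 * (n2 * n1 * 4 + n3^2) = 0"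
    using p e by algebra+
  then have "\<beta>$1 = 0" "\<beta>$2 = 0" "\<beta>$3 = 0"
    using q by (simp_all only: mult_eq_0_iff simp_thms)
  then show ?thesis by (simp add: vec_eq_iff forall_3)
qed

text \<open>The next lemma is the reason why a harmonic function with vanishing Cauchy data on a non-null
  surface vanishes to all orders there.\<close>

lemma tracefree_zero:
  fixes J M :: "complex^3^3"
  assumes "J *v N = 0" "N \<noteq> 0" "\<And>X. (transpose J ** flat3 ** J) *v X = 0 \<Longrightarrow> \<exists>c. X = c *s N"
    and sym: "transpose M = M" and MJ: "M ** J = 0" and trace: "4 * M $ 1 $ 2 + M $ 3 $ 3 = 0"
  shows "M = 0"
proof -
  obtain a b where nz: "(J$3$a * J$1$b - J$1$a * J$3$b) * (J$2$a * J$3$b - J$3$a * J$2$b) * 4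
      + (J$1$a * J$2$b - J$2$a * J$1$b)^2 \<noteq> 0"
    using non_null_conormal[OF assms(1-3)] by blast
  define n1 n2 n3 where n: "n1 = J$2$a * J$3$b - J$3$a * J$2$b" "n2 = J$3$a * J$1$b - J$1$a * J$3$b"
    "n3 = J$1$a * J$2$b - J$2$a * J$1$b"
  have t: "M$i$1 * J$1$j + M$i$2 * J$2$j + M$i$3 * J$3$j = 0" for i j
    using MJ by (simp add: matrix_matrix_mult_def vec_eq_iff sum_3)
  \<comment> \<open>Rows of \<open>M\<close> are multiples of the conormal, so by symmetry
    \<open>M\<close> is a multiple of its square. The trace is then this multiple of the non-zero
    norm of the conormal.\<close>
  have p: "M$i$1 * n2 = M$i$2 * n1" "M$i$1 * n3 = M$i$3 * n1" "M$i$2 * n3 = M$i$3 * n2" for i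
    unfolding n using t[of i a] t[of i b] by algebra+
  have s: "M$2$1 = M$1$2" "M$3$1 = M$1$3" "M$3$2 = M$2$3"
    using sym by (auto simp: transpose_def vec_eq_iff)
  have q: "n2 * n1 * 4 + n3^2 \<noteq> 0" using nz unfolding n by (simp add: power2_eq_square)
  note P = p[of 1] p[of 2] p[of 3]
  have "M$1$1 * (n2 * n1 * 4 + n3^2) = 0"
    "M$1$2 * (n2 * n1 * 4 + n3^2) = 0"
    "M$1$3 * (n2 * n1 * 4 + n3^2) = 0"
    "M$2$2 * (n2 * n1 * 4 + n3^2) = 0"
    "M$2$3 * (n2 * n1 * 4 + n3^2) = 0"
    "M$3$3 * (n2 * n1 * 4 + n3^2) = 0"
    using P s trace by algebra+
  then have "M$1$1 = 0" "M$1$2 = 0" "M$1$3 = 0" "M$2$2 = 0" "M$2$3 = 0" "M$3$3 = 0"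
    using q by (simp_all only: mult_eq_0_iff simp_thms)
  then show ?thesis using s by (simp add: vec_eq_iff forall_3)
qed

section \<open>Functions on the two charts of the sphere\<close>

text \<open>Any radius above \<open>r\<close> and below the inverse of \<open>s\<close> will do; for
  \<open>s = 0\<close> there is no upper bound.\<close>

lemma sphere_cover_radius:
  assumes "sphere_cover U U'"
  obtains t where "t > 0" "\<And>l. norm l = t \<Longrightarrow> l \<in> overlap U U'" "cball 0 t \<subseteq> U" "cball 0 (inverse t) \<subseteq> U'"
proof -
  obtain r s where rs: "0 \<le> r" "0 \<le> s" "r * s < 1" "U = {l. s * norm l < 1}" "U' = {m. r * norm m < 1}"
    using assms unfolding sphere_cover_def by blast
  have "\<exists>t. t > 0 \<and> r < t \<and> s * t < 1"
  proof (cases "s = 0")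
    case True
    with rs(1) show ?thesis by (intro exI[of _ "r + 1"]) auto
  next
    case False
    with rs(1-3) have "r < inverse s" "s > 0" by (auto simp: field_simps)
    with rs(1) show ?thesis
      by (intro exI[of _ "(r + inverse s) / 2"]) (auto simp: field_simps intro: add_pos_nonneg)
  qed
  then obtain t where t: "t > 0" "r < t" "s * t < 1" by blast
  have 1: "cball 0 t \<subseteq> U"
    using t rs by (auto intro: le_less_trans[OF mult_left_mono])
  have "r * inverse t < 1" using t by (simp add: field_simps)
  then have 2: "cball 0 (inverse t) \<subseteq> U'"
    using rs(1) by (auto simp: rs(5) intro: le_less_trans[OF mult_left_mono])
  have "l \<in> overlap U U'" if "norm l = t" for l
    using that 1 2 t(1) unfolding overlap_def by (auto simp: norm_inverse)
  with that t 1 2 show thesis by blast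
qed

text \<open>\<open>sphere_cover_larger\<close> is for power series: each point of \<open>U\<close>
  lies closer to 0 than some point of the overlap, where convergence is known.\<close>

lemma
  assumes "sphere_cover U U'"
  shows sphere_cover_open: "open U" "open U'"
    and sphere_cover_convex: "convex U" "convex U'"
    and sphere_cover_0: "0 \<in> U" "0 \<in> U'"
    and sphere_cover_covers: "l \<notin> U \<Longrightarrow> l \<noteq> 0 \<and> inverse l \<in> U'"
    and sphere_cover_swap: "sphere_cover U' U"
    and sphere_cover_larger: "l \<in> U \<Longrightarrow> \<exists>l'\<in>overlap U U'. norm l < norm l'"
proof -
  obtain r s where rs: "0 \<le> r" "0 \<le> s" "r * s < 1" "U = {l. s * norm l < 1}" "U' = {m. r * norm m < 1}"
    using assms unfolding sphere_cover_def by blast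
  show "open U" "open U'"
    unfolding rs(4,5) by (intro open_Collect_less continuous_intros)+
  have cv: "convex {l::complex. a * norm l < 1}" if "0 \<le> a" for a
  proof (cases "a = 0")
    case False
    with that have "{l::complex. a * norm l < 1} = ball 0 (inverse a)"
      by (auto simp: field_simps)
    then show ?thesis by simp
  qed auto
  show "convex U" "convex U'" unfolding rs(4,5) using rs(1,2) by (auto intro: cv)
  show "0 \<in> U" "0 \<in> U'" by (simp_all add: rs(4,5))
  show "sphere_cover U' U"
    using rs unfolding sphere_cover_def by (metis mult.commute)
  show "l \<noteq> 0 \<and> inverse l \<in> U'" if "l \<notin> U"
  proof -
    have s: "s * norm l \<ge> 1" using that by (simp add: rs(4))
    then have l: "l \<noteq> 0" by auto
    have "r * 1 \<le> r * (s * norm l)" using s rs(1) by (intro mult_left_mono) auto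
    also have "\<dots> < norm l" using l rs(3) by (simp add: mult.assoc[symmetric])
    finally have "r / norm l < 1" using l by simp
    then show ?thesis using l by (simp add: rs(5) norm_inverse divide_inverse)
  qed
  show "\<exists>l'\<in>overlap U U'. norm l < norm l'" if "l \<in> U"
  proof -
    have "\<exists>t. t > 0 \<and> r < t \<and> s * t < 1 \<and> norm l < t"
    proof (cases "s = 0")
      case True
      with rs(1) show ?thesis by (intro exI[of _ "r + norm l + 1"]) (auto simp: add_nonneg_pos)
    next
      case False
      with rs that have "r < inverse s" "s > 0" "norm l < inverse s" by (auto simp: field_simps)
      then obtain t where "max r (norm l) < t" "t < inverse s" using dense[of "max r (norm l)"] by auto
      with rs(1) \<open>s > 0\<close> show ?thesis
        by (intro exI[of _ t]) (auto simp: field_simps)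
    qed
    then obtain t where "t > 0" "r < t" "s * t < 1" "norm l < t" by blast
    then show ?thesis
      by (intro bexI[of _ "of_real t"]) (auto simp: overlap_def rs(4,5) norm_divide field_simps)
  qed
qed

lemma overlap_swap: "l \<in> overlap U U' \<Longrightarrow> inverse l \<in> overlap U' U"
  by (auto simp: overlap_def)

text \<open>The two functions glue to an entire function with the finite limit \<open>b 0\<close> at
  infinity, to which the classical Liouville theorem applies.\<close>

lemma sphere_cover_liouville:
  assumes "sphere_cover U U'" "a holomorphic_on U" "b holomorphic_on U'"
    "\<And>l. l \<in> overlap U U' \<Longrightarrow> a l = b (inverse l)"
  shows "\<exists>c. (\<forall>l\<in>U. a l = c) \<and> (\<forall>m\<in>U'. b m = c)"
proof -
  note cover = sphere_cover_open[OF assms(1)] sphere_cover_0[OF assms(1)]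
  define g where "g l = (if l \<in> U then a l else b (inverse l))" for l
  have gb: "g l = b (inverse l)" if "l \<noteq> 0" "inverse l \<in> U'" for l
    using that assms(4)[of l] by (auto simp: g_def overlap_def)
  have op: "open {l. l \<noteq> 0 \<and> inverse l \<in> U'}"
  proof -
    have "open ((- {0}) \<inter> inverse -` U')"
      by (rule continuous_open_preimage[OF _ _ cover(2)]) (auto intro!: continuous_intros)
    moreover have "{l. l \<noteq> 0 \<and> inverse l \<in> U'} = (- {0}) \<inter> inverse -` U'" by auto
    ultimately show ?thesis by simp
  qed
  have "\<exists>g'. (g has_field_derivative g') (at l)" for l
  proof (cases "l \<in> U")
    case True
    have "(a has_field_derivative deriv a l) (at l)"
      by (rule holomorphic_derivI[OF assms(2) cover(1) True])
    then have "(g has_field_derivative deriv a l) (at l)"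
      by (rule has_field_derivative_transform_within_open[OF _ cover(1) True]) (simp add: g_def)
    then show ?thesis ..
  next
    case False
    then have l: "l \<in> {l. l \<noteq> 0 \<and> inverse l \<in> U'}"
      using sphere_cover_covers[OF assms(1)] by blast
    then have "(b has_field_derivative deriv b (inverse l)) (at (inverse l))"
      by (intro holomorphic_derivI[OF assms(3) cover(2)]) auto
    from DERIV_chain2[OF this DERIV_inverse[of l]] l
    have "((\<lambda>l. b (inverse l)) has_field_derivative deriv b (inverse l) * - (inverse l ^ Suc (Suc 0))) (at l)"
      by blast
    then have "(g has_field_derivative deriv b (inverse l) * - (inverse l ^ Suc (Suc 0))) (at l)"
      by (rule has_field_derivative_transform_within_open[OF _ op l]) (simp add: gb)
    then show ?thesis ..
  qed
  then have hol: "g holomorphic_on UNIV"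
    by (simp add: holomorphic_on_open)
  have "isCont b 0"
    using assms(3) cover by (meson continuous_on_eq_continuous_at holomorphic_on_imp_continuous_on)
  then have "((\<lambda>l. b (inverse l)) \<longlongrightarrow> b 0) at_infinity"
    by (rule isCont_tendsto_compose[OF _ tendsto_inverse_0])
  moreover have "eventually (\<lambda>l. b (inverse l) = g l) at_infinity"
  proof -
    obtain e where e: "e > 0" "ball 0 e \<subseteq> U'" using cover openE by blast
    have "b (inverse l) = g l" if "inverse e + 1 \<le> norm l" for l
    proof -
      have "0 < inverse e" using e(1) by simp
      with that have "0 < norm l" by linarith
      then have "l \<noteq> 0" by simp
      moreover have "inverse e < norm l" using that by simp
      then have "norm (inverse l) < e"
        using e(1) \<open>l \<noteq> 0\<close> by (simp add: norm_divide field_simps)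
      ultimately show ?thesis using e(2) gb by auto
    qed
    then show ?thesis unfolding eventually_at_infinity by blast
  qed
  ultimately have "(g \<longlongrightarrow> b 0) at_infinity"
    by (rule Lim_transform_eventually)
  then have c: "g l = b 0" for l using Liouville_weak[OF hol] by blast
  have "b m = b 0" if "m \<in> U'" for m
    using gb[of "inverse m"] that c by (cases "m = 0") auto
  moreover have "a l = b 0" if "l \<in> U" for l using c[of l] that by (simp add: g_def)
  ultimately show ?thesis by blast
qed

text \<open>Bundles of negative degree have no sections: \<open>m ^ Suc k * b m\<close> continues
  \<open>a\<close> to the other chart, so it is constant, and it vanishes at
  \<open>m = 0\<close>.\<close>

lemma sphere_cover_liouville_neg:
  assumes "sphere_cover U U'" "a holomorphic_on U" "b holomorphic_on U'"
    "\<And>l. l \<in> overlap U U' \<Longrightarrow> a l = inverse l ^ Suc k * b (inverse l)" "l \<in> U"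
  shows "a l = 0"
proof -
  have "\<exists>c. (\<forall>l\<in>U. a l = c) \<and> (\<forall>m\<in>U'. m ^ Suc k * b m = c)"
    using assms(1-4) by (intro sphere_cover_liouville) (auto intro!: holomorphic_intros simp del: power_Suc)
  then obtain c where c: "\<forall>l\<in>U. a l = c" "\<forall>m\<in>U'. m ^ Suc k * b m = c" by blast
  from c(2) have "c = 0" using sphere_cover_0(2)[OF assms(1)] by (metis mult_zero_left power_0_Suc)
  with c(1) assms(5) show ?thesis by simp
qed

lemma divided_difference:
  assumes "a holomorphic_on U" "open U" "0 \<in> U"
  obtains a1 where "a1 holomorphic_on U" "\<And>l. l \<in> U \<Longrightarrow> a l = a 0 + l * a1 l" "a1 0 = deriv a 0"
proof -
  let ?a = "\<lambda>z. if z = 0 then deriv a 0 else (a z - a 0) / (z - 0)"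
  have "?a holomorphic_on U" using assms by (intro pole_lemma) (auto simp: interior_open)
  then show thesis by (rule that) auto
qed

text \<open>A section of \<open>O(k)\<close> over the sphere is a polynomial of degree \<open>k\<close>.\<close>

lemma sphere_cover_polynomial:
  assumes "sphere_cover U U'" "a holomorphic_on U" "b holomorphic_on U'"
    "\<And>l. l \<in> overlap U U' \<Longrightarrow> a l = l ^ k * b (inverse l)"
  shows "\<exists>c. (\<forall>l\<in>U. a l = (\<Sum>i\<le>k. c i * l ^ i)) \<and> (\<forall>m\<in>U'. b m = (\<Sum>i\<le>k. c i * m ^ (k - i)))"
  using assms(2-4)
proof (induction k arbitrary: a b)
  case 0
  from sphere_cover_liouville[OF assms(1) 0(1,2)] 0(3)
  obtain c where "\<forall>l\<in>U. a l = c" "\<forall>m\<in>U'. b m = c" by auto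
  then show ?case by (intro exI[of _ "\<lambda>_. c"]) auto
next
  case (Suc k)
  obtain a1 where a1: "a1 holomorphic_on U" "\<And>l. l \<in> U \<Longrightarrow> a l = a 0 + l * a1 l"
    using divided_difference[OF Suc(2)] sphere_cover_open[OF assms(1)] sphere_cover_0[OF assms(1)] by metis
  \<comment> \<open>Removing the value at 0 and dividing by \<open>l\<close> lowers the degree. Over
    the other chart this value is the coefficient of the top power of \<open>m\<close>.\<close>
  have "\<exists>c. (\<forall>l\<in>U. a1 l = (\<Sum>i\<le>k. c i * l ^ i)) \<and>
      (\<forall>m\<in>U'. b m - a 0 * m ^ Suc k = (\<Sum>i\<le>k. c i * m ^ (k - i)))"
  proof (rule Suc.IH[OF a1(1)])
    show "(\<lambda>m. b m - a 0 * m ^ Suc k) holomorphic_on U'"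
      using Suc(3) by (intro holomorphic_intros)
    fix l assume l: "l \<in> overlap U U'"
    then have "l \<noteq> 0" "l \<in> U" by (auto simp: overlap_def)
    have "l * a1 l = l ^ Suc k * b (inverse l) - a 0"
      using a1(2)[OF \<open>l \<in> U\<close>] Suc(4)[OF l] by (simp add: algebra_simps)
    moreover have "l ^ Suc k * inverse l ^ Suc k = 1"
      using \<open>l \<noteq> 0\<close> by (simp add: power_mult_distrib[symmetric] del: power_Suc)
    moreover have "l * (l ^ k * (b (inverse l) - a 0 * inverse l ^ Suc k)) =
        l ^ Suc k * b (inverse l) - a 0 * (l ^ Suc k * inverse l ^ Suc k)"
      by (simp add: algebra_simps)
    ultimately have "l * a1 l = l * (l ^ k * (b (inverse l) - a 0 * inverse l ^ Suc k))"
      by (simp only: mult_1_right)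
    then show "a1 l = l ^ k * (b (inverse l) - a 0 * inverse l ^ Suc k)"
      using \<open>l \<noteq> 0\<close> by simp
  qed
  then obtain c where c: "\<forall>l\<in>U. a1 l = (\<Sum>i\<le>k. c i * l ^ i)"
    "\<forall>m\<in>U'. b m - a 0 * m ^ Suc k = (\<Sum>i\<le>k. c i * m ^ (k - i))" by blast
  define c' where "c' i = (case i of 0 \<Rightarrow> a 0 | Suc i \<Rightarrow> c i)" for i
  have "a l = (\<Sum>i\<le>Suc k. c' i * l ^ i)" if "l \<in> U" for l
    using a1(2)[OF that] c(1) that
    by (subst sum.atMost_Suc_shift) (simp add: c'_def sum_distrib_left mult_ac)
  moreover have "b m = (\<Sum>i\<le>Suc k. c' i * m ^ (Suc k - i))" if "m \<in> U'" for m
  proof -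
    have "b m = a 0 * m ^ Suc k + (\<Sum>i\<le>k. c i * m ^ (k - i))" using c(2) that by (metis diff_add_cancel add.commute)
    then show ?thesis by (subst sum.atMost_Suc_shift) (simp add: c'_def)
  qed
  ultimately show ?case by blast
qed

lemma power_series_holomorphic_on_chart:
  assumes "sphere_cover U U'" "\<And>l. l \<in> overlap U U' \<Longrightarrow> summable (\<lambda>n. a n * l ^ n)"
  shows "(\<lambda>l. \<Sum>n. a n * l ^ n) holomorphic_on U"
proof -
  have "(\<lambda>l. \<Sum>n. a n * l ^ n) field_differentiable at l" if l: "l \<in> U" for l
  proof -
    obtain l' where l': "l' \<in> overlap U U'" "norm l < norm l'"
      using sphere_cover_larger[OF assms(1) l] by blast
    have "(\<lambda>l. \<Sum>n. a n * l ^ n) holomorphic_on ball 0 (norm l')"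
    proof (rule power_series_holomorphic)
      fix w :: complex assume "w \<in> ball 0 (cmod l')"
      then have "summable (\<lambda>n. a n * w ^ n)"
        by (intro powser_inside[OF assms(2)[OF l'(1)]]) auto
      then show "(\<lambda>n. a n * (w - 0) ^ n) sums (\<Sum>n. a n * w ^ n)"
        by (simp add: summable_sums)
    qed
    then show ?thesis using l'(2) by (simp add: holomorphic_on_imp_differentiable_at)
  qed
  then show ?thesis by (simp add: holomorphic_on_def field_differentiable_at_within)
qed

text \<open>The Laurent series is a power series in \<open>l\<close> plus \<open>inverse l\<close>
  times one in \<open>inverse l\<close>, holomorphic on the respective charts. By Liouville this
  splitting differs from the given one by a constant, which \<open>deriv q 0\<close> does not
  see.\<close>

lemma laurent_coefficient:
  fixes \<gamma> :: "int \<Rightarrow> complex"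
  assumes "sphere_cover U U'" "p holomorphic_on U" "q holomorphic_on U'"
    and sum: "\<And>l. l \<in> overlap U U' \<Longrightarrow> ((\<lambda>n. \<gamma> n * l powi n) has_sum (p l + q (inverse l))) UNIV"
  shows "\<gamma> (- 1) = deriv q 0"
proof -
  let ?pos = "\<lambda>n. \<gamma> (int n)" and ?neg = "\<lambda>n. \<gamma> (- int n - 1)"
  have sums: "summable (\<lambda>n. ?pos n * l ^ n) \<and> summable (\<lambda>n. ?neg n * inverse l ^ n) \<and>
      p l + q (inverse l) = (\<Sum>n. ?pos n * l ^ n) + inverse l * (\<Sum>n. ?neg n * inverse l ^ n)"
    if l: "l \<in> overlap U U'" for l
  proof -
    have l0: "l \<noteq> 0" using l by (auto simp: overlap_def)
    let ?f = "\<lambda>n. \<gamma> n * l powi n"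
    have s: "?f summable_on UNIV" using sum[OF l] by (auto simp: summable_on_def)
    then have sp: "?f summable_on {0..}" and sn: "?f summable_on {..<0}"
      by (auto intro: summable_on_subset_banach)
    have b1: "bij_betw int UNIV {0..}"
      by (rule bij_betw_byWitness[where f' = nat]) auto
    \<comment> \<open>Negative exponents are enumerated as \<open>- int n - 1\<close>, so the wanted
      coefficient is the constant term of the series in \<open>inverse l\<close>.\<close>
    have b2: "bij_betw (\<lambda>n. - int n - 1) UNIV {..<0}"
      by (rule bij_betw_byWitness[where f' = "\<lambda>k. nat (- k - 1)"]) auto
    have e2: "l powi (- int n - 1) = inverse l * inverse l ^ n" for n
    proof -
      have "- int n - 1 = - int (Suc n)" by simp
      then show ?thesis
        by (simp only: power_int_minus power_int_of_nat) (simp add: power_inverse)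
    qed
    have h1: "((\<lambda>n. ?pos n * l ^ n) has_sum infsum ?f {0..}) UNIV"
      using has_sum_infsum[OF sp] has_sum_reindex_bij_betw[OF b1, of ?f] by simp
    have h2: "((\<lambda>n. ?neg n * (inverse l * inverse l ^ n)) has_sum infsum ?f {..<0}) UNIV"
      using has_sum_infsum[OF sn] has_sum_reindex_bij_betw[OF b2, of ?f] by (simp only: e2)
    have s1: "(\<lambda>n. ?pos n * l ^ n) sums infsum ?f {0..}"
      by (rule has_sum_imp_sums[OF h1])
    have s2: "(\<lambda>n. inverse l * (?neg n * inverse l ^ n)) sums infsum ?f {..<0}"
      using has_sum_imp_sums[OF h2] by (simp add: mult_ac)
    have s3: "summable (\<lambda>n. ?neg n * inverse l ^ n)"
      using sums_summable[OF s2] l0 by (subst (asm) summable_cmult_iff) auto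
    have "(?f has_sum (infsum ?f {0..} + infsum ?f {..<0})) ({0..} \<union> {..<0})"
      by (rule has_sum_Un_disjoint[OF has_sum_infsum[OF sp] has_sum_infsum[OF sn]]) auto
    moreover have "{0..} \<union> {..<0} = (UNIV :: int set)" by auto
    ultimately have "p l + q (inverse l) = infsum ?f {0..} + infsum ?f {..<0}"
      using sum[OF l] has_sum_unique by metis
    then show ?thesis
      using s1 s2 s3 sums_unique[OF s1] sums_unique[OF s2]
      by (simp add: sums_iff suminf_mult)
  qed
  let ?P = "\<lambda>l. \<Sum>n. ?pos n * l ^ n" and ?N = "\<lambda>m. \<Sum>n. ?neg n * m ^ n"
  have P: "?P holomorphic_on U"
    by (rule power_series_holomorphic_on_chart[OF assms(1)]) (use sums in blast)
  have N: "?N holomorphic_on U'"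
  proof (rule power_series_holomorphic_on_chart[OF sphere_cover_swap[OF assms(1)]])
    fix m assume "m \<in> overlap U' U"
    from sums[OF overlap_swap[OF this]] show "summable (\<lambda>n. ?neg n * m ^ n)" by simp
  qed
  have "\<exists>c. (\<forall>l\<in>U. p l - ?P l = c) \<and> (\<forall>m\<in>U'. m * ?N m - q m = c)"
  proof (rule sphere_cover_liouville[OF assms(1)])
    show "p l - ?P l = inverse l * ?N (inverse l) - q (inverse l)" if "l \<in> overlap U U'" for l
      using sums[OF that] by (simp add: algebra_simps)
  qed (intro holomorphic_intros assms P N)+
  then obtain c where c: "\<And>m. m \<in> U' \<Longrightarrow> m * ?N m - q m = c" by blast
  note U' = sphere_cover_open(2)[OF assms(1)] sphere_cover_0(2)[OF assms(1)]
  have "(?N has_field_derivative deriv ?N 0) (at 0)" by (rule holomorphic_derivI[OF N U'])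
  then have "((\<lambda>m. m * ?N m - c) has_field_derivative ?N 0) (at 0)"
    by (auto intro!: derivative_eq_intros)
  then have "(q has_field_derivative ?N 0) (at 0)"
    by (rule has_field_derivative_transform_within_open[OF _ U']) (use c in \<open>auto simp: algebra_simps\<close>)
  then show ?thesis by (simp add: DERIV_imp_deriv)
qed

section \<open>Contour integrals of split functions\<close>

lemma circle_integral_0:
  assumes "p holomorphic_on U" "convex U" "cball 0 t \<subseteq> U" "0 < t"
  shows "(p has_contour_integral 0) (circlepath 0 t)"
  by (rule Cauchy_theorem_convex_simple[OF assms(1,2)])
    (use assms(3,4) in \<open>auto simp: path_image_circlepath_nonneg\<close>)

text \<open>In the coordinate m = 1/l the integrand is the one-form -q(m) dm, which has a primitive
  on the convex chart.\<close>

lemma circle_integral_inverse_square: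
  assumes "q holomorphic_on U'" "convex U'" "open U'" "cball 0 (inverse t) \<subseteq> U'" "0 < t"
  shows "((\<lambda>l. q (inverse l) * inverse l ^ 2) has_contour_integral 0) (circlepath 0 t)"
proof -
  obtain G where G: "\<And>m. m \<in> U' \<Longrightarrow> (G has_field_derivative q m) (at m within U')"
    using holomorphic_convex_primitive'[OF assms(2,3,1)] by blast
  have "((\<lambda>l. - G (inverse l)) has_field_derivative q (inverse l) * inverse l ^ 2) (at l within sphere 0 t)"
    if l: "l \<in> sphere 0 t" for l
  proof -
    have l0: "l \<noteq> 0" using l assms(5) by auto
    have "inverse l \<in> cball 0 (inverse t)" using l by (simp add: norm_inverse)
    then have "inverse l \<in> U'" using assms(4) by blast
    with G assms(3) have "(G has_field_derivative q (inverse l)) (at (inverse l))"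
      by (metis at_within_open)
    from DERIV_chain2[OF this DERIV_inverse[OF l0]]
    have "((\<lambda>l. - G (inverse l)) has_field_derivative - (q (inverse l) * - (inverse l ^ Suc (Suc 0)))) (at l)"
      by (intro DERIV_minus)
    moreover have "- (q (inverse l) * - (inverse l ^ Suc (Suc 0))) = q (inverse l) * inverse l ^ 2"
      by (simp only: numeral_2_eq_2 mult_minus_right minus_minus)
    ultimately show ?thesis
      by (simp only: has_field_derivative_at_within)
  qed
  then show ?thesis
    by (rule Cauchy_theorem_primitive[where S = "sphere 0 t"]) 
      (use assms(5) in \<open>auto simp: path_image_circlepath_nonneg\<close>)
qed

text \<open>Taylor expansion with remainder at the centres of the two charts leaves only the
  monomial 1/l with a non-zero integral. The other terms are holomorphic on \<open>U\<close> or of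
  the form q(1/l) / l^2.\<close>

lemma
  assumes "sphere_cover U U'" "p holomorphic_on U" "q holomorphic_on U'"
    "0 < t" "cball 0 t \<subseteq> U" "cball 0 (inverse t) \<subseteq> U'"
  shows circle_residue: "((\<lambda>l. p l + q (inverse l)) has_contour_integral
      (2 * of_real pi * \<i> * deriv q 0)) (circlepath 0 t)"
    and circle_mean: "((\<lambda>l. inverse l * (p l + q (inverse l))) has_contour_integral
      (2 * of_real pi * \<i> * (p 0 + q 0))) (circlepath 0 t)"
proof -
  note cover = sphere_cover_open[OF assms(1)] sphere_cover_0[OF assms(1)] sphere_cover_convex[OF assms(1)]
  have inv: "((\<lambda>l. inverse l) has_contour_integral 2 * of_real pi * \<i>) (circlepath 0 t)"
    using Cauchy_integral_circlepath_simple[of "\<lambda>_. 1" 0 t 0] assms(4) by (simp add: divide_inverse)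
  have on: "l \<noteq> 0" "l \<in> U" "inverse l \<in> U'" if "l \<in> path_image (circlepath 0 t)" for l
    using that assms(4-6) by (auto simp: path_image_circlepath_nonneg norm_inverse subset_iff)
  obtain q1 where q1: "q1 holomorphic_on U'" "\<And>m. m \<in> U' \<Longrightarrow> q m = q 0 + m * q1 m" "q1 0 = deriv q 0"
    using divided_difference[OF assms(3) cover(2,4)] by metis
  obtain q2 where q2: "q2 holomorphic_on U'" "\<And>m. m \<in> U' \<Longrightarrow> q1 m = q1 0 + m * q2 m"
    using divided_difference[OF q1(1) cover(2,4)] by metis
  obtain p1 where p1: "p1 holomorphic_on U" "\<And>l. l \<in> U \<Longrightarrow> p l = p 0 + l * p1 l"
    using divided_difference[OF assms(2) cover(1,3)] by metis
  have "((\<lambda>l. (p l + q 0) + (inverse l * q1 0 + q2 (inverse l) * inverse l ^ 2)) has_contour_integral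
      (0 + ((2 * of_real pi * \<i>) * q1 0 + 0))) (circlepath 0 t)"
    by (intro has_contour_integral_add circle_integral_0[of _ U] circle_integral_inverse_square[of _ U']
        has_contour_integral_rmul inv holomorphic_intros assms cover q2)
  then have "((\<lambda>l. p l + q (inverse l)) has_contour_integral
      (0 + ((2 * of_real pi * \<i>) * q1 0 + 0))) (circlepath 0 t)"
    by (rule has_contour_integral_eq) (use on q1(2) q2(2) in \<open>auto simp: algebra_simps power2_eq_square\<close>)
  then show "((\<lambda>l. p l + q (inverse l)) has_contour_integral
      (2 * of_real pi * \<i> * deriv q 0)) (circlepath 0 t)"
    by (simp add: q1(3))
  have "((\<lambda>l. p1 l + (inverse l * (p 0 + q 0) + q1 (inverse l) * inverse l ^ 2)) has_contour_integral
      (0 + ((2 * of_real pi * \<i>) * (p 0 + q 0) + 0))) (circlepath 0 t)"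
    by (intro has_contour_integral_add circle_integral_0[of _ U] circle_integral_inverse_square[of _ U']
        has_contour_integral_rmul inv holomorphic_intros assms cover q1 p1)
  then have "((\<lambda>l. inverse l * (p l + q (inverse l))) has_contour_integral
      (0 + ((2 * of_real pi * \<i>) * (p 0 + q 0) + 0))) (circlepath 0 t)"
  proof (rule has_contour_integral_eq)
    fix l assume "l \<in> path_image (circlepath 0 t)"
    note l = on[OF this]
    have "inverse l * l = 1" using l by simp
    then show "p1 l + (inverse l * (p 0 + q 0) + q1 (inverse l) * inverse l ^ 2) =
        inverse l * (p l + q (inverse l))"
      unfolding p1(2)[OF l(2)] q1(2)[OF l(3)] by algebra
  qed
  then show "((\<lambda>l. inverse l * (p l + q (inverse l))) has_contour_integral
      (2 * of_real pi * \<i> * (p 0 + q 0))) (circlepath 0 t)" by simp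
qed

section \<open>Normal bundles of twistor lines\<close>

lemma pair_3: "pair a (v :: complex^3) = a $ 1 * v $ 1 + a $ 2 * v $ 2 + a $ 3 * v $ 3"
  by (simp add: pair_def sum_3)

lemma matrix_2_mult:
  fixes A B :: "complex^2^2"
  shows "(A ** B) $ i $ j = A $ i $ 1 * B $ 1 $ j + A $ i $ 2 * B $ 2 $ j"
  by (simp add: matrix_matrix_mult_def sum_2)

lemma matrix_2_eq_iff:
  fixes A B :: "complex^2^2"
  shows "A = B \<longleftrightarrow> A $ 1 $ 1 = B $ 1 $ 1 \<and> A $ 1 $ 2 = B $ 1 $ 2 \<and> A $ 2 $ 1 = B $ 2 $ 1 \<and> A $ 2 $ 2 = B $ 2 $ 2"
  by (auto simp: vec_eq_iff forall_2)

lemma bounded_linear_pair: "bounded_linear (pair a)"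
proof -
  have "linear (pair a)"
    by (rule linearI) (simp_all add: pair_add, simp add: pair_def scaleR_sum_right)
  then show ?thesis by (simp add: linear_conv_bounded_linear)
qed

lemma Q_section_pair: "Q_section v l = pair (vector [l^2, -1, -2 * l]) v"
  by (simp add: Q_section_def pair_3 algebra_simps)

lemma has_derivative_Q_section:
  "((\<lambda>y. Q_section y l) has_derivative pair (vector [l^2, -1, -2 * l])) (at x)"
  unfolding Q_section_pair[abs_def]
  by (intro bounded_linear_imp_has_derivative bounded_linear_pair)

lemma space_part_nth [simp]:
  "space_part p $ 1 = p $ 2" "space_part p $ 2 = p $ 3" "space_part p $ 3 = p $ 4"
  by (simp_all add: space_part_def)

locale gibbons_hawking =
  fixes U U' :: "complex set" and D :: "(complex^2) set" and f :: "complex \<Rightarrow> complex \<Rightarrow> complex"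
    and X :: "(complex^3) set" and h h' :: "complex^3 \<Rightarrow> complex \<Rightarrow> complex"
  assumes gh: "gh_twistor_space U U' D f X h h'"
begin

lemma cover: "sphere_cover U U'"
  and holo_f: "holo_on (\<lambda>q. f (q $ 1) (q $ 2)) D"
  and open_X: "open X"
  and in_D: "x \<in> X \<Longrightarrow> l \<in> overlap U U' \<Longrightarrow> vector [Q_section x l, l] \<in> D"
  and holo_h: "holo_family_on h X U"
  and holo_h': "holo_family_on h' X U'"
  and split: "x \<in> X \<Longrightarrow> l \<in> overlap U U' \<Longrightarrow> f (Q_section x l) l = h x l - h' x (inverse l)"
  and dense: "lines X \<subseteq> closure {p \<in> lines X. normal_bundle U U' f h p 1 1}"
  using gh unfolding gh_twistor_space_def by auto

lemmas open_U = sphere_cover_open[OF cover]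
lemmas zero_U = sphere_cover_0[OF cover]

lemma overlapD: "l \<in> overlap U U' \<Longrightarrow> l \<noteq> 0" "l \<in> overlap U U' \<Longrightarrow> l \<in> U"
  "l \<in> overlap U U' \<Longrightarrow> inverse l \<in> U'"
  by (auto simp: overlap_def)

section \<open>The differentiated splitting\<close>

definition dh :: "3 \<Rightarrow> complex^3 \<Rightarrow> complex \<Rightarrow> complex" where
  "dh i x l = cpartial i (\<lambda>y. h y l) x"

definition dh' :: "3 \<Rightarrow> complex^3 \<Rightarrow> complex \<Rightarrow> complex" where
  "dh' i x m = cpartial i (\<lambda>y. h' y m) x"

lemma dh_family: "holo_family_on (dh i) X U" and dh'_family: "holo_family_on (dh' i) X U'"
  unfolding dh_def[abs_def] dh'_def[abs_def] by (intro holo_family_cpartial holo_h holo_h')+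

lemma dh_holomorphic: "x \<in> X \<Longrightarrow> dh i x holomorphic_on U" "x \<in> X \<Longrightarrow> dh' i x holomorphic_on U'"
  using holo_family_right dh_family dh'_family by blast+

definition fQ :: "complex^3 \<Rightarrow> complex \<Rightarrow> complex" where
  "fQ x l = deriv (\<lambda>Q. f Q l) (Q_section x l)"

lemma has_derivative_f_line:
  assumes "vector [Q, l] \<in> D"
  shows "((\<lambda>Q. f Q l) has_field_derivative cpartial 1 (\<lambda>q. f (q $ 1) (q $ 2)) (vector [Q, l] :: complex^2)) (at Q)"
proof -
  from has_field_derivative_axis[OF holo_on_has_derivative[OF holo_f assms], of 1]
  have "((\<lambda>s. f (Q + s) l) has_field_derivative cpartial 1 (\<lambda>q. f (q $ 1) (q $ 2)) (vector [Q, l] :: complex^2)) (at 0)"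
    by (simp add: differential_def axis_def)
  then show ?thesis
    using DERIV_shift[of "\<lambda>Q. f Q l" _ 0 Q] by (simp add: add.commute)
qed

lemma fQ_derivative:
  assumes "x \<in> X" "l \<in> overlap U U'"
  shows "((\<lambda>Q. f Q l) has_field_derivative fQ x l) (at (Q_section x l))"
  using has_derivative_f_line[OF in_D[OF assms]] unfolding fQ_def by (metis DERIV_imp_deriv)

text \<open>The line enters \<open>f\<close> only through \<open>Q_section\<close>, whose gradient
  is the vector on the right, so the jumps of all three \<open>dh i\<close> are multiples of the one
  function \<open>fQ\<close>.\<close>

lemma splitting_derivative:
  assumes "x \<in> X" "l \<in> overlap U U'"
  shows "dh i x l - dh' i x (inverse l) = fQ x l * (vector [l^2, -1, -2 * l] :: complex^3) $ i"
proof -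
  note l = overlapD[OF assms(2)]
  have "((\<lambda>y. f (Q_section y l) l) has_derivative (\<lambda>v. fQ x l * pair (vector [l^2, -1, -2 * l]) v)) (at x)"
    using diff_chain_at[OF has_derivative_Q_section fQ_derivative[OF assms, unfolded has_field_derivative_def]]
    by (simp add: o_def)
  then have "((\<lambda>y. h y l - h' y (inverse l)) has_derivative (\<lambda>v. fQ x l * pair (vector [l^2, -1, -2 * l]) v)) (at x)"
    by (rule has_derivative_transform_within_open[OF _ open_X assms(1)]) (simp add: split assms(2))
  moreover have "(\<lambda>v. fQ x l * pair (vector [l^2, -1, -2 * l]) v) = pair (fQ x l *s vector [l^2, -1, -2 * l] :: complex^3)"
    by (auto simp: pair_3 algebra_simps)
  ultimately have "cpartial i (\<lambda>y. h y l - h' y (inverse l)) x = (fQ x l *s vector [l^2, -1, -2 * l] :: complex^3) $ i"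
    by (intro cpartial_eq) simp
  then show ?thesis
    using cpartial_diff[OF holo_family_left[OF holo_h l(2)] holo_family_left[OF holo_h' l(3)] assms(1), of i]
    by (simp add: dh_def dh'_def)
qed

lemma
  assumes "x \<in> X" "l \<in> overlap U U'"
  shows dh_diff_1: "dh 1 x l - dh' 1 x (inverse l) = fQ x l * l^2"
    and dh_diff_2: "dh 2 x l - dh' 2 x (inverse l) = - fQ x l"
    and dh_diff_3: "dh 3 x l - dh' 3 x (inverse l) = - 2 * fQ x l * l"
  using splitting_derivative[OF assms, of 1] splitting_derivative[OF assms, of 2]
    splitting_derivative[OF assms, of 3]
  by simp_all

text \<open>This depends on the splitting, as a function of \<open>x\<close> may be added to both
  \<open>h\<close> and \<open>h'\<close>; the difference of \<open>cc x\<close> and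
  \<open>dh 2 x 0\<close> does not.\<close>

definition cc :: "complex^3 \<Rightarrow> complex" where "cc x = dh' 2 x 0"

text \<open>\<open>bb\<close> is the Laurent coefficient \<open>\<gamma>\<^sub>-\<^sub>1\<close>, that is, \<open>V\<close> up to a constant.\<close>

definition bb :: "complex^3 \<Rightarrow> complex" where "bb x = deriv (dh' 2 x) 0"

text \<open>The combinations on the left eliminate \<open>fQ\<close>, so they are sections of O(2)
  and O(1), hence polynomials. Their coefficients are read off at the centres of the charts.\<close>

lemma
  assumes x: "x \<in> X"
  shows dh_12: "l \<in> U \<Longrightarrow> dh 1 x l + l^2 * dh 2 x l = dh 1 x 0 + bb x * l + cc x * l^2"
    and dh'_12: "m \<in> U' \<Longrightarrow> dh' 2 x m + m^2 * dh' 1 x m = dh 1 x 0 * m^2 + bb x * m + cc x"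
    and dh_32: "l \<in> U \<Longrightarrow> dh 3 x l - 2 * l * dh 2 x l = dh 3 x 0 - 2 * cc x * l"
proof -
  note hol = dh_holomorphic[OF x]
  obtain c where c: "\<And>l. l \<in> U \<Longrightarrow> dh 1 x l + l^2 * dh 2 x l = (\<Sum>i\<le>2. c i * l ^ i)"
    "\<And>m. m \<in> U' \<Longrightarrow> dh' 2 x m + m^2 * dh' 1 x m = (\<Sum>i\<le>2. c i * m ^ (2 - i))"
  proof -
    have "\<exists>c. (\<forall>l\<in>U. dh 1 x l + l^2 * dh 2 x l = (\<Sum>i\<le>2. c i * l ^ i)) \<and>
      (\<forall>m\<in>U'. dh' 2 x m + m^2 * dh' 1 x m = (\<Sum>i\<le>2. c i * m ^ (2 - i)))"
    proof (rule sphere_cover_polynomial[OF cover])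
      fix l assume l: "l \<in> overlap U U'"
      have "l^2 * inverse l ^ 2 = 1"
        using overlapD(1)[OF l] by (simp add: power_mult_distrib[symmetric])
      then show "dh 1 x l + l\<^sup>2 * dh 2 x l = l\<^sup>2 * (dh' 2 x (inverse l) + (inverse l)\<^sup>2 * dh' 1 x (inverse l))"
        using dh_diff_1[OF x l] dh_diff_2[OF x l] by algebra
    qed (intro holomorphic_intros hol)+
    then show thesis using that by blast
  qed
  have c': "dh 1 x l + l^2 * dh 2 x l = c 0 + c 1 * l + c 2 * l^2" if "l \<in> U" for l
    using c(1)[OF that] by (simp add: numeral_2_eq_2)
  have c'': "dh' 2 x m + m^2 * dh' 1 x m = c 0 * m^2 + c 1 * m + c 2" if "m \<in> U'" for m
    using c(2)[OF that] by (simp add: numeral_2_eq_2)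
  have c0: "c 0 = dh 1 x 0" using c'[OF zero_U(1)] by simp
  have c2: "c 2 = cc x" using c''[OF zero_U(2)] by (simp add: cc_def)
  have "(dh' 1 x has_field_derivative deriv (dh' 1 x) 0) (at 0)"
    by (rule holomorphic_derivI[OF hol(2) open_U(2) zero_U(2)])
  \<comment> \<open>The term \<open>m^2 * dh' 1 x m\<close> vanishes to second order at 0, so the
    derivative of \<open>dh' 2 x\<close> there is \<open>c 1\<close>.\<close>
  then have "((\<lambda>m. c 0 * m^2 + c 1 * m + c 2 - m^2 * dh' 1 x m) has_field_derivative c 1) (at 0)"
    by (auto intro!: derivative_eq_intros)
  then have "(dh' 2 x has_field_derivative c 1) (at 0)"
    by (rule has_field_derivative_transform_within_open[OF _ open_U(2) zero_U(2)])
      (use c'' in \<open>auto simp: algebra_simps\<close>)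
  then have c1: "c 1 = bb x" by (simp add: bb_def DERIV_imp_deriv)
  show "l \<in> U \<Longrightarrow> dh 1 x l + l^2 * dh 2 x l = dh 1 x 0 + bb x * l + cc x * l^2"
    using c'[of l] unfolding c0 c1 c2 .
  show "m \<in> U' \<Longrightarrow> dh' 2 x m + m^2 * dh' 1 x m = dh 1 x 0 * m^2 + bb x * m + cc x"
    using c''[of m] unfolding c0 c1 c2 .
  have "\<exists>c. (\<forall>l\<in>U. dh 3 x l - 2 * l * dh 2 x l = (\<Sum>i\<le>1. c i * l ^ i)) \<and>
      (\<forall>m\<in>U'. m * dh' 3 x m - 2 * dh' 2 x m = (\<Sum>i\<le>1. c i * m ^ (1 - i)))"
  proof (rule sphere_cover_polynomial[OF cover])
    fix l assume l: "l \<in> overlap U U'"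
    have "l * inverse l = 1" using overlapD(1)[OF l] by simp
    then show "dh 3 x l - 2 * l * dh 2 x l = l ^ 1 * (inverse l * dh' 3 x (inverse l) - 2 * dh' 2 x (inverse l))"
      using dh_diff_3[OF x l] dh_diff_2[OF x l] unfolding power_one_right by algebra
  qed (intro holomorphic_intros hol)+
  then obtain d where "\<forall>l\<in>U. dh 3 x l - 2 * l * dh 2 x l = (\<Sum>i\<le>1. d i * l ^ i)"
      "\<forall>m\<in>U'. m * dh' 3 x m - 2 * dh' 2 x m = (\<Sum>i\<le>1. d i * m ^ (1 - i))" by blast
  then have d: "\<And>l. l \<in> U \<Longrightarrow> dh 3 x l - 2 * l * dh 2 x l = d 0 + d 1 * l"
    "\<And>m. m \<in> U' \<Longrightarrow> m * dh' 3 x m - 2 * dh' 2 x m = d 0 * m + d 1" by auto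
  show "dh 3 x l - 2 * l * dh 2 x l = dh 3 x 0 - 2 * cc x * l" if "l \<in> U"
  proof -
    have "d 0 = dh 3 x 0" using d(1)[OF zero_U(1)] by simp
    moreover have "d 1 = - 2 * cc x" using d(2)[OF zero_U(2)] by (simp add: cc_def)
    ultimately show ?thesis using d(1)[OF that] by simp
  qed
qed

lemma gh_potential_bb:
  assumes "gh_potential U U' f X V"
  obtains c where "c \<noteq> 0" "\<And>x. x \<in> X \<Longrightarrow> V x = c * bb x"
proof -
  obtain c and \<gamma> :: "int \<Rightarrow> complex^3 \<Rightarrow> complex" where c: "c \<noteq> 0" "\<And>x. x \<in> X \<Longrightarrow> V x = c * \<gamma> (- 1) x"
    and sum: "\<And>x l. x \<in> X \<Longrightarrow> l \<in> overlap U U' \<Longrightarrow> ((\<lambda>n. \<gamma> n x * l powi n) has_sum fQ x l) UNIV"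
    using assms unfolding gh_potential_def fQ_def by blast
  have "\<gamma> (- 1) x = bb x" if x: "x \<in> X" for x
    unfolding bb_def
  proof (rule laurent_coefficient[OF cover])
    fix l assume l: "l \<in> overlap U U'"
    have "- dh 2 x l + dh' 2 x (inverse l) = fQ x l" using dh_diff_2[OF x l] by algebra
    then show "((\<lambda>n. \<gamma> n x * l powi n) has_sum - dh 2 x l + dh' 2 x (inverse l)) UNIV"
      using sum[OF x l] by simp
  qed (use dh_holomorphic[OF x] in \<open>auto intro!: holomorphic_intros\<close>)
  with c that show thesis by simp
qed

lemma normal_patching_eq:
  assumes "space_part p \<in> X" "l \<in> overlap U U'"
  shows "normal_patching f h p l = vector [vector [1, fQ (space_part p) l], vector [0, inverse l ^ 2]]"
proof -
  let ?w = "line h p l"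
  have w: "?w $ 2 = Q_section (space_part p) l" by (simp add: line_def)
  have "((\<lambda>w. f (w $ 2) l) has_derivative (\<lambda>v. fQ (space_part p) l * v $ 2)) (at ?w)"
    using diff_chain_at[OF bounded_linear_imp_has_derivative[OF bounded_linear_vec_nth]
        fQ_derivative[OF assms, unfolded has_field_derivative_def w[symmetric]]]
    by (simp add: o_def)
  then have "((\<lambda>w. w $ 1 + f (w $ 2) l) has_derivative (\<lambda>v. v $ 1 + fQ (space_part p) l * v $ 2)) (at ?w)"
    by (intro has_derivative_add bounded_linear_imp_has_derivative bounded_linear_vec_nth)
  moreover have "(\<lambda>v :: complex^2. v $ 1 + fQ (space_part p) l * v $ 2) = pair (vector [1, fQ (space_part p) l])"
    by (auto simp: pair_def sum_2)
  ultimately have 1: "cpartial i (\<lambda>w. w $ 1 + f (w $ 2) l) ?w = vector [1, fQ (space_part p) l] $ i" for i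
    by (intro cpartial_eq) simp
  have "((\<lambda>w. w $ 2 * inverse l ^ 2) has_derivative (\<lambda>v. v $ 2 * inverse l ^ 2)) (at ?w)"
    by (intro has_derivative_mult_left bounded_linear_imp_has_derivative bounded_linear_vec_nth)
  moreover have "(\<lambda>v :: complex^2. v $ 2 * inverse l ^ 2) = pair (vector [0, inverse l ^ 2])"
    by (auto simp: pair_def sum_2)
  ultimately have 2: "cpartial i (\<lambda>w. w $ 2 * inverse l ^ 2) ?w = vector [0, inverse l ^ 2] $ i" for i
    by (intro cpartial_eq) simp
  have "w $ 2 / l\<^sup>2 = w $ 2 * inverse l ^ 2" for w :: "complex^2"
    by (simp add: divide_inverse power_inverse)
  then have "normal_patching f h p l $ 1 $ i = vector [1, fQ (space_part p) l] $ i"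
    "normal_patching f h p l $ 2 $ i = vector [0, inverse l ^ 2] $ i" for i
    using 1[of i] 2[of i] unfolding normal_patching_def cjacobian_def patching_def by simp_all
  then show ?thesis by (simp add: matrix_2_eq_iff)
qed

subsection \<open>Frames on the jumping lines\<close>

definition pp :: "complex^3 \<Rightarrow> complex \<Rightarrow> complex" where "pp x l = dh 2 x l - cc x"

definition tau :: "complex^3 \<Rightarrow> complex \<Rightarrow> complex" where "tau x m = dh 1 x 0 - dh' 1 x m"

text \<open>In general a term \<open>bb x / l\<close> remains. It represents the class of
  \<open>fQ\<close> in H^1(O(-2)), which is the extension class of the normal bundle as an extension
  of O(2) by O. All other powers of \<open>l\<close> are absorbed by \<open>pp\<close> on
  \<open>U\<close> or by \<open>tau\<close>, with its factor l^-2, on \<open>U'\<close>.\<close>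

lemma fQ_split:
  assumes "x \<in> X" "bb x = 0" "l \<in> overlap U U'"
  shows "fQ x l = inverse l ^ 2 * tau x (inverse l) - pp x l"
  using dh'_12[OF assms(1) overlapD(3)[OF assms(3)]] dh_diff_2[OF assms(1,3)] assms(2)
  unfolding tau_def pp_def by algebra

definition frame :: "complex \<Rightarrow> complex^2^2" where
  "frame p = vector [vector [1, p], vector [0, 1]]"

lemma frame_nth [simp]: "frame p $ 1 $ 1 = 1" "frame p $ 1 $ 2 = p" "frame p $ 2 $ 1 = 0" "frame p $ 2 $ 2 = 1"
  by (simp_all add: frame_def)

lemma frame_inverse: "frame p ** frame (- p) = mat 1"
  by (simp add: matrix_2_eq_iff matrix_2_mult mat_def)

lemma invertible_frame: "invertible (frame p)"
  using frame_inverse[of p] frame_inverse[of "- p"] unfolding invertible_def by auto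

lemma matrix_inv_frame: "matrix_inv (frame p) = frame (- p)"
  using frame_inverse[of p] matrix_inv_left[OF invertible_frame[of p]]
  by (metis matrix_mul_assoc matrix_mul_lid matrix_mul_rid)

lemma splitting_frames_standard:
  assumes "space_part p \<in> X" "bb (space_part p) = 0"
  shows "splitting_frames U U' f h p 0 2 (\<lambda>l. frame (pp (space_part p) l)) (\<lambda>m. frame (tau (space_part p) m))"
proof -
  let ?x = "space_part p"
  have pp: "pp ?x holomorphic_on U" "tau ?x holomorphic_on U'"
    unfolding pp_def[abs_def] tau_def[abs_def] using dh_holomorphic[OF assms(1)]
    by (auto intro!: holomorphic_intros)
  have frame_hol: "(\<lambda>l. frame (g l) $ i $ j) holomorphic_on A" if "g holomorphic_on A" for g A i j
    using exhaust_2[of i] exhaust_2[of j] that by auto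
  show ?thesis
    unfolding splitting_frames_def
  proof (intro conjI ballI allI frame_hol pp invertible_frame)
    fix l assume l: "l \<in> overlap U U'"
    have "l powi (- 2) = inverse l ^ 2" by (simp add: power_int_minus power_inverse)
    then show "normal_patching f h p l = frame (tau ?x (inverse l)) **
        vector [vector [l powi - 0, 0], vector [0, l powi - 2]] ** matrix_inv (frame (pp ?x l))"
      unfolding normal_patching_eq[OF assms(1) l] matrix_inv_frame
      using fQ_split[OF assms l] by (simp add: matrix_2_eq_iff matrix_2_mult algebra_simps)
  qed
qed

lemma jumping_frames_exist:
  assumes "open \<Omega>" "\<And>k. holo_on (\<lambda>u. \<phi> u $ k) \<Omega>"
    and "\<And>u. u \<in> \<Omega> \<Longrightarrow> space_part (\<phi> u) \<in> X" "\<And>u. u \<in> \<Omega> \<Longrightarrow> bb (space_part (\<phi> u)) = 0"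
  shows "jumping_frames U U' f h \<Omega> \<phi> (\<lambda>u l. frame (pp (space_part (\<phi> u)) l))
    (\<lambda>u m. frame (tau (space_part (\<phi> u)) m))"
proof -
  have sp: "holo_on (\<lambda>u. space_part (\<phi> u) $ k) \<Omega>" for k
    using exhaust_3[of k] assms(2) by auto
  have ppt: "holo_family_on pp X U" "holo_family_on tau X U'"
    unfolding pp_def[abs_def] tau_def[abs_def] cc_def[abs_def]
    by (intro holo_family_diff dh_family dh'_family holo_family_parameter open_U
        holo_family_left[OF dh_family zero_U(1)] holo_family_left[OF dh'_family zero_U(2)])+
  have fam: "holo_family_on (\<lambda>u l. pp (space_part (\<phi> u)) l) \<Omega> U"
    "holo_family_on (\<lambda>u m. tau (space_part (\<phi> u)) m) \<Omega> U'"
    using holo_family_compose[OF ppt(1) assms(1) sp] holo_family_compose[OF ppt(2) assms(1) sp] assms(3)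
    by (simp_all add: image_subset_iff)
  have frame_fam: "holo_family_on (\<lambda>u l. frame (g u l) $ i $ j) \<Omega> A"
    if "holo_family_on g \<Omega> A" for g A i j
    using exhaust_2[of i] exhaust_2[of j] that holo_family_open[OF that] by (auto intro: holo_family_const)
  show ?thesis
    unfolding jumping_frames_def
    by (intro conjI allI ballI frame_fam fam splitting_frames_standard assms(3,4))
qed

text \<open>Any two splittings of \<open>O + O(2)\<close> differ by a global automorphism: constants on the diagonal and
  a section of \<open>O(2)\<close> below it.\<close>

lemma splitting_frames_structure:
  assumes "splitting_frames U U' f h p 0 2 H H'" "space_part p \<in> X" "bb (space_part p) = 0"
  shows "\<exists>a b s0 s1 s2. a \<noteq> 0 \<and> b \<noteq> 0 \<and> (\<forall>l\<in>U.
    H l $ 1 $ 1 = a + pp (space_part p) l * (s0 + s1 * l + s2 * l^2) \<and>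
    H l $ 1 $ 2 = pp (space_part p) l * b \<and> H l $ 2 $ 1 = s0 + s1 * l + s2 * l^2 \<and> H l $ 2 $ 2 = b)"
proof -
  let ?x = "space_part p"
  have H: "(\<lambda>l. H l $ i $ j) holomorphic_on U" "(\<lambda>m. H' m $ i $ j) holomorphic_on U'"
    "l \<in> U \<Longrightarrow> invertible (H l)" for i j l
    using assms(1) by (auto simp: splitting_frames_def)
  have pp: "pp ?x holomorphic_on U" "tau ?x holomorphic_on U'"
    unfolding pp_def[abs_def] tau_def[abs_def] using dh_holomorphic[OF assms(2)]
    by (auto intro!: holomorphic_intros)
  have eq: "H l $ 1 $ 1 + fQ ?x l * H l $ 2 $ 1 = H' (inverse l) $ 1 $ 1"
    "H l $ 1 $ 2 + fQ ?x l * H l $ 2 $ 2 = H' (inverse l) $ 1 $ 2 * inverse l ^ 2"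
    "inverse l ^ 2 * H l $ 2 $ 1 = H' (inverse l) $ 2 $ 1"
    "inverse l ^ 2 * H l $ 2 $ 2 = H' (inverse l) $ 2 $ 2 * inverse l ^ 2"
    if l: "l \<in> overlap U U'" for l
  proof -
    let ?d = "vector [vector [l powi - 0, 0], vector [0, l powi - 2]] :: complex^2^2"
    have "normal_patching f h p l ** H l = H' (inverse l) ** ?d ** (matrix_inv (H l) ** H l)"
      using assms(1) l by (simp add: splitting_frames_def matrix_mul_assoc)
    also have "\<dots> = H' (inverse l) ** ?d"
      using matrix_inv_left[OF H(3)[OF overlapD(2)[OF l]]] by simp
    finally have "vector [vector [1, fQ ?x l], vector [0, inverse l ^ 2]] ** H l = H' (inverse l) ** ?d"
      unfolding normal_patching_eq[OF assms(2) l] .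
    moreover have "l powi - 2 = inverse l ^ 2" by (simp add: power_int_minus power_inverse)
    ultimately show "H l $ 1 $ 1 + fQ ?x l * H l $ 2 $ 1 = H' (inverse l) $ 1 $ 1"
      "H l $ 1 $ 2 + fQ ?x l * H l $ 2 $ 2 = H' (inverse l) $ 1 $ 2 * inverse l ^ 2"
      "inverse l ^ 2 * H l $ 2 $ 1 = H' (inverse l) $ 2 $ 1"
      "inverse l ^ 2 * H l $ 2 $ 2 = H' (inverse l) $ 2 $ 2 * inverse l ^ 2"
      by (simp_all add: matrix_2_eq_iff matrix_2_mult)
  qed
  have inv: "l ^ 2 * inverse l ^ 2 = 1" if "l \<in> overlap U U'" for l
    using overlapD(1)[OF that] by (simp add: power_mult_distrib[symmetric])
  have 22: "H l $ 2 $ 2 = H' (inverse l) $ 2 $ 2" if "l \<in> overlap U U'" for l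
    using eq(4)[OF that] overlapD(1)[OF that] by simp
  have "\<exists>a. (\<forall>l\<in>U. H l $ 1 $ 1 - pp ?x l * H l $ 2 $ 1 = a) \<and>
      (\<forall>m\<in>U'. H' m $ 1 $ 1 - tau ?x m * H' m $ 2 $ 1 = a)"
  proof (rule sphere_cover_liouville[OF cover])
    fix l assume l: "l \<in> overlap U U'"
    show "H l $ 1 $ 1 - pp ?x l * H l $ 2 $ 1 =
        H' (inverse l) $ 1 $ 1 - tau ?x (inverse l) * H' (inverse l) $ 2 $ 1"
      unfolding eq(1)[OF l, symmetric] eq(3)[OF l, symmetric] fQ_split[OF assms(2,3) l]
      by (simp add: algebra_simps)
  qed (intro holomorphic_intros H pp)+
  then obtain a where a: "\<And>l. l \<in> U \<Longrightarrow> H l $ 1 $ 1 - pp ?x l * H l $ 2 $ 1 = a" by blast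
  \<comment> \<open>Maps from the O(2) summand to the trivial one are sections of O(-2), so this
    entry vanishes.\<close>
  have 12: "H l $ 1 $ 2 - pp ?x l * H l $ 2 $ 2 = 0" if "l \<in> U" for l
  proof (rule sphere_cover_liouville_neg[OF cover _ _ _ that, where k = 1])
    fix l assume l: "l \<in> overlap U U'"
    show "H l $ 1 $ 2 - pp ?x l * H l $ 2 $ 2 =
        inverse l ^ Suc 1 * (H' (inverse l) $ 1 $ 2 - tau ?x (inverse l) * H' (inverse l) $ 2 $ 2)"
      using eq(2)[OF l] unfolding 22[OF l] fQ_split[OF assms(2,3) l] Suc_1
      by (simp add: algebra_simps)
  qed (intro holomorphic_intros H pp)+
  have "\<exists>b. (\<forall>l\<in>U. H l $ 2 $ 2 = b) \<and> (\<forall>m\<in>U'. H' m $ 2 $ 2 = b)"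
  proof (rule sphere_cover_liouville[OF cover])
    fix l assume l: "l \<in> overlap U U'"
    show "H l $ 2 $ 2 = H' (inverse l) $ 2 $ 2" by (rule 22[OF l])
  qed (intro H)+
  then obtain b where b: "\<And>l. l \<in> U \<Longrightarrow> H l $ 2 $ 2 = b" by blast
  have "\<exists>c. (\<forall>l\<in>U. H l $ 2 $ 1 = (\<Sum>i\<le>2. c i * l ^ i)) \<and>
      (\<forall>m\<in>U'. H' m $ 2 $ 1 = (\<Sum>i\<le>2. c i * m ^ (2 - i)))"
  proof (rule sphere_cover_polynomial[OF cover])
    fix l assume l: "l \<in> overlap U U'"
    show "H l $ 2 $ 1 = l^2 * H' (inverse l) $ 2 $ 1"
      using inv[OF l] unfolding eq(3)[OF l, symmetric] by (simp add: mult.assoc[symmetric])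
  qed (intro H)+
  then obtain c where c: "\<And>l. l \<in> U \<Longrightarrow> H l $ 2 $ 1 = (\<Sum>i\<le>2. c i * l ^ i)" by blast
  have c': "H l $ 2 $ 1 = c 0 + c 1 * l + c 2 * l^2" if "l \<in> U" for l
    using c[OF that] by (simp add: numeral_2_eq_2)
  \<comment> \<open>This determinant equals \<open>a * b\<close>.\<close>
  have "det (H 0) \<noteq> 0" using H(3)[OF zero_U(1)] by (simp add: invertible_det_nz)
  then have "a \<noteq> 0 \<and> b \<noteq> 0"
    using a[OF zero_U(1)] b[OF zero_U(1)] 12[OF zero_U(1)] by (auto simp: det_2 algebra_simps)
  moreover have "H l $ 1 $ 1 = a + pp ?x l * (c 0 + c 1 * l + c 2 * l^2) \<and> H l $ 1 $ 2 = pp ?x l * b"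
    if "l \<in> U" for l
    using a[OF that] b[OF that] 12[OF that] c'[OF that] by (simp add: algebra_simps)
  ultimately show ?thesis using b c' by blast
qed

text \<open>With \<open>bb = 0\<close> the bundle is O + O(2). The O-component of a map from O(1) +
  O(1) consists of sections of O(-1), which vanish, so such a frame would be singular.\<close>

lemma normal_bundle_1_1_bb:
  assumes "space_part p \<in> X" "normal_bundle U U' f h p 1 1"
  shows "bb (space_part p) \<noteq> 0"
proof
  let ?x = "space_part p"
  assume bb: "bb ?x = 0"
  obtain H H' where spl: "splitting_frames U U' f h p 1 1 H H'"
    using assms(2) unfolding normal_bundle_def by blast
  have H: "(\<lambda>l. H l $ i $ j) holomorphic_on U" "(\<lambda>m. H' m $ i $ j) holomorphic_on U'"
    "l \<in> U \<Longrightarrow> invertible (H l)" for i j l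
    using spl by (auto simp: splitting_frames_def)
  have pp: "pp ?x holomorphic_on U" "tau ?x holomorphic_on U'"
    unfolding pp_def[abs_def] tau_def[abs_def] using dh_holomorphic[OF assms(1)]
    by (auto intro!: holomorphic_intros)
  have "H l $ 1 $ j - pp ?x l * H l $ 2 $ j = 0" if "l \<in> U" for l j
  proof (rule sphere_cover_liouville_neg[OF cover _ _ _ that, where k = 0])
    fix l assume l: "l \<in> overlap U U'"
    let ?d = "vector [vector [l powi - 1, 0], vector [0, l powi - 1]] :: complex^2^2"
    have "normal_patching f h p l ** H l = H' (inverse l) ** ?d ** (matrix_inv (H l) ** H l)"
      using spl l by (simp add: splitting_frames_def matrix_mul_assoc)
    also have "\<dots> = H' (inverse l) ** ?d"
      using matrix_inv_left[OF H(3)[OF overlapD(2)[OF l]]] by simp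
    finally have m: "vector [vector [1, fQ ?x l], vector [0, inverse l ^ 2]] ** H l = H' (inverse l) ** ?d"
      unfolding normal_patching_eq[OF assms(1) l] .
    have "H l $ 1 $ j + fQ ?x l * H l $ 2 $ j = H' (inverse l) $ 1 $ j * inverse l"
      "inverse l ^ 2 * H l $ 2 $ j = H' (inverse l) $ 2 $ j * inverse l"
      using m exhaust_2[of j] by (auto simp: matrix_2_eq_iff matrix_2_mult)
    moreover have k: "inverse l * H l $ 2 $ j = H' (inverse l) $ 2 $ j"
      using calculation(2) overlapD(1)[OF l] by (simp add: power2_eq_square mult_ac)
    ultimately show "H l $ 1 $ j - pp ?x l * H l $ 2 $ j =
        inverse l ^ Suc 0 * (H' (inverse l) $ 1 $ j - tau ?x (inverse l) * H' (inverse l) $ 2 $ j)"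
      unfolding k[symmetric] fQ_split[OF assms(1) bb l] by (simp add: algebra_simps power2_eq_square)
  qed (intro holomorphic_intros H pp)+
  then have "det (H 0) = 0"
    using zero_U(1) by (simp add: det_2 algebra_simps)
  then show False using H(3)[OF zero_U(1)] by (simp add: invertible_det_nz)
qed

end

section \<open>Moments of the derivatives of the patching function\<close>

context gibbons_hawking
begin

text \<open>Fixed once and for all, so that all integrals share one contour and relations between
  them reduce to relations between their weights.\<close>

definition rad :: real where
  "rad = (SOME t. t > 0 \<and> (\<forall>l. norm l = t \<longrightarrow> l \<in> overlap U U') \<and> cball 0 t \<subseteq> U \<and> cball 0 (inverse t) \<subseteq> U')"

lemma rad: "rad > 0" "l \<in> sphere 0 rad \<Longrightarrow> l \<in> overlap U U'" "cball 0 rad \<subseteq> U" "cball 0 (inverse rad) \<subseteq> U'"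
proof -
  obtain t where "t > 0 \<and> (\<forall>l. norm l = t \<longrightarrow> l \<in> overlap U U') \<and> cball 0 t \<subseteq> U \<and> cball 0 (inverse t) \<subseteq> U'"
    using sphere_cover_radius[OF cover] by metis
  from someI[of "\<lambda>t. t > 0 \<and> (\<forall>l. norm l = t \<longrightarrow> l \<in> overlap U U') \<and> cball 0 t \<subseteq> U \<and> cball 0 (inverse t) \<subseteq> U'", OF this]
  show "rad > 0" "l \<in> sphere 0 rad \<Longrightarrow> l \<in> overlap U U'" "cball 0 rad \<subseteq> U" "cball 0 (inverse rad) \<subseteq> U'"
    unfolding rad_def[symmetric] by auto
qed

primrec fder :: "nat \<Rightarrow> complex^2 \<Rightarrow> complex" where
  "fder 0 = (\<lambda>q. f (q $ 1) (q $ 2))"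
| "fder (Suc n) = cpartial 1 (fder n)"

lemma holo_fder: "holo_on (fder n) D"
  by (induction n) (auto intro: holo_f holo_on_cpartial)

lemma fder_line:
  assumes "vector [Q, l] \<in> D"
  shows "((\<lambda>Q. fder n (vector [Q, l])) has_field_derivative fder (Suc n) (vector [Q, l])) (at Q)"
proof -
  have "vector [Q, l] + s *s axis 1 1 = (vector [Q + s, l] :: complex^2)" for s
    by (simp add: vec_eq_iff forall_2 axis_def)
  with has_field_derivative_axis[OF holo_on_has_derivative[OF holo_fder assms], of n 1]
  have "((\<lambda>s. fder n (vector [Q + s, l])) has_field_derivative fder (Suc n) (vector [Q, l])) (at 0)"
    by (simp add: differential_def)
  then show ?thesis
    using DERIV_shift[of "\<lambda>Q. fder n (vector [Q, l])" _ 0 Q] by (simp add: add.commute)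
qed

lemma fder_1:
  assumes "x \<in> X" "l \<in> overlap U U'"
  shows "fder 1 (vector [Q_section x l, l]) = fQ x l"
  using fder_line[OF in_D[OF assms], of 0] fQ_derivative[OF assms] DERIV_unique by fastforce

text \<open>A weighted form of Whittaker's contour integral for harmonic functions in three
  dimensions. Order 1 with weight 1 is the potential up to a constant; higher orders with products
  of \<open>Q_section\<close> as weights are its derivatives.\<close>

definition moment :: "nat \<Rightarrow> (complex \<Rightarrow> complex) \<Rightarrow> complex^3 \<Rightarrow> complex" where
  "moment n w x = contour_integral (circlepath 0 rad) (\<lambda>l. w l * fder n (vector [Q_section x l, l]))"

lemma moment_cong: "(\<And>l. l \<in> sphere 0 rad \<Longrightarrow> w l = w' l) \<Longrightarrow> moment n w x = moment n w' x"
  unfolding moment_def using rad(1)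
  by (intro contour_integral_cong) (auto simp: path_image_circlepath_nonneg)

lemma continuous_on_Q_section: "continuous_on A (\<lambda>p. Q_section (fst p) (snd p))"
  unfolding Q_section_def by (intro continuous_intros)

lemma continuous_on_fder:
  "continuous_on (X \<times> sphere 0 rad) (\<lambda>(x, l). fder n (vector [Q_section x l, l]))"
proof -
  have "continuous_on (X \<times> sphere 0 rad) (\<lambda>p. \<chi> i::2. if i = 1 then Q_section (fst p) (snd p) else snd p)"
  proof (rule continuous_on_vec_lambda)
    fix i :: 2
    show "continuous_on (X \<times> sphere 0 rad) (\<lambda>p. if i = 1 then Q_section (fst p) (snd p) else snd p)"
      by (cases "i = 1") (auto intro: continuous_on_Q_section continuous_intros)
  qed
  moreover have "(\<chi> i::2. if i = 1 then Q_section x l else l) = vector [Q_section x l, l]" for x l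
    by (simp add: vec_eq_iff forall_2)
  ultimately have "continuous_on (X \<times> sphere 0 rad) (\<lambda>p. vector [Q_section (fst p) (snd p), snd p] :: complex^2)"
    by simp
  then have "continuous_on (X \<times> sphere 0 rad) (\<lambda>p. fder n (vector [Q_section (fst p) (snd p), snd p]))"
    by (rule continuous_on_compose2[OF holo_on_continuous_on[OF holo_fder]]) (use in_D rad(2) in auto)
  then show ?thesis by (simp add: case_prod_beta')
qed

lemma continuous_on_moment_integrand:
  assumes "continuous_on (sphere 0 rad) w" "x \<in> X"
  shows "continuous_on (sphere 0 rad) (\<lambda>l. w l * fder n (vector [Q_section x l, l]))"
proof -
  have "continuous_on (sphere 0 rad) (\<lambda>l. (\<lambda>(x, l). fder n (vector [Q_section x l, l])) (x, l))"
    by (rule continuous_on_compose2[OF continuous_on_fder continuous_on_Pair[OF continuous_on_const continuous_on_id]])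
      (use assms(2) in auto)
  with assms(1) show ?thesis by (simp add: continuous_on_mult)
qed

lemma moment_sum:
  assumes "\<And>i. i \<in> I \<Longrightarrow> continuous_on (sphere 0 rad) (w i)" "finite I" "x \<in> X"
  shows "moment n (\<lambda>l. \<Sum>i\<in>I. c i * w i l) x = (\<Sum>i\<in>I. c i * moment n (w i) x)"
proof -
  have int: "(\<lambda>l. w i l * fder n (vector [Q_section x l, l])) contour_integrable_on circlepath 0 rad" if "i \<in> I" for i
    by (rule contour_integrable_continuous_circlepath)
      (use rad(1) continuous_on_moment_integrand[OF assms(1)[OF that] assms(3)] in
        \<open>simp add: path_image_circlepath_nonneg\<close>)
  have "moment n (\<lambda>l. \<Sum>i\<in>I. c i * w i l) x =
      contour_integral (circlepath 0 rad) (\<lambda>l. \<Sum>i\<in>I. c i * (w i l * fder n (vector [Q_section x l, l])))"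
    by (simp add: moment_def sum_distrib_right mult.assoc)
  also have "\<dots> = (\<Sum>i\<in>I. contour_integral (circlepath 0 rad)
      (\<lambda>l. c i * (w i l * fder n (vector [Q_section x l, l]))))"
    by (rule contour_integral_sum[OF assms(2)]) (intro contour_integrable_lmul int)
  also have "\<dots> = (\<Sum>i\<in>I. c i * moment n (w i) x)"
    by (rule sum.cong) (simp_all add: moment_def contour_integral_lmul int)
  finally show ?thesis .
qed

lemma moment_scale:
  assumes "continuous_on (sphere 0 rad) w" "x \<in> X"
  shows "moment n (\<lambda>l. c * w l) x = c * moment n w x"
  using moment_sum[of "{()}" "\<lambda>_. w" x n "\<lambda>_. c"] assms by simp

lemma continuous_on_Q: "continuous_on A (Q_section v)"
  unfolding Q_section_def[abs_def] by (intro continuous_intros)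

lemma Q_section_expand: "Q_section v l = (\<Sum>i\<in>UNIV. v $ i * Q_section (axis i 1) l)"
  by (simp add: Q_section_def sum_3 axis_def algebra_simps)

lemma moment_expand:
  assumes "continuous_on (sphere 0 rad) w" "x \<in> X"
  shows "moment n (\<lambda>l. w l * Q_section v l) x =
    pair (\<chi> i. moment n (\<lambda>l. w l * Q_section (axis i 1) l) x) v"
proof -
  have "moment n (\<lambda>l. w l * Q_section v l) x = moment n (\<lambda>l. \<Sum>i\<in>UNIV. v $ i * (w l * Q_section (axis i 1) l)) x"
    by (rule moment_cong) (subst Q_section_expand, simp add: sum_distrib_left mult_ac)
  also have "\<dots> = (\<Sum>i\<in>UNIV. v $ i * moment n (\<lambda>l. w l * Q_section (axis i 1) l) x)"
    by (intro moment_sum continuous_on_mult assms continuous_on_Q) simp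
  finally show ?thesis by (simp add: pair_def mult.commute)
qed

text \<open>\<open>Q_section\<close> is linear in the line, so a derivative in \<open>x\<close>
  raises the order in \<open>Q\<close> by one and multiplies the weight by \<open>Q_section\<close>
  of the direction.\<close>

lemma moment_has_derivative:
  assumes "continuous_on (sphere 0 rad) w" "x \<in> X"
  shows "(moment n w has_derivative
    pair (\<chi> i. moment (Suc n) (\<lambda>l. w l * Q_section (axis i 1) l) x)) (at x)"
proof -
  have "((\<lambda>x. contour_integral (circlepath 0 rad) (\<lambda>l. w l * fder n (vector [Q_section x l, l]))) has_derivative
     (\<lambda>v. contour_integral (circlepath 0 rad)
        (\<lambda>l. w l * Q_section v l * fder (Suc n) (vector [Q_section x l, l])))) (at x)"
  proof (rule has_derivative_circle_integral[OF open_X assms(2) less_imp_le[OF rad(1)]])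
    fix x l assume *: "x \<in> X" "l \<in> sphere (0::complex) rad"
    note d = fder_line[OF in_D[OF *(1) rad(2)[OF *(2)]], of n]
    from diff_chain_at[OF has_derivative_Q_section d[unfolded has_field_derivative_def]]
    have "((\<lambda>x. fder n (vector [Q_section x l, l])) has_derivative
      (\<lambda>v. fder (Suc n) (vector [Q_section x l, l]) * Q_section v l)) (at x)"
      by (simp only: o_def Q_section_pair[symmetric])
    from has_derivative_mult_right[OF this, of "w l"]
    show "((\<lambda>x. w l * fder n (vector [Q_section x l, l])) has_derivative
      (\<lambda>v. w l * Q_section v l * fder (Suc n) (vector [Q_section x l, l]))) (at x)"
      by (simp only: mult_ac)
  next
    show "continuous_on (X \<times> sphere 0 rad) (\<lambda>(x, l). w l * Q_section v l * fder (Suc n) (vector [Q_section x l, l]))" for v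
    proof -
      have "continuous_on (X \<times> sphere 0 rad) (\<lambda>p. w (snd p))" "continuous_on (X \<times> sphere 0 rad) (\<lambda>p. Q_section v (snd p))"
        by (rule continuous_on_compose2[OF assms(1)] continuous_on_compose2[OF continuous_on_Q[of UNIV]];
            auto intro: continuous_on_snd continuous_on_id)+
      then show ?thesis
        using continuous_on_fder[of "Suc n"] by (simp add: case_prod_beta' continuous_on_mult del: fder.simps)
    qed
  qed (rule continuous_on_moment_integrand[OF assms(1)])
  then have "(moment n w has_derivative (\<lambda>v. moment (Suc n) (\<lambda>l. w l * Q_section v l) x)) (at x)"
    by (simp only: moment_def[abs_def])
  moreover have "(\<lambda>v. moment (Suc n) (\<lambda>l. w l * Q_section v l) x) =
      pair (\<chi> i. moment (Suc n) (\<lambda>l. w l * Q_section (axis i 1) l) x)"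
    by (rule ext) (rule moment_expand[OF assms])
  ultimately show ?thesis by (simp only:)
qed

text \<open>On the circle the integrand is a split function with parts \<open>- dh 2 x\<close> and
  \<open>dh' 2 x\<close>; weights 1 and \<open>inverse\<close> extract its Laurent coefficients of
  order -1 and 0.\<close>

lemma moment_1:
  assumes x: "x \<in> X"
  shows "moment 1 (\<lambda>_. 1) x = 2 * of_real pi * \<i> * bb x"
    and "moment 1 inverse x = 2 * of_real pi * \<i> * (cc x - dh 2 x 0)"
proof -
  have fder: "fder 1 (vector [Q_section x l, l]) = - dh 2 x l + dh' 2 x (inverse l)"
    if "l \<in> path_image (circlepath 0 rad)" for l
  proof -
    have l: "l \<in> overlap U U'" using that rad by (simp add: path_image_circlepath_nonneg)
    show ?thesis using fder_1[OF x l] dh_diff_2[OF x l] by (simp add: algebra_simps del: One_nat_def)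
  qed
  have p: "(\<lambda>l. - dh 2 x l) holomorphic_on U" using dh_holomorphic[OF x] by (intro holomorphic_intros)
  note circ = cover p dh_holomorphic(2)[OF x, of 2] rad(1,3,4)
  have "moment 1 (\<lambda>_. 1) x = contour_integral (circlepath 0 rad) (\<lambda>l. - dh 2 x l + dh' 2 x (inverse l))"
    unfolding moment_def by (rule contour_integral_cong) (simp_all add: fder del: One_nat_def)
  then show "moment 1 (\<lambda>_. 1) x = 2 * of_real pi * \<i> * bb x"
    using contour_integral_unique[OF circle_residue[OF circ]] by (simp add: bb_def)
  have "moment 1 inverse x = contour_integral (circlepath 0 rad) (\<lambda>l. inverse l * (- dh 2 x l + dh' 2 x (inverse l)))"
    unfolding moment_def by (rule contour_integral_cong) (simp_all add: fder del: One_nat_def)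
  then show "moment 1 inverse x = 2 * of_real pi * \<i> * (cc x - dh 2 x 0)"
    using contour_integral_unique[OF circle_mean[OF circ]] by (simp add: cc_def)
qed

text \<open>\<open>G0\<close> is the Laurent coefficient \<open>\<gamma>\<^sub>0\<close>, and \<open>dbb\<close> is \<open>2 \<pi> \<i>\<close> times the differential of \<open>bb\<close>.\<close>

definition G0 :: "complex^3 \<Rightarrow> complex" where "G0 x = cc x - dh 2 x 0"

definition dbb :: "complex^3 \<Rightarrow> complex^3" where
  "dbb x = (\<chi> i. moment 2 (\<lambda>l. 1 * Q_section (axis i 1) l) x)"

lemma holo_G0: "holo_on G0 X"
  unfolding G0_def[abs_def] cc_def
  by (intro holo_on_diff holo_family_left[OF dh_family zero_U(1)] holo_family_left[OF dh'_family zero_U(2)])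

text \<open>Both differentials are moments of order 2. For \<open>bb\<close> the weights are l^2, -1
  and -2l, for \<open>G0\<close> these divided by l; here l^2 / l is -1/2 times the third weight and
  -2l / l is twice the second. The weight -1/l is new, but it occurs only in
  \<open>cpartial 2 G0\<close>, which drops out of the wedge product with d\<xi>~.\<close>

lemma
  assumes x: "x \<in> X"
  shows bb_has_derivative: "(bb has_derivative pair ((1 / (2 * of_real pi * \<i>)) *s dbb x)) (at x)"
    and G0_derivative_1: "cpartial 1 G0 x = - ((1 / (2 * of_real pi * \<i>)) * dbb x $ 3) / 2"
    and G0_derivative_3: "cpartial 3 G0 x = 2 * ((1 / (2 * of_real pi * \<i>)) * dbb x $ 2)"
proof -
  let ?k = "1 / (2 * of_real pi * \<i>)"
  have k: "?k * (2 * of_real pi * \<i> * c) = c" for c :: complex by simp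
  have pk: "(\<lambda>v. c * pair a v) = pair (c *s a)" for c and a :: "complex^3"
    by (simp add: pair_def sum_distrib_left mult.assoc fun_eq_iff)
  have cinv: "continuous_on (sphere 0 rad) (inverse :: complex \<Rightarrow> complex)"
    using rad(1) by (intro continuous_intros) auto
  have two: "Suc 1 = 2" by simp
  have "((\<lambda>y. ?k * moment 1 (\<lambda>_. 1) y) has_derivative pair (?k *s dbb x)) (at x)"
    using has_derivative_mult_right[OF moment_has_derivative[OF continuous_on_const x, of 1], of ?k]
    unfolding pk two dbb_def .
  then show "(bb has_derivative pair (?k *s dbb x)) (at x)"
    by (rule has_derivative_transform_within_open[OF _ open_X x]) (simp only: moment_1 k)
  let ?g = "\<chi> i. moment 2 (\<lambda>l. inverse l * Q_section (axis i 1) l) x"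
  have "((\<lambda>y. ?k * moment 1 inverse y) has_derivative pair (?k *s ?g)) (at x)"
    using has_derivative_mult_right[OF moment_has_derivative[OF cinv x, of 1], of ?k]
    unfolding pk two .
  then have G: "(G0 has_derivative pair (?k *s ?g)) (at x)"
    by (rule has_derivative_transform_within_open[OF _ open_X x]) (simp only: moment_1 k G0_def)
  have "?g $ 1 = moment 2 (\<lambda>l. (- 1/2) * (1 * Q_section (axis 3 1) l)) x"
    unfolding vec_lambda_beta
  proof (rule moment_cong)
    fix l :: complex assume "l \<in> sphere 0 rad"
    with rad(1) have "l \<noteq> 0" by auto
    then show "inverse l * Q_section (axis 1 1) l = - 1 / 2 * (1 * Q_section (axis 3 1) l)"
      by (simp add: Q_section_def axis_def power2_eq_square)
  qed
  also have "\<dots> = (- 1/2) * dbb x $ 3"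
    unfolding dbb_def vec_lambda_beta by (intro moment_scale continuous_on_mult continuous_on_Q continuous_on_const x)
  finally have g1: "?g $ 1 = (- 1/2) * dbb x $ 3" .
  have "?g $ 3 = moment 2 (\<lambda>l. 2 * (1 * Q_section (axis 2 1) l)) x"
    unfolding vec_lambda_beta
  proof (rule moment_cong)
    fix l :: complex assume "l \<in> sphere 0 rad"
    with rad(1) have "l \<noteq> 0" by auto
    then show "inverse l * Q_section (axis 3 1) l = 2 * (1 * Q_section (axis 2 1) l)"
      by (simp add: Q_section_def axis_def)
  qed
  also have "\<dots> = 2 * dbb x $ 2"
    unfolding dbb_def vec_lambda_beta by (intro moment_scale continuous_on_mult continuous_on_Q continuous_on_const x)
  finally have g3: "?g $ 3 = 2 * dbb x $ 2" .
  show "cpartial 1 G0 x = - (?k * dbb x $ 3) / 2" "cpartial 3 G0 x = 2 * (?k * dbb x $ 2)"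
    unfolding cpartial_eq[OF G] vector_smult_component g1 g3 by simp_all
qed

section \<open>Taylor coefficients of the potential\<close>

lemma moment_along_line:
  assumes "x + s *s v \<in> X" "continuous_on (sphere 0 rad) w"
  shows "((\<lambda>s. moment n w (x + s *s v)) has_field_derivative
    moment (Suc n) (\<lambda>l. w l * Q_section v l) (x + s *s v)) (at s)"
proof -
  have "((\<lambda>s. x + s *s v) has_derivative (\<lambda>s. s *s v)) (at s)"
    by (auto intro!: derivative_eq_intros bounded_linear.has_derivative[OF bounded_linear_smult_vec])
  from diff_chain_at[OF this moment_has_derivative[OF assms(2,1)]]
  show ?thesis
    unfolding moment_expand[OF assms(2,1), where n = "Suc n" and v = v]
    by (simp add: o_def has_field_derivative_def pair_smult mult_commute_abs del: fder.simps)
qed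

text \<open>On the complex line from \<open>x\<close> (parameter 0) to \<open>y\<close> (parameter
  1) the n-th derivative of \<open>bb\<close> at \<open>x\<close> is, up to a constant, the moment
  in \<open>van\<close>. The line meets the ball in a convex set, so the identity theorem reaches
  \<open>y\<close>.\<close>

lemma bb_zero_near:
  assumes "ball x e \<subseteq> X" "y \<in> ball x e"
    and van: "\<And>n v. moment (Suc n) (\<lambda>l. Q_section v l ^ n) x = 0"
  shows "bb y = 0"
proof -
  define v where "v = y - x"
  define T where "T = {s. x + s *s v \<in> ball x e}"
  have lin: "linear (\<lambda>s. s *s v)"
    using bounded_linear_smult_vec by (rule bounded_linear.linear)
  have Tx: "T = (\<lambda>s. s *s v) -` ball 0 e"
    by (auto simp: T_def dist_norm)
  have "open T"
    unfolding Tx using bounded_linear_smult_vec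
    by (intro open_vimage) (auto intro: linear_continuous_on)
  have "convex T" unfolding Tx using lin by (intro convex_linear_vimage) auto
  have "0 < e" using assms(2) by (metis ball_empty empty_iff not_le)
  then have T01: "0 \<in> T" "1 \<in> T" using assms(2) by (auto simp: T_def v_def)
  let ?g = "\<lambda>n s. moment (Suc n) (\<lambda>l. Q_section v l ^ n) (x + s *s v)"
  have d: "(?g n has_field_derivative ?g (Suc n) s) (at s)" if "s \<in> T" for n s
  proof -
    have "x + s *s v \<in> X" using that assms(1) by (auto simp: T_def)
    from moment_along_line[OF this, of "\<lambda>l. Q_section v l ^ n" "Suc n"]
    show ?thesis by (simp add: continuous_on_Q continuous_on_power mult.commute del: fder.simps)
  qed
  have hol: "?g 0 holomorphic_on T"
    unfolding holomorphic_on_open[OF \<open>open T\<close>] using d[of _ 0] by blast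
  have "(deriv ^^ n) (?g 0) s = ?g n s" if "s \<in> T" for n s
    using that
  proof (induction n arbitrary: s)
    case (Suc n)
    have "((deriv ^^ n) (?g 0) has_field_derivative ?g (Suc n) s) (at s)"
      by (rule has_field_derivative_transform_within_open[OF d[OF Suc.prems] \<open>open T\<close> Suc.prems])
        (rule Suc.IH[symmetric])
    then show ?case by (simp add: DERIV_imp_deriv)
  qed simp
  then have "(deriv ^^ n) (?g 0) 0 = 0" for n
    using van T01(1) by simp
  from holomorphic_fun_eq_0_on_connected[OF hol \<open>open T\<close> convex_connected[OF \<open>convex T\<close>] this T01]
  have "moment 1 (\<lambda>_. 1) y = 0" by (simp add: v_def)
  then show ?thesis
    using moment_1(1)[of y] assms(1,2) by auto
qed

text \<open>Cauchy data on a non-null surface determine a harmonic function: all moments that occur as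
  derivatives of \<open>bb\<close> vanish at the points of the surface, by induction on the order.\<close>

lemma moments_vanish:
  fixes \<psi> :: "complex^3 \<Rightarrow> complex^3"
  assumes "open W" "\<And>k. holo_on (\<lambda>u. \<psi> u $ k) W" "\<And>u. u \<in> W \<Longrightarrow> \<psi> u \<in> X"
    and J: "\<And>u. u \<in> W \<Longrightarrow> cjacobian \<psi> u *v N u = 0 \<and> N u \<noteq> 0"
    and ker: "\<And>u v. u \<in> W \<Longrightarrow> (transpose (cjacobian \<psi> u) ** flat3 ** cjacobian \<psi> u) *v v = 0 \<Longrightarrow> \<exists>c. v = c *s N u"
    and bb: "\<And>u. u \<in> W \<Longrightarrow> bb (\<psi> u) = 0" and dbb: "\<And>u. u \<in> W \<Longrightarrow> dbb (\<psi> u) = 0"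
    and "u \<in> W"
  shows "moment (Suc (length vs)) (\<lambda>l. \<Prod>v\<leftarrow>vs. Q_section v l) (\<psi> u) = 0"
  using \<open>u \<in> W\<close>
proof (induction "length vs" arbitrary: vs u rule: less_induct)
  case less
  have cont: "continuous_on A (\<lambda>l. \<Prod>v\<leftarrow>vs. Q_section v l)" for A vs
    by (induction vs) (auto intro: continuous_on_mult continuous_on_Q)
  have u: "u \<in> W" "\<psi> u \<in> X" using less.prems assms(3) by auto
  consider "vs = []" | v where "vs = [v]" | v w r where "vs = v # w # r"
    by (metis neq_Nil_conv)
  then show ?case
  proof cases
    case 1
    then show ?thesis using moment_1(1)[OF u(2)] bb[OF u(1)] by simp
  next
    case 2
    have "moment 2 (\<lambda>l. 1 * Q_section v l) (\<psi> u) = 0"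
      unfolding moment_expand[OF continuous_on_const u(2), where n = 2 and v = v] dbb_def[symmetric] dbb[OF u(1)]
      by (simp add: pair_def)
    then show ?thesis using 2 by (simp add: numeral_2_eq_2)
  next
    case 3
    define R where "R l = (\<Prod>v\<leftarrow>r. Q_section v l)" for l
    define n where "n = Suc (Suc (Suc (length r)))"
    have contR: "continuous_on A R" for A unfolding R_def[abs_def] by (rule cont)
    \<comment> \<open>The Hessian of the moment with weight \<open>R\<close>, which is two orders
      lower. By the induction hypothesis the gradient of that moment vanishes along the surface,
      whence \<open>MJ\<close>.\<close>
    define M :: "complex^3^3" where
      "M = (\<chi> i j. moment n (\<lambda>l. Q_section (axis i 1) l * R l * Q_section (axis j 1) l) (\<psi> u))"
    have contQR: "continuous_on A (\<lambda>l. Q_section v l * R l)" for A v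
      by (intro continuous_on_mult continuous_on_Q contR)
    have sym: "transpose M = M"
      by (auto simp: M_def transpose_def vec_eq_iff mult_ac)
    have MJ: "M ** cjacobian \<psi> u = 0"
    proof (simp only: vec_eq_iff, intro allI)
      fix i j
      let ?w = "\<lambda>l. Q_section (axis i 1) l * R l"
      have z: "moment (Suc (Suc (length r))) ?w (\<psi> y) = 0" if "y \<in> W" for y
        using less.hyps[of "axis i 1 # r" y] that 3 by (simp add: R_def)
      have hm: "holo_on (moment (Suc (Suc (length r))) ?w) X"
        by (rule holo_onI[OF open_X moment_has_derivative[OF contQR]])
      have "cpartial j (\<lambda>y. moment (Suc (Suc (length r))) ?w (\<psi> y)) u = cpartial j (\<lambda>y. 0) u"
        by (rule cpartial_cong[OF assms(1) u(1) z holo_on_compose[OF hm assms(1,2)]]) (use assms(3) in auto)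
      moreover have "cpartial j (\<lambda>y. moment (Suc (Suc (length r))) ?w (\<psi> y)) u =
        (\<Sum>k\<in>UNIV. M $ i $ k * cjacobian \<psi> u $ k $ j)"
        by (subst cpartial_compose[OF hm assms(1,2) _ u(1)])
          (use assms(3) in \<open>auto simp: M_def n_def cjacobian_def cpartial_eq[OF moment_has_derivative[OF contQR u(2)]]\<close>)
      ultimately show "(M ** cjacobian \<psi> u) $ i $ j = 0 $ i $ j"
        by (simp add: matrix_matrix_mult_def)
    qed
    \<comment> \<open>The Laplace equation, from (-2l)^2 = -4 (l^2)(-1).\<close>
    have trace: "4 * M $ 1 $ 2 + M $ 3 $ 3 = 0"
    proof -
      have "M $ 3 $ 3 = moment n (\<lambda>l. (- 4) * (Q_section (axis 1 1) l * R l * Q_section (axis 2 1) l)) (\<psi> u)"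
        unfolding M_def vec_lambda_beta
        by (rule moment_cong) (simp add: Q_section_def axis_def power2_eq_square)
      also have "\<dots> = (- 4) * M $ 1 $ 2"
        unfolding M_def vec_lambda_beta by (intro moment_scale continuous_on_mult contQR continuous_on_Q u(2))
      finally show ?thesis by simp
    qed
    have M0: "M = 0"
      using tracefree_zero[OF _ _ ker[OF u(1)] sym MJ trace] J[OF u(1)] by blast
    \<comment> \<open>Linearity of the weight in each direction, used here for \<open>w\<close> and
      below for \<open>v\<close>, passes from basis vectors to arbitrary ones.\<close>
    have z: "moment n (\<lambda>l. Q_section (axis i 1) l * R l * Q_section w l) (\<psi> u) = 0" for i w
    proof -
      have "(\<chi> j. moment n (\<lambda>l. Q_section (axis i 1) l * R l * Q_section (axis j 1) l) (\<psi> u)) = M $ i"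
        by (simp add: M_def vec_eq_iff)
      then show ?thesis
        unfolding moment_expand[OF contQR u(2), where n = n and v = w] by (simp add: M0 pair_def)
    qed
    have "moment n (\<lambda>l. (R l * Q_section w l) * Q_section v l) (\<psi> u) = 0"
    proof -
      have "(\<chi> i. moment n (\<lambda>l. R l * Q_section w l * Q_section (axis i 1) l) (\<psi> u)) = 0"
        using z by (simp add: vec_eq_iff mult_ac)
      then show ?thesis
        by (subst moment_expand) (auto intro!: continuous_on_mult contR continuous_on_Q u simp: pair_def)
    qed
    then show ?thesis unfolding 3 by (simp add: n_def R_def mult_ac)
  qed
qed

end

section \<open>The geometry of the hypersurface of jumping lines\<close>

locale jumping_chart = gibbons_hawking +
  fixes \<Omega> :: "(complex^3) set" and \<phi> :: "complex^3 \<Rightarrow> complex^4"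
  assumes chart: "hypersurface_chart {p \<in> lines X. bb (space_part p) = 0} \<Omega> \<phi>"
    and rank_2: "u \<in> \<Omega> \<Longrightarrow> rank (restricted_flat3 \<phi> u) = 2"
begin

abbreviation sp :: "complex^3 \<Rightarrow> complex^3" where "sp u \<equiv> space_part (\<phi> u)"

definition jac :: "complex^3 \<Rightarrow> complex^3^3" where "jac u = cjacobian sp u"

text \<open>The coordinate T of the line at l = 0.\<close>

definition \<psi> :: "complex^3 \<Rightarrow> complex" where "\<psi> u = \<phi> u $ 1 - h (sp u) 0"

text \<open>The first component of the frame section for the frame built from \<open>pp\<close>,
  that is, dT - \<open>pp\<close> dQ. Isolating the exact part leaves only \<open>G0\<close> to be
  differentiated in its exterior derivative.\<close>

definition \<theta>\<^sub>0 :: "complex^3 \<Rightarrow> complex^3" where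
  "\<theta>\<^sub>0 u = (\<chi> j. cpartial j \<psi> u - G0 (sp u) * cpartial j (\<lambda>u. sp u $ 2) u)"

lemma holo_\<phi>: "holo_on (\<lambda>u. \<phi> u $ k) \<Omega>"
  using chart by (simp add: hypersurface_chart_def)

lemma open_\<Omega>: "open \<Omega>"
  by (rule holo_on_open[OF holo_\<phi>])

lemma in_S: "u \<in> \<Omega> \<Longrightarrow> sp u \<in> X" "u \<in> \<Omega> \<Longrightarrow> bb (sp u) = 0" "u \<in> \<Omega> \<Longrightarrow> \<phi> u \<in> lines X"
proof -
  assume "u \<in> \<Omega>"
  then have "\<phi> u \<in> {p \<in> lines X. bb (space_part p) = 0}"
    using chart unfolding hypersurface_chart_def by (metis (no_types, lifting) imageI openin_imp_subset subsetD)
  then show "sp u \<in> X" "bb (sp u) = 0" "\<phi> u \<in> lines X" by (auto simp: lines_def)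
qed

lemma holo_sp: "holo_on (\<lambda>u. sp u $ k) \<Omega>"
  using exhaust_3[of k] holo_\<phi> by auto

lemma sp_image: "sp ` \<Omega> \<subseteq> X"
  using in_S(1) by blast

lemma jac_nth: "jac u $ k $ j = cpartial j (\<lambda>u. sp u $ k) u"
  by (simp add: jac_def cjacobian_def)

lemma holo_jac: "holo_on (\<lambda>u. jac u $ k $ j) \<Omega>"
  unfolding jac_nth by (intro holo_on_cpartial holo_sp)

lemma restricted_flat3_jac: "restricted_flat3 \<phi> u = transpose (jac u) ** flat3 ** jac u"
  by (simp add: restricted_flat3_def jac_def Let_def)

lemma holo_restricted_flat3: "holo_on (\<lambda>u. restricted_flat3 \<phi> u $ i $ j) \<Omega>"
  unfolding restricted_flat3_jac matrix_matrix_mult_def transpose_def vec_lambda_beta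
  by (intro holo_on_sum holo_on_mult open_\<Omega> holo_jac holo_on_const)

lemma holo_h_sp: "l \<in> U \<Longrightarrow> holo_on (\<lambda>u. h (sp u) l) \<Omega>"
  using holo_on_compose[OF holo_family_left[OF holo_h] open_\<Omega> holo_sp sp_image] .

lemma holo_\<psi>: "holo_on \<psi> \<Omega>"
  unfolding \<psi>_def[abs_def] by (intro holo_on_diff holo_\<phi> holo_h_sp zero_U)

lemma holo_G0_sp: "holo_on (\<lambda>u. G0 (sp u)) \<Omega>"
  by (rule holo_on_compose[OF holo_G0 open_\<Omega> holo_sp sp_image])

lemma holo_\<theta>\<^sub>0: "holo_on (\<lambda>u. \<theta>\<^sub>0 u $ j) \<Omega>"
  unfolding \<theta>\<^sub>0_def vec_lambda_beta
  by (intro holo_on_diff holo_on_mult holo_on_cpartial holo_\<psi> holo_G0_sp holo_sp)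

section \<open>The frame section in chart coordinates\<close>

lemma cpartial_T:
  assumes "u \<in> \<Omega>" "l \<in> U"
  shows "cpartial j (\<lambda>u. \<phi> u $ 1 - h (sp u) l) u =
    cpartial j (\<lambda>u. \<phi> u $ 1) u - (\<Sum>k\<in>UNIV. dh k (sp u) l * jac u $ k $ j)"
  unfolding cpartial_diff[OF holo_\<phi> holo_h_sp[OF assms(2)] assms(1)]
    cpartial_compose[OF holo_family_left[OF holo_h assms(2)] open_\<Omega> holo_sp sp_image assms(1)]
  by (simp add: jac_nth dh_def)

lemma \<theta>\<^sub>0_eq:
  assumes "u \<in> \<Omega>"
  shows "\<theta>\<^sub>0 u $ j = cpartial j (\<lambda>u. \<phi> u $ 1) u
    - (dh 1 (sp u) 0 * jac u $ 1 $ j + cc (sp u) * jac u $ 2 $ j + dh 3 (sp u) 0 * jac u $ 3 $ j)"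
  unfolding \<theta>\<^sub>0_def vec_lambda_beta \<psi>_def[abs_def] cpartial_T[OF assms zero_U(1)] jac_nth[symmetric] G0_def
  by (simp add: sum_3 algebra_simps)

text \<open>By \<open>dh_12\<close> and \<open>dh_32\<close>, with \<open>bb\<close> zero, the
  dependence on \<open>l\<close> cancels between dT and \<open>pp\<close> dQ. The result is constant
  in \<open>l\<close>, as a section of the trivial summand must be.\<close>

lemma
  assumes u: "u \<in> \<Omega>" "l \<in> U"
  defines "w Y \<equiv> cjacobian (\<lambda>u. line h (\<phi> u) l) u *v Y"
  shows dQ_line: "w Y $ 2 = Q_section (jac u *v Y) l"
    and dT_line: "w Y $ 1 - pp (sp u) l * w Y $ 2 = pair (\<theta>\<^sub>0 u) Y"
proof -
  have hQ: "holo_on (\<lambda>y. Q_section y l) UNIV"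
    by (rule holo_onI[OF open_UNIV has_derivative_Q_section])
  have 2: "cjacobian (\<lambda>u. line h (\<phi> u) l) u $ 2 $ j =
      l^2 * jac u $ 1 $ j - jac u $ 2 $ j - 2 * l * jac u $ 3 $ j" for j
    using cpartial_compose[OF hQ open_\<Omega> holo_sp _ u(1), of j]
    by (simp add: cjacobian_def line_def cpartial_eq[OF has_derivative_Q_section] jac_nth sum_3)
  have 1: "cjacobian (\<lambda>u. line h (\<phi> u) l) u $ 1 $ j = cpartial j (\<lambda>u. \<phi> u $ 1) u
      - (dh 1 (sp u) l * jac u $ 1 $ j + dh 2 (sp u) l * jac u $ 2 $ j + dh 3 (sp u) l * jac u $ 3 $ j)" for j
    using cpartial_T[OF u] by (simp add: cjacobian_def line_def sum_3)
  show "w Y $ 2 = Q_section (jac u *v Y) l"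
    unfolding w_def by (simp add: matrix_vector_mult_def Q_section_def sum_3 2 algebra_simps)
  have "cjacobian (\<lambda>u. line h (\<phi> u) l) u $ 1 $ j - pp (sp u) l * cjacobian (\<lambda>u. line h (\<phi> u) l) u $ 2 $ j = \<theta>\<^sub>0 u $ j" for j
    unfolding 1 2 \<theta>\<^sub>0_eq[OF u(1)] pp_def
    using dh_12[OF in_S(1)[OF u(1)] u(2)] dh_32[OF in_S(1)[OF u(1)] u(2)] in_S(2)[OF u(1)] by algebra
  then show "w Y $ 1 - pp (sp u) l * w Y $ 2 = pair (\<theta>\<^sub>0 u) Y"
    unfolding w_def by (simp add: matrix_vector_mult_def pair_def sum_3 algebra_simps flip: \<open>\<And>j. _ = \<theta>\<^sub>0 u $ j\<close>)
qed

text \<open>Since \<open>flat3\<close> is non-degenerate, the rank can drop only if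
  \<open>jac u\<close> has a kernel. The chart is an immersion, so it maps a kernel vector to a
  non-zero multiple of d/dt, on which \<open>\<theta>\<^sub>0\<close> does not vanish.\<close>

lemma obtain_kernel:
  assumes u: "u \<in> \<Omega>"
  obtains N where "jac u *v N = 0" "pair (\<theta>\<^sub>0 u) N = 1"
    "\<And>v. (transpose (jac u) ** flat3 ** jac u) *v v = 0 \<Longrightarrow> \<exists>c. v = c *s N"
proof -
  let ?g = "transpose (jac u) ** flat3 ** jac u"
  have rk: "rank ?g = 2" using rank_2[OF u] by (simp add: restricted_flat3_jac)
  have "\<exists>N. jac u *v N = 0 \<and> N \<noteq> 0"
  proof (rule ccontr)
    assume "\<not> ?thesis"
    then have "invertible (jac u)"
      by (metis invertible_left_inverse matrix_left_invertible_ker)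
    then have "det (jac u) \<noteq> 0" by (simp add: invertible_det_nz)
    moreover have "det flat3 \<noteq> 0" by (simp add: flat3_def det_3)
    ultimately have "invertible ?g" by (simp add: invertible_det_nz det_mul det_transpose)
    then have "rank ?g = CARD(3)"
      by (metis invertible_left_inverse matrix_left_invertible_ker rank_eq_card_iff)
    with rk show False by simp
  qed
  then obtain N where N: "jac u *v N = 0" "N \<noteq> 0" by blast
  have "rank (cjacobian \<phi> u) = CARD(3)"
    using chart u by (simp add: hypersurface_chart_def)
  with N(2) have "cjacobian \<phi> u *v N \<noteq> 0" using rank_eq_card_iff by blast
  moreover have "(cjacobian \<phi> u *v N) $ 2 = (jac u *v N) $ 1" "(cjacobian \<phi> u *v N) $ 3 = (jac u *v N) $ 2"
    "(cjacobian \<phi> u *v N) $ 4 = (jac u *v N) $ 3"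
    by (simp_all add: matrix_vector_mult_def cjacobian_def jac_nth)
  ultimately have "(cjacobian \<phi> u *v N) $ 1 \<noteq> 0"
    using N(1) by (auto simp: vec_eq_iff forall_4)
  moreover have "pair (\<theta>\<^sub>0 u) N = (cjacobian \<phi> u *v N) $ 1
      - (dh 1 (sp u) 0 * (jac u *v N) $ 1 + cc (sp u) * (jac u *v N) $ 2 + dh 3 (sp u) 0 * (jac u *v N) $ 3)"
    by (simp add: pair_def \<theta>\<^sub>0_eq[OF u] sum_3 matrix_vector_mult_def cjacobian_def algebra_simps)
  ultimately have t: "pair (\<theta>\<^sub>0 u) N \<noteq> 0" using N(1) by simp
  let ?N = "inverse (pair (\<theta>\<^sub>0 u) N) *s N"
  have JN: "jac u *v ?N = 0" using N(1) by (simp add: vec.scale)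
  moreover have tN: "pair (\<theta>\<^sub>0 u) ?N = 1" using t by (simp add: pair_smult)
  moreover have "\<exists>c. v = c *s ?N" if "?g *v v = 0" for v
  proof (rule rank_2_kernel[OF rk _ _ that])
    show "?N \<noteq> 0" using t N(2) by simp
    show "?g *v ?N = 0" by (simp only: matrix_vector_mul_assoc[symmetric] JN vec.zero)
  qed
  ultimately show thesis by (rule that)
qed

text \<open>\<open>d\<theta>\<^sub>0 = - dG0 \<and> d\<xi>~\<close>, and on the hypersurface the components of \<open>dG0\<close> are, up to a constant,
  those of the Hodge dual of \<open>dV\<close>.\<close>

lemma ext_d_\<theta>\<^sub>0:
  assumes u: "u \<in> \<Omega>"
  shows "ext_d \<theta>\<^sub>0 u $ i $ j =
    (\<Sum>k\<in>UNIV. cpartial k G0 (sp u) * jac u $ k $ j) * jac u $ 2 $ i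
    - (\<Sum>k\<in>UNIV. cpartial k G0 (sp u) * jac u $ k $ i) * jac u $ 2 $ j"
proof -
  have dG: "cpartial i (\<lambda>u. G0 (sp u)) u = (\<Sum>k\<in>UNIV. cpartial k G0 (sp u) * jac u $ k $ i)" for i
    unfolding cpartial_compose[OF holo_G0 open_\<Omega> holo_sp sp_image u] jac_nth ..
  have d: "cpartial i (\<lambda>y. \<theta>\<^sub>0 y $ j) u = cpartial i (cpartial j \<psi>) u
      - (G0 (sp u) * cpartial i (cpartial j (\<lambda>u. sp u $ 2)) u + jac u $ 2 $ j * cpartial i (\<lambda>u. G0 (sp u)) u)" for i j
    unfolding \<theta>\<^sub>0_def vec_lambda_beta
    by (subst cpartial_diff[OF holo_on_cpartial[OF holo_\<psi>]
          holo_on_mult[OF holo_G0_sp holo_on_cpartial[OF holo_sp]] u])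
      (simp add: cpartial_mult[OF holo_G0_sp holo_on_cpartial[OF holo_sp] u] jac_nth
        del: space_part_nth)
  show ?thesis
    unfolding ext_d_def vec_lambda_beta d
      cpartial_commute[OF holo_\<psi> u, of i j] cpartial_commute[OF holo_sp u, of i j] dG
    by (simp add: algebra_simps)
qed

text \<open>Contract d\<alpha> \<and> \<open>\<theta>\<^sub>0\<close> + \<alpha>
  d\<open>\<theta>\<^sub>0\<close> = 0 with the kernel vector \<open>N\<close>. As
  d\<open>\<theta>\<^sub>0\<close> is built from differentials of \<open>sp\<close>, it is
  annihilated by \<open>N\<close>; hence d\<alpha> is a multiple of \<open>\<theta>\<^sub>0\<close>,
  both terms vanish separately, and \<open>gradient_zero\<close> applies.\<close>

lemma dbb_zero:
  assumes u: "u \<in> \<Omega>" and \<alpha>: "holo_on \<alpha> \<Omega>" "\<alpha> u \<noteq> 0"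
    and closed: "ext_d (\<lambda>u. \<alpha> u *s \<theta>\<^sub>0 u) u = 0"
  shows "dbb (sp u) = 0"
proof -
  obtain N where N: "jac u *v N = 0" "pair (\<theta>\<^sub>0 u) N = 1"
    "\<And>v. (transpose (jac u) ** flat3 ** jac u) *v v = 0 \<Longrightarrow> \<exists>c. v = c *s N"
    using obtain_kernel[OF u] by blast
  define da where "da = (\<chi> i. cpartial i \<alpha> u)"
  let ?d = "ext_d \<theta>\<^sub>0 u"
  have e: "da $ i * \<theta>\<^sub>0 u $ j - da $ j * \<theta>\<^sub>0 u $ i + \<alpha> u * ?d $ i $ j = 0" for i j
  proof -
    have "ext_d (\<lambda>u. \<alpha> u *s \<theta>\<^sub>0 u) u $ i $ j = da $ i * \<theta>\<^sub>0 u $ j - da $ j * \<theta>\<^sub>0 u $ i + \<alpha> u * ?d $ i $ j"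
      by (simp add: ext_d_def da_def cpartial_mult[OF \<alpha>(1) holo_\<theta>\<^sub>0 u] algebra_simps)
    then show ?thesis using closed by simp
  qed
  have JN: "(\<Sum>i\<in>UNIV. N $ i * jac u $ k $ i) = 0" for k
    using N(1) by (simp add: vec_eq_iff matrix_vector_mult_def mult.commute)
  have dN: "(\<Sum>i\<in>UNIV. N $ i * ?d $ i $ j) = 0" for j
  proof -
    have "(\<Sum>i\<in>UNIV. N $ i * ?d $ i $ j) =
      (\<Sum>k\<in>UNIV. cpartial k G0 (sp u) * jac u $ k $ j) * (\<Sum>i\<in>UNIV. N $ i * jac u $ 2 $ i)
      - (\<Sum>k\<in>UNIV. cpartial k G0 (sp u) * (\<Sum>i\<in>UNIV. N $ i * jac u $ k $ i)) * jac u $ 2 $ j"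
      unfolding ext_d_\<theta>\<^sub>0[OF u] by (simp add: sum_3 algebra_simps)
    then show ?thesis by (simp add: JN)
  qed
  have da: "da $ j = pair da N * \<theta>\<^sub>0 u $ j" for j
  proof -
    have "0 = (\<Sum>i\<in>UNIV. N $ i * (da $ i * \<theta>\<^sub>0 u $ j - da $ j * \<theta>\<^sub>0 u $ i + \<alpha> u * ?d $ i $ j))"
      by (simp only: e) simp
    also have "\<dots> = pair da N * \<theta>\<^sub>0 u $ j - da $ j * pair (\<theta>\<^sub>0 u) N + \<alpha> u * (\<Sum>i\<in>UNIV. N $ i * ?d $ i $ j)"
      by (simp add: pair_def sum_3 algebra_simps)
    finally show ?thesis by (simp add: N(2) dN)
  qed
  have "da $ i * \<theta>\<^sub>0 u $ j - da $ j * \<theta>\<^sub>0 u $ i = 0" for i j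
    by (subst (1 2) da) simp
  then have d0: "?d $ i $ j = 0" for i j
    using e[of i j] \<alpha>(2) by simp
  let ?k = "1 / (2 * of_real pi * \<i>) :: complex"
  have "?k *s dbb (sp u) = 0"
  proof (rule gradient_zero[OF N(1) _ N(3)])
    show "N \<noteq> 0" using N(2) by (auto simp: pair_def)
    show "(\<Sum>k\<in>UNIV. (?k *s dbb (sp u)) $ k * jac u $ k $ j) = 0" for j
    proof -
      have hb: "holo_on bb X" by (rule holo_onI[OF open_X bb_has_derivative])
      have "cpartial j (\<lambda>u. bb (sp u)) u = cpartial j (\<lambda>u. 0) u"
        by (rule cpartial_cong[OF open_\<Omega> u in_S(2) holo_on_compose[OF hb open_\<Omega> holo_sp sp_image]])
      then show ?thesis
        unfolding cpartial_compose[OF hb open_\<Omega> holo_sp sp_image u] cpartial_eq[OF bb_has_derivative[OF in_S(1)[OF u]]] jac_nth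
        by simp
    qed
    show "(\<Sum>k\<in>UNIV. differential G0 (sp u) $ k * jac u $ k $ i) * jac u $ 2 $ j =
        (\<Sum>k\<in>UNIV. differential G0 (sp u) $ k * jac u $ k $ j) * jac u $ 2 $ i" for i j
      using d0[of i j] unfolding ext_d_\<theta>\<^sub>0[OF u] differential_def by simp
    show "differential G0 (sp u) $ 1 = - (?k *s dbb (sp u)) $ 3 / 2"
      "differential G0 (sp u) $ 3 = 2 * (?k *s dbb (sp u)) $ 2"
      using G0_derivative_1[OF in_S(1)[OF u]] G0_derivative_3[OF in_S(1)[OF u]]
      by (simp_all add: differential_def)
  qed
  moreover have "?k \<noteq> 0" by simp
  ultimately show ?thesis by (simp only: vector_mul_eq_0) blast
qed

text \<open>The factor \<alpha> will be the reciprocal of the constant \<open>a\<close> of an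
  arbitrary frame, which varies with the line.\<close>

lemma torsional:
  assumes \<alpha>: "holo_on \<alpha> \<Omega>" "\<And>u. u \<in> \<Omega> \<Longrightarrow> \<alpha> u \<noteq> 0"
  shows "generically_torsional \<Omega> (\<lambda>u. \<alpha> u *s \<theta>\<^sub>0 u)"
  unfolding generically_torsional_def
proof (rule ccontr)
  let ?A = "{u \<in> \<Omega>. ext_d (\<lambda>u. \<alpha> u *s \<theta>\<^sub>0 u) u \<noteq> 0}"
  assume "\<not> \<Omega> \<subseteq> closure ?A"
  then obtain u0 where u0: "u0 \<in> \<Omega>" "u0 \<notin> closure ?A" by blast
  define W where "W = \<Omega> - closure ?A"
  have W: "open W" "u0 \<in> W" "W \<subseteq> \<Omega>"
    using u0 open_\<Omega> by (auto simp: W_def)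
  have closed: "ext_d (\<lambda>u. \<alpha> u *s \<theta>\<^sub>0 u) u = 0" if "u \<in> W" for u
    using that closure_subset[of ?A] by (auto simp: W_def)
  have "\<exists>N. (jac u *v N = 0 \<and> N \<noteq> 0) \<and>
      (\<forall>v. (transpose (jac u) ** flat3 ** jac u) *v v = 0 \<longrightarrow> (\<exists>c. v = c *s N))" if "u \<in> W" for u
  proof -
    obtain N where "jac u *v N = 0" "pair (\<theta>\<^sub>0 u) N = 1"
      "\<And>v. (transpose (jac u) ** flat3 ** jac u) *v v = 0 \<Longrightarrow> \<exists>c. v = c *s N"
      using obtain_kernel[of u] \<open>u \<in> W\<close> W(3) by blast
    moreover from this have "N \<noteq> 0" by (auto simp: pair_def)
    ultimately show ?thesis by blast
  qed
  then obtain N where N: "\<And>u. u \<in> W \<Longrightarrow> jac u *v N u = 0 \<and> N u \<noteq> 0"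
    "\<And>u v. u \<in> W \<Longrightarrow> (transpose (jac u) ** flat3 ** jac u) *v v = 0 \<Longrightarrow> \<exists>c. v = c *s N u"
    by metis
  have van: "moment (Suc (length vs)) (\<lambda>l. \<Prod>v\<leftarrow>vs. Q_section v l) (sp u0) = 0" for vs
  proof (rule moments_vanish[where W = W and N = N and \<psi> = sp])
    show "holo_on (\<lambda>u. sp u $ k) W" for k
      by (rule holo_on_subset[OF holo_sp W(1,3)])
    show "dbb (sp u) = 0" if "u \<in> W" for u
      using dbb_zero[OF _ \<alpha>(1) \<alpha>(2) closed[OF that]] that W(3) by blast
  qed (use W N in_S in \<open>auto simp: jac_def[symmetric]\<close>)
  have van': "moment (Suc n) (\<lambda>l. Q_section v l ^ n) (sp u0) = 0" for n v
    using van[of "replicate n v"] by (simp add: prod_list_replicate del: fder.simps)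
  obtain e where e: "e > 0" "ball (sp u0) e \<subseteq> X"
    using open_X in_S(1)[OF u0(1)] openE by blast
  have "bounded_linear space_part"
  proof -
    have "linear space_part"
      by (rule linearI) (simp_all add: vec_eq_iff forall_3)
    then show ?thesis by (simp add: linear_conv_bounded_linear)
  qed
  then have op: "open (space_part -` ball (sp u0) e)"
    by (intro open_vimage) (auto intro: linear_continuous_on)
  \<comment> \<open>Density provides a generic line over the ball around \<open>sp u0\<close>; as
    \<open>bb\<close> vanishes on this ball, that contradicts
    \<open>normal_bundle_1_1_bb\<close>.\<close>
  have "\<phi> u0 \<in> closure {p \<in> lines X. normal_bundle U U' f h p 1 1}"
    using in_S(3)[OF u0(1)] dense by blast
  moreover have "\<phi> u0 \<in> space_part -` ball (sp u0) e" using e(1) by simp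
  ultimately have "(space_part -` ball (sp u0) e) \<inter> {p \<in> lines X. normal_bundle U U' f h p 1 1} \<noteq> {}"
    using open_Int_closure_eq_empty[OF op] by blast
  then obtain p where p: "p \<in> lines X" "normal_bundle U U' f h p 1 1" "space_part p \<in> ball (sp u0) e"
    by blast
  have "bb (space_part p) = 0" by (rule bb_zero_near[OF e(2) p(3) van'])
  with normal_bundle_1_1_bb[OF _ p(2)] p(1) show False by (auto simp: lines_def)
qed

lemma twistor_geometry:
  assumes fr: "jumping_frames U U' f h \<Omega> \<phi> H H'"
  shows "\<exists>\<theta> e00 e01 e11. twistor_induced U h \<Omega> \<phi> H \<theta> e00 e01 e11 \<and>
    (\<exists>k \<Gamma>. inverse_spatial_metric \<Omega> \<theta> (\<lambda>u. triad_metric (e00 u) (e01 u) (e11 u)) k \<and>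
      newton_cartan \<Omega> \<theta> k \<Gamma>) \<and> generically_torsional \<Omega> \<theta>"
proof -
  have spl: "splitting_frames U U' f h (\<phi> u) 0 2 (H u) (H' u)" if "u \<in> \<Omega>" for u
    using fr that by (simp add: jumping_frames_def)
  have Hfam: "holo_family_on (\<lambda>u l. H u l $ i $ j) \<Omega> U" for i j
    using fr by (simp add: jumping_frames_def)
  have inv: "invertible (H u l)" if "u \<in> \<Omega>" "l \<in> U" for u l
    using spl that by (simp add: splitting_frames_def)
  define R where "R u a b s0 s1 s2 \<longleftrightarrow> a \<noteq> 0 \<and> b \<noteq> 0 \<and> (\<forall>l\<in>U.
      H u l $ 1 $ 1 = a + pp (sp u) l * (s0 + s1 * l + s2 * l^2) \<and>
      H u l $ 1 $ 2 = pp (sp u) l * b \<and> H u l $ 2 $ 1 = s0 + s1 * l + s2 * l^2 \<and> H u l $ 2 $ 2 = b)"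
    for u a b s0 s1 s2
  have "\<exists>a b s0 s1 s2. R u a b s0 s1 s2" if u: "u \<in> \<Omega>" for u
    unfolding R_def by (rule splitting_frames_structure[OF spl[OF u] in_S(1,2)[OF u]])
  then obtain a b s0 s1 s2 where "\<And>u. u \<in> \<Omega> \<Longrightarrow> R u (a u) (b u) (s0 u) (s1 u) (s2 u)"
    by metis
  then have ab: "\<And>u. u \<in> \<Omega> \<Longrightarrow> a u \<noteq> 0" "\<And>u. u \<in> \<Omega> \<Longrightarrow> b u \<noteq> 0"
    and H: "\<And>u l. u \<in> \<Omega> \<Longrightarrow> l \<in> U \<Longrightarrow>
      H u l $ 1 $ 1 = a u + pp (sp u) l * (s0 u + s1 u * l + s2 u * l^2)"
      "\<And>u l. u \<in> \<Omega> \<Longrightarrow> l \<in> U \<Longrightarrow> H u l $ 1 $ 2 = pp (sp u) l * b u"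
      "\<And>u l. u \<in> \<Omega> \<Longrightarrow> l \<in> U \<Longrightarrow> H u l $ 2 $ 1 = s0 u + s1 u * l + s2 u * l^2"
      "\<And>u l. u \<in> \<Omega> \<Longrightarrow> l \<in> U \<Longrightarrow> H u l $ 2 $ 2 = b u"
    unfolding R_def by blast+
  have holo_b: "holo_on b \<Omega>"
    by (rule holo_on_cong[OF _ holo_family_left[OF Hfam zero_U(1)]]) (rule H(4)[OF _ zero_U(1)])
  \<comment> \<open>The function \<open>a\<close> was chosen pointwise. It equals H_11 -
    \<open>pp\<close> H_21 at l = 0, and inherits holomorphy from the frames.\<close>
  have holo_a: "holo_on a \<Omega>"
  proof -
    have "holo_on (\<lambda>u. pp (sp u) 0) \<Omega>"
      unfolding pp_def cc_def
      by (intro holo_on_diff holo_on_compose[OF _ open_\<Omega> holo_sp sp_image]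
          holo_family_left[OF dh_family zero_U(1)] holo_family_left[OF dh'_family zero_U(2)])
    then have "holo_on (\<lambda>u. H u 0 $ 1 $ 1 - pp (sp u) 0 * H u 0 $ 2 $ 1) \<Omega>"
      by (intro holo_on_diff holo_on_mult holo_family_left[OF Hfam zero_U(1)])
    then show ?thesis
      by (rule holo_on_cong[rotated]) (simp add: H zero_U)
  qed
  define \<theta> where "\<theta> u = inverse (a u) *s \<theta>\<^sub>0 u" for u
  \<comment> \<open>Inverting the triangular frame gives the second component Q/b - s t/(ab), with t
    the value of \<open>\<theta>\<^sub>0\<close> and s the section of O(2). Comparing its
    coefficients with \<open>e00\<close> l^2 - 2 \<open>e01\<close> l - \<open>e11\<close> explains
    the signs and the half of \<open>s1\<close>.\<close>
  define e00 where "e00 u = inverse (b u) *s jac u $ 1 - (s2 u / (a u * b u)) *s \<theta>\<^sub>0 u" for u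
  define e01 where "e01 u = inverse (b u) *s jac u $ 3 + (s1 u / (2 * a u * b u)) *s \<theta>\<^sub>0 u" for u
  define e11 where "e11 u = inverse (b u) *s jac u $ 2 + (s0 u / (a u * b u)) *s \<theta>\<^sub>0 u" for u
  have pair_left: "pair (c *s x + d *s y) Y = c * pair x Y + d * pair y Y"
    "pair (c *s x - d *s y) Y = c * pair x Y - d * pair y Y" "pair (c *s x) Y = c * pair x Y"
    for c d and x y Y :: "complex^3"
    by (simp_all add: pair_3 algebra_simps)
  have pair_jac: "pair (jac u $ i) Y = (jac u *v Y) $ i" for u i Y
    by (simp add: pair_def matrix_vector_mult_def)
  have "twistor_induced U h \<Omega> \<phi> H \<theta> e00 e01 e11"
    unfolding twistor_induced_def
  proof (intro ballI allI)
    fix u l Y assume u: "u \<in> \<Omega>" "l \<in> U"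
    define w where "w = cjacobian (\<lambda>u. line h (\<phi> u) l) u *v Y"
    define t where "t = pair (\<theta>\<^sub>0 u) Y"
    define Q where "Q = Q_section (jac u *v Y) l"
    define s where "s = s0 u + s1 u * l + s2 u * l^2"
    have w2: "w $ 2 = Q" and w1: "w $ 1 = t + pp (sp u) l * Q"
      using dQ_line[OF u, of Y] dT_line[OF u, of Y] by (simp_all add: w_def t_def Q_def algebra_simps)
    define v :: "complex^2" where "v = vector [t / a u, Q / b u - s * t / (a u * b u)]"
    have "H u l *v v = w"
      using ab[OF u(1)] H[OF u, folded s_def] w1 w2
      by (simp add: vec_eq_iff forall_2 matrix_vector_mult_def sum_2 v_def field_simps)
    then have "frame_section h \<phi> H u l Y = matrix_inv (H u l) *v (H u l *v v)"
      by (simp add: frame_section_def w_def)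
    also have "\<dots> = v"
      by (simp add: matrix_vector_mul_assoc matrix_inv_left[OF inv[OF u]])
    finally have fs: "frame_section h \<phi> H u l Y = v" .
    have "v $ 1 = pair (\<theta> u) Y"
      by (simp add: v_def \<theta>_def pair_left t_def divide_inverse mult.commute)
    moreover have "v $ 2 = pair (e00 u) Y * l^2 - 2 * pair (e01 u) Y * l - pair (e11 u) Y"
      using ab[OF u(1)]
      unfolding e00_def e01_def e11_def pair_left pair_jac t_def[symmetric]
      by (simp add: v_def Q_def Q_section_def s_def field_simps)
    ultimately show "frame_section h \<phi> H u l Y $ 1 = pair (\<theta> u) Y \<and>
        frame_section h \<phi> H u l Y $ 2 = pair (e00 u) Y * l^2 - 2 * pair (e01 u) Y * l - pair (e11 u) Y"
      by (simp add: fs)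
  qed
  moreover have "generically_torsional \<Omega> \<theta>"
    unfolding \<theta>_def[abs_def]
    by (rule torsional) (use ab holo_a in \<open>auto intro: holo_on_inverse\<close>)
  moreover have "\<exists>k \<Gamma>. inverse_spatial_metric \<Omega> \<theta> (\<lambda>u. triad_metric (e00 u) (e01 u) (e11 u)) k \<and>
      newton_cartan \<Omega> \<theta> k \<Gamma>"
  proof -
    let ?g = "restricted_flat3 \<phi>"
    define m where "m u = (\<chi> i j. ?g u $ i $ j + \<theta>\<^sub>0 u $ i * \<theta>\<^sub>0 u $ j)" for u
    \<comment> \<open>An explicit formula, so that holomorphy is visible; pointwise this is the
      normalised kernel vector of \<open>obtain_kernel\<close>.\<close>
    define N where "N u = matrix_inv (m u) *v \<theta>\<^sub>0 u" for u
    define k0 where "k0 u = (\<chi> i j. matrix_inv (m u) $ i $ j - N u $ i * N u $ j)" for u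
    have tg: "transpose (?g u) = ?g u" for u
    proof -
      have "transpose flat3 = flat3" by (simp add: flat3_def transpose_def vec_eq_iff forall_3)
      then show ?thesis
        by (simp add: restricted_flat3_jac matrix_transpose_mul transpose_transpose matrix_mul_assoc)
    qed
    have deg: "invertible (m u)" "transpose (k0 u) = k0 u" "k0 u *v \<theta>\<^sub>0 u = 0" "pair (\<theta>\<^sub>0 u) (N u) = 1"
      "?g u ** k0 u = (\<chi> i j. mat 1 $ i $ j - \<theta>\<^sub>0 u $ i * N u $ j)" if u: "u \<in> \<Omega>" for u
    proof -
      obtain N' where N': "jac u *v N' = 0" "pair (\<theta>\<^sub>0 u) N' = 1"
        "\<And>v. ?g u *v v = 0 \<Longrightarrow> \<exists>c. v = c *s N'"
        using obtain_kernel[OF u] unfolding restricted_flat3_jac by blast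
      have gN: "?g u *v N' = 0"
        by (simp only: restricted_flat3_jac matrix_vector_mul_assoc[symmetric] N'(1) vec.zero)
      note D = degenerate_metric_inverse[OF tg gN N'(2,3), folded m_def]
      have NN: "N u = N'" using D(2) by (simp add: N_def)
      show "invertible (m u)" "transpose (k0 u) = k0 u" "k0 u *v \<theta>\<^sub>0 u = 0" "pair (\<theta>\<^sub>0 u) (N u) = 1"
        "?g u ** k0 u = (\<chi> i j. mat 1 $ i $ j - \<theta>\<^sub>0 u $ i * N u $ j)"
        using D N'(2) unfolding k0_def NN by auto
    qed
    have hm: "holo_on (\<lambda>u. m u $ i $ j) \<Omega>" for i j
      unfolding m_def by (simp, intro holo_on_add holo_on_mult holo_restricted_flat3 holo_\<theta>\<^sub>0)
    have hB: "holo_on (\<lambda>u. matrix_inv (m u) $ i $ j) \<Omega>" for i j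
      by (rule holo_on_matrix_inv[OF open_\<Omega> hm deg(1)])
    have hN: "holo_on (\<lambda>u. N u $ i) \<Omega>" for i
      unfolding N_def matrix_vector_mult_def by (simp, intro holo_on_sum holo_on_mult hB holo_\<theta>\<^sub>0 open_\<Omega>)
    \<comment> \<open>The clock scales by 1/a and the triad by 1/b, so the covariant metric scales
      by b^-2, its inverse by b^2 and the dual vector by a.\<close>
    define k where "k u = (\<chi> i j. b u ^ 2 * k0 u $ i $ j)" for u
    define \<sigma> where "\<sigma> u = (\<chi> i j. inverse (b u) ^ 2 * ?g u $ i $ j)" for u
    define N\<^sub>a where "N\<^sub>a u = a u *s N u" for u
    have kv: "k u *v x = b u ^ 2 *s (k0 u *v x)" for u x
      by (simp add: k_def vec_eq_iff matrix_vector_mult_def sum_distrib_left mult.assoc)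
    have sv: "\<sigma> u *v x = inverse (b u) ^ 2 *s (?g u *v x)" for u x
      by (simp add: \<sigma>_def vec_eq_iff matrix_vector_mult_def sum_distrib_left mult.assoc)
    note NC = newton_cartan_exists[where \<Omega> = \<Omega> and \<theta> = \<theta> and N = N\<^sub>a and k = k and \<sigma> = \<sigma>
        and q = "\<lambda>u. triad_metric (e00 u) (e01 u) (e11 u)"]
    have P: "open \<Omega>" "\<And>i. holo_on (\<lambda>u. \<theta> u $ i) \<Omega>" "\<And>i. holo_on (\<lambda>u. N\<^sub>a u $ i) \<Omega>"
      "\<And>i j. holo_on (\<lambda>u. k u $ i $ j) \<Omega>" "\<And>i j. holo_on (\<lambda>u. \<sigma> u $ i $ j) \<Omega>"
      unfolding \<theta>_def N\<^sub>a_def k_def k0_def \<sigma>_def vector_smult_component vec_lambda_beta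
      by (intro open_\<Omega> holo_on_mult holo_on_diff holo_on_power holo_on_inverse holo_a holo_b holo_\<theta>\<^sub>0 hN hB
          holo_restricted_flat3; simp add: ab)+
    have Q: "transpose (k u) = k u" "transpose (\<sigma> u) = \<sigma> u" "k u *v \<theta> u = 0" "pair (\<theta> u) (N\<^sub>a u) = 1"
      "\<sigma> u ** k u = (\<chi> i j. mat 1 $ i $ j - \<theta> u $ i * N\<^sub>a u $ j)" if u: "u \<in> \<Omega>" for u
    proof -
      show "transpose (k u) = k u"
        using deg(2)[OF u] by (auto simp: k_def transpose_def vec_eq_iff)
      show "transpose (\<sigma> u) = \<sigma> u"
        using tg[of u] by (auto simp: \<sigma>_def transpose_def vec_eq_iff)
      show "k u *v \<theta> u = 0"
        using deg(3)[OF u] by (simp add: kv \<theta>_def vec.scale)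
      show "pair (\<theta> u) (N\<^sub>a u) = 1"
        using deg(4)[OF u] ab(1)[OF u] by (simp add: \<theta>_def N\<^sub>a_def pair_smult pair_left)
      have "(\<sigma> u ** k u) $ i $ j = (?g u ** k0 u) $ i $ j" for i j
      proof -
        have "inverse (b u) ^ 2 * b u ^ 2 = 1"
          using ab(2)[OF u] by (simp add: power_mult_distrib[symmetric])
        then have "inverse (b u) ^ 2 * x * (b u ^ 2 * y) = x * y" for x y by algebra
        then show ?thesis by (simp only: matrix_matrix_mult_def \<sigma>_def k_def vec_lambda_beta)
      qed
      then show "\<sigma> u ** k u = (\<chi> i j. mat 1 $ i $ j - \<theta> u $ i * N\<^sub>a u $ j)"
        using ab(1)[OF u] by (simp add: vec_eq_iff deg(5)[OF u] \<theta>_def N\<^sub>a_def)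
    qed
    \<comment> \<open>On \<open>ker \<theta>\<close> the multiples of
      \<open>\<theta>\<^sub>0\<close> in the triad vanish, and what remains is the restricted flat
      metric divided by b^2.\<close>
    have R: "triad_metric (e00 u) (e01 u) (e11 u) X Y = pair X (\<sigma> u *v Y)"
      if u: "u \<in> \<Omega>" and X: "pair (\<theta> u) X = 0" and Y: "pair (\<theta> u) Y = 0" for u X Y
    proof -
      have "pair (\<theta>\<^sub>0 u) X = 0" "pair (\<theta>\<^sub>0 u) Y = 0"
        using X Y ab(1)[OF u] by (auto simp: \<theta>_def pair_left)
      then have "triad_metric (e00 u) (e01 u) (e11 u) X Y =
          inverse (b u) ^ 2 * pair (jac u *v X) (flat3 *v (jac u *v Y))"
        unfolding triad_metric_def e00_def e01_def e11_def pair_left pair_jac flat3_pair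
        by (simp add: power2_eq_square algebra_simps add_divide_distrib)
      also have "\<dots> = pair X (\<sigma> u *v Y)"
        unfolding sv pair_smult restricted_flat3_jac pair_restricted ..
      finally show ?thesis .
    qed
    show ?thesis using NC[OF P Q R] by blast
  qed
  ultimately show ?thesis by blast
qed

end

theorem theorem3p5:
  fixes U U' :: "complex set" and D :: "(complex^2) set"
    and f :: "complex \<Rightarrow> complex \<Rightarrow> complex"
    and X :: "(complex^3) set" and h h' :: "complex^3 \<Rightarrow> complex \<Rightarrow> complex"
    and V :: "complex^3 \<Rightarrow> complex" and A :: "complex^3 \<Rightarrow> complex^3"
  assumes "gh_twistor_space U U' D f X h h'"
    and "gh_moduli_space U U' f X h h' V A"
  shows "(\<forall>p\<in>lines X. V (space_part p) = 0 \<longrightarrow> normal_bundle U U' f h p 0 2) \<and>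
    (\<forall>\<Omega> \<phi>. hypersurface_chart {p \<in> lines X. V (space_part p) = 0} \<Omega> \<phi> \<longrightarrow>
      (\<forall>u\<in>\<Omega>. rank (restricted_flat3 \<phi> u) = 2) \<longrightarrow>
      (\<exists>H H'. jumping_frames U U' f h \<Omega> \<phi> H H') \<and>
      (\<forall>H H'. jumping_frames U U' f h \<Omega> \<phi> H H' \<longrightarrow>
        (\<exists>\<theta> e00 e01 e11.
          twistor_induced U h \<Omega> \<phi> H \<theta> e00 e01 e11 \<and>
          (\<exists>k \<Gamma>. inverse_spatial_metric \<Omega> \<theta> (\<lambda>u. triad_metric (e00 u) (e01 u) (e11 u)) k \<and>
            newton_cartan \<Omega> \<theta> k \<Gamma>) \<and>
          generically_torsional \<Omega> \<theta>)))"
proof -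
  interpret gibbons_hawking U U' D f X h h'
    using assms(1) by unfold_locales
  obtain c where c: "c \<noteq> 0" "\<And>x. x \<in> X \<Longrightarrow> V x = c * bb x"
    using gh_potential_bb assms(2) unfolding gh_moduli_space_def by blast
  have V: "V (space_part p) = 0 \<longleftrightarrow> bb (space_part p) = 0" if "p \<in> lines X" for p
    using c that by (simp add: lines_def)
  show ?thesis
  proof (intro conjI ballI allI impI)
    fix p assume "p \<in> lines X" "V (space_part p) = 0"
    then show "normal_bundle U U' f h p 0 2"
      using splitting_frames_standard[of p] V unfolding normal_bundle_def lines_def by blast
  next
    fix \<Omega> \<phi> assume chart: "hypersurface_chart {p \<in> lines X. V (space_part p) = 0} \<Omega> \<phi>"
      and rank: "\<forall>u\<in>\<Omega>. rank (restricted_flat3 \<phi> u) = 2"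
    have "{p \<in> lines X. V (space_part p) = 0} = {p \<in> lines X. bb (space_part p) = 0}"
      using V by blast
    with chart rank interpret jumping_chart U U' D f X h h' \<Omega> \<phi>
      by unfold_locales simp_all
    show "\<exists>H H'. jumping_frames U U' f h \<Omega> \<phi> H H'"
      using jumping_frames_exist[OF open_\<Omega> holo_\<phi> in_S(1,2)] by blast
    fix H H' assume "jumping_frames U U' f h \<Omega> \<phi> H H'"
    then show "\<exists>\<theta> e00 e01 e11.
          twistor_induced U h \<Omega> \<phi> H \<theta> e00 e01 e11 \<and>
          (\<exists>k \<Gamma>. inverse_spatial_metric \<Omega> \<theta> (\<lambda>u. triad_metric (e00 u) (e01 u) (e11 u)) k \<and>
            newton_cartan \<Omega> \<theta> k \<Gamma>) \<and>
          generically_torsional \<Omega> \<theta>"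
      by (rule twistor_geometry)
  qed
qed

end
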